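(* Let $k$ be an algebraically closed field of odd characteristic, let $n\ge 1$ and $G=SL_{n+1}(k)$. If $n=1$, every conjugacy class of $G$ is spherical. If $n\ge 2$ then: (1) every spherical conjugacy class of $G$ is, up to multiplication by an element of $Z(G)$, either semisimple or unipotent; (2) a semisimple class $\mathcal{O}_s$ is spherical if and only if the matrix $s$ has at most two distinct eigenvalues, and in this case $\mathcal{O}_s$ is a symmetric space; (3) a nontrivial unipotent class is spherical if and only if the partition of $n+1$ given by its Jordan block sizes is of the form $(2^m,1^{n+1-2m})$ for some $m\in\{1,\ldots,\left[\frac{n+1}{2}\right]\}$.
   Context: For $x\in G$, $\mathcal{O}_x\simeq G/G_x$ denotes the $G$-conjugacy class of $x$, where $G_x$ is the centralizer of $x$. A conjugacy class (more generally a homogeneous space $G/H$) is called spherical if some Borel subgroup of $G$ has a dense orbit on it for the Zariski topology. A homogeneous space $G/H$ is called a symmetric space if there is an algebraic group automorphism $\theta$ of $G$ with $\theta^2=1$ such that $(G^\theta)^\circ\subseteq H\subseteq G^\theta$; a class $\mathcal{O}_s$ is symmetric if $G/G_s$ is. In a partition, exponents denote multiplicities; $[\cdot]$ is the integer part. *)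

theory Defs
  imports
    "HOL-Analysis.Abstract_Topology_2"
    "HOL-Algebra.Group_Action"
    "HOL-Algebra.Solvable_Groups"
    "HOL-Computational_Algebra.Polynomial"
    "HOL-Library.Multiset"
    "Jordan_Normal_Form.Jordan_Normal_Form"
    "Jordan_Normal_Form.Spectral_Radius"
begin

(* hides the HOL-Algebra closure operator, which clashes with topological closure *)
no_notation eq_closure_of (\<open>closure'_of\<index>\<close>)

definition special_linear :: "nat \<Rightarrow> 'a::field mat monoid" where
  "special_linear N =
     \<lparr>carrier = {A \<in> carrier_mat N N. det A = 1}, monoid.mult = (*), one = 1\<^sub>m N\<rparr>"

lemma group_special_linear: "group (special_linear N)"
proof (rule groupI)
  fix A :: "'a mat"
  assume "A \<in> carrier (special_linear N)"
  then have A: "A \<in> carrier_mat N N" and d: "det A = 1"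
    by (auto simp: special_linear_def)
  have "adj_mat A * A = 1\<^sub>m N" "det (adj_mat A) = 1" "adj_mat A \<in> carrier_mat N N"
  proof -
    show "adj_mat A * A = 1\<^sub>m N" using adj_mat(3)[OF A] d by (auto intro!: eq_matI)
    show c: "adj_mat A \<in> carrier_mat N N" using adj_mat(1)[OF A] .
    show "det (adj_mat A) = 1"
      using det_mult[OF c A] \<open>adj_mat A * A = 1\<^sub>m N\<close> d by simp
  qed
  then show "\<exists>B\<in>carrier (special_linear N). B \<otimes>\<^bsub>special_linear N\<^esub> A = \<one>\<^bsub>special_linear N\<^esub>"
    by (auto simp: special_linear_def)
qed (auto simp: special_linear_def det_mult assoc_mult_mat)


subsection \<open>Zariski topology\<close>

inductive_set polynomial_funs :: "nat \<Rightarrow> ('a::field mat \<Rightarrow> 'a) set" for N where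
  const: "(\<lambda>_. c) \<in> polynomial_funs N"
| entry: "i < N \<Longrightarrow> j < N \<Longrightarrow> (\<lambda>A. A $$ (i, j)) \<in> polynomial_funs N"
| add: "f \<in> polynomial_funs N \<Longrightarrow> g \<in> polynomial_funs N \<Longrightarrow> (\<lambda>A. f A + g A) \<in> polynomial_funs N"
| mult: "f \<in> polynomial_funs N \<Longrightarrow> g \<in> polynomial_funs N \<Longrightarrow> (\<lambda>A. f A * g A) \<in> polynomial_funs N"

definition zero_locus :: "nat \<Rightarrow> ('a::field mat \<Rightarrow> 'a) set \<Rightarrow> 'a mat set" where
  "zero_locus N F = {A \<in> carrier_mat N N. \<forall>f\<in>F. f A = 0}"

definition zariski :: "nat \<Rightarrow> 'a::field mat topology" where
  "zariski N = topology (\<lambda>U. \<exists>F \<subseteq> polynomial_funs N. U = carrier_mat N N - zero_locus N F)"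

lemma zero_locus_Un_products:
  "zero_locus N {(\<lambda>A. f A * g A) | f g. f \<in> F \<and> g \<in> G} = zero_locus N F \<union> zero_locus N G"
proof -
  have "(\<forall>h\<in>{(\<lambda>A. f A * g A) | f g. f \<in> F \<and> g \<in> G}. h A = 0) \<longleftrightarrow>
    (\<forall>f\<in>F. f A = 0) \<or> (\<forall>g\<in>G. g A = 0)" (is "?L \<longleftrightarrow> ?R") for A
  proof
    assume L: ?L
    have "f A * g A = 0" if "f \<in> F" "g \<in> G" for f g
      by (rule bspec[OF L, of "\<lambda>A. f A * g A"]) (use that in blast)
    then show ?R
      unfolding mult_eq_0_iff by meson
  next
    assume ?R
    show ?L
    proof
      fix h assume "h \<in> {(\<lambda>A. f A * g A) | f g. f \<in> F \<and> g \<in> G}"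
      then obtain f g where "f \<in> F" "g \<in> G" and h: "h = (\<lambda>A. f A * g A)"
        by (elim CollectE exE conjE)
      with \<open>?R\<close> have "f A = 0 \<or> g A = 0"
        by meson
      then show "h A = 0"
        unfolding h mult_eq_0_iff .
    qed
  qed
  then show ?thesis
    unfolding zero_locus_def by (simp only: Collect_disj_eq[symmetric] conj_disj_distribL)
qed

lemma istopology_zariski:
  "istopology (\<lambda>U. \<exists>F \<subseteq> polynomial_funs N. U = carrier_mat N N - zero_locus N F)"
  unfolding istopology_def
proof (intro conjI allI impI)
  fix S T :: "'a mat set"
  assume "\<exists>F \<subseteq> polynomial_funs N. S = carrier_mat N N - zero_locus N F"
  then obtain F where F: "F \<subseteq> polynomial_funs N" and S: "S = carrier_mat N N - zero_locus N F"
    by blast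
  assume "\<exists>F \<subseteq> polynomial_funs N. T = carrier_mat N N - zero_locus N F"
  then obtain G where G: "G \<subseteq> polynomial_funs N" and T: "T = carrier_mat N N - zero_locus N G"
    by blast
  let ?H = "{(\<lambda>A. f A * g A) | f g. f \<in> F \<and> g \<in> G}"
  have "?H \<subseteq> polynomial_funs N"
    using F G polynomial_funs.mult by blast
  moreover have "S \<inter> T = carrier_mat N N - zero_locus N ?H"
    unfolding S T zero_locus_Un_products by blast
  ultimately show "\<exists>F \<subseteq> polynomial_funs N. S \<inter> T = carrier_mat N N - zero_locus N F"
    by (intro exI[of _ ?H] conjI)
next
  fix K :: "'a mat set set"
  let ?Z = "\<lambda>F. carrier_mat N N - zero_locus N F"
  assume K: "\<forall>U\<in>K. \<exists>F \<subseteq> polynomial_funs N. U = ?Z F"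
  let ?F = "\<Union>{F. F \<subseteq> polynomial_funs N \<and> ?Z F \<in> K}"
  have "\<Union>K = ?Z ?F"
  proof (rule Set.set_eqI)
    fix A
    have "A \<in> \<Union>K \<longleftrightarrow> (\<exists>F \<subseteq> polynomial_funs N. ?Z F \<in> K \<and> A \<in> ?Z F)"
      using K by (metis UnionE UnionI)
    also have "\<dots> \<longleftrightarrow> A \<in> ?Z ?F"
      unfolding zero_locus_def by blast
    finally show "A \<in> \<Union>K \<longleftrightarrow> A \<in> ?Z ?F" .
  qed
  moreover have "?F \<subseteq> polynomial_funs N"
    by blast
  ultimately show "\<exists>F \<subseteq> polynomial_funs N. \<Union>K = ?Z F"
    by (intro exI[of _ ?F] conjI)
qed

lemma openin_zariski:
  "openin (zariski N) U \<longleftrightarrow> (\<exists>F \<subseteq> polynomial_funs N. U = carrier_mat N N - zero_locus N F)"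
  unfolding zariski_def by (simp add: istopology_zariski)

lemma topspace_zariski: "topspace (zariski N :: 'a::field mat topology) = carrier_mat N N"
proof -
  have "openin (zariski N) (carrier_mat N N :: 'a mat set)"
    unfolding openin_zariski
    by (rule exI[of _ "{\<lambda>_. 1}"]) (auto simp: zero_locus_def intro: polynomial_funs.const)
  moreover have "U \<subseteq> carrier_mat N N" if "openin (zariski N) U" for U :: "'a mat set"
    using that unfolding openin_zariski by auto
  ultimately show ?thesis
    by (meson openin_subset openin_topspace subset_antisym)
qed

lemma closedin_zariski:
  "closedin (zariski N) C \<longleftrightarrow> (\<exists>F \<subseteq> polynomial_funs N. C = zero_locus N F)"
proof
  assume "closedin (zariski N) C"
  then obtain F where "C \<subseteq> carrier_mat N N" "F \<subseteq> polynomial_funs N"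
    "carrier_mat N N - C = carrier_mat N N - zero_locus N F"
    by (auto simp: closedin_def topspace_zariski openin_zariski)
  moreover from this(1,3) have "C = zero_locus N F"
    unfolding zero_locus_def by blast
  ultimately show "\<exists>F \<subseteq> polynomial_funs N. C = zero_locus N F" by blast
next
  assume "\<exists>F \<subseteq> polynomial_funs N. C = zero_locus N F"
  then show "closedin (zariski N) C"
    by (auto simp: closedin_def topspace_zariski openin_zariski zero_locus_def)
qed


subsection \<open>Borel subgroups and spherical conjugacy classes\<close>

text \<open>
  Connectedness in the Zariski topology coincides with irreducibility for algebraic groups,
  so the usual notion of a connected algebraic group is the topological one.
\<close>

definition closed_connected_solvable :: "nat \<Rightarrow> 'a::field mat set \<Rightarrow> bool" where
  "closed_connected_solvable N B \<longleftrightarrow>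
     subgroup B (special_linear N) \<and> closedin (zariski N) B \<and> connectedin (zariski N) B \<and>
     solvable ((special_linear N)\<lparr>carrier := B\<rparr>)"

definition borel_subgroup :: "nat \<Rightarrow> 'a::field mat set \<Rightarrow> bool" where
  "borel_subgroup N B \<longleftrightarrow> closed_connected_solvable N B \<and>
     (\<forall>B'. closed_connected_solvable N B' \<and> B \<subseteq> B' \<longrightarrow> B' = B)"

definition conj_act :: "('a, 'b) monoid_scheme \<Rightarrow> 'a \<Rightarrow> 'a \<Rightarrow> 'a" where
  "conj_act G g x = g \<otimes>\<^bsub>G\<^esub> x \<otimes>\<^bsub>G\<^esub> inv\<^bsub>G\<^esub> g"

definition conj_class :: "('a, 'b) monoid_scheme \<Rightarrow> 'a \<Rightarrow> 'a set" where
  "conj_class G x = orbit G (conj_act G) x"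

definition conj_classes :: "('a, 'b) monoid_scheme \<Rightarrow> 'a set set" where
  "conj_classes G = conj_class G ` carrier G"

definition group_centralizer :: "('a, 'b) monoid_scheme \<Rightarrow> 'a \<Rightarrow> 'a set" where
  "group_centralizer G x = {g \<in> carrier G. g \<otimes>\<^bsub>G\<^esub> x = x \<otimes>\<^bsub>G\<^esub> g}"

definition group_center :: "('a, 'b) monoid_scheme \<Rightarrow> 'a set" where
  "group_center G = {z \<in> carrier G. \<forall>g\<in>carrier G. z \<otimes>\<^bsub>G\<^esub> g = g \<otimes>\<^bsub>G\<^esub> z}"

definition spherical_class :: "nat \<Rightarrow> 'a::field mat set \<Rightarrow> bool" where
  "spherical_class N C \<longleftrightarrow>
     (\<exists>B. borel_subgroup N B \<and>
       (\<exists>y\<in>C. (subtopology (zariski N) C) closure_of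
          (orbit ((special_linear N)\<lparr>carrier := B\<rparr>) (conj_act (special_linear N)) y) = C))"


subsection \<open>Symmetric spaces\<close>

text \<open>
  The special linear group is closed in affine space, so its regular functions are the
  restrictions of polynomials in the matrix entries.  Since \<open>\<theta>\<close> is required to be its own
  inverse, no separate regularity condition on the inverse is needed.
\<close>

definition algebraic_involution :: "nat \<Rightarrow> ('a::field mat \<Rightarrow> 'a mat) \<Rightarrow> bool" where
  "algebraic_involution N \<theta> \<longleftrightarrow>
     \<theta> \<in> iso (special_linear N) (special_linear N) \<and>
     (\<forall>i<N. \<forall>j<N. \<exists>f\<in>polynomial_funs N. \<forall>A\<in>carrier (special_linear N). \<theta> A $$ (i, j) = f A) \<and>
     (\<forall>A\<in>carrier (special_linear N). \<theta> (\<theta> A) = A)"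

definition fixed_points :: "nat \<Rightarrow> ('a::field mat \<Rightarrow> 'a mat) \<Rightarrow> 'a mat set" where
  "fixed_points N \<theta> = {A \<in> carrier (special_linear N). \<theta> A = A}"

definition identity_component :: "nat \<Rightarrow> 'a::field mat set \<Rightarrow> 'a mat set" where
  "identity_component N H = connected_component_of_set (subtopology (zariski N) H) (1\<^sub>m N)"

text \<open>\<open>symmetric_space N H\<close> says that the homogeneous space \<open>special_linear N / H\<close> is symmetric.\<close>

definition symmetric_space :: "nat \<Rightarrow> 'a::field mat set \<Rightarrow> bool" where
  "symmetric_space N H \<longleftrightarrow>
     subgroup H (special_linear N) \<and> closedin (zariski N) H \<and>
     (\<exists>\<theta>. algebraic_involution N \<theta> \<and>
        identity_component N (fixed_points N \<theta>) \<subseteq> H \<and> H \<subseteq> fixed_points N \<theta>)"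


subsection \<open>Semisimple and unipotent elements\<close>

text \<open>
  Diagonalizability over the ground field; this is the notion of a semisimple element of the
  special linear group when the field is algebraically closed.
\<close>

definition semisimple_mat :: "'a::field mat \<Rightarrow> bool" where
  "semisimple_mat A \<longleftrightarrow> (\<exists>D. diagonal_mat D \<and> similar_mat A D)"

definition unipotent_mat :: "'a::field mat \<Rightarrow> bool" where
  "unipotent_mat A \<longleftrightarrow>
     (\<exists>k. (A - 1\<^sub>m (dim_row A)) ^\<^sub>m k = 0\<^sub>m (dim_row A) (dim_row A))"

definition has_jordan_type :: "'a::field mat \<Rightarrow> nat multiset \<Rightarrow> bool" where
  "has_jordan_type A \<mu> \<longleftrightarrow> (\<exists>n_as. jordan_nf A n_as \<and> \<mu> = mset (map fst n_as))"

end

theory Submission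
  imports Defs
begin

text \<open>
  Everything reduces to one criterion: the class of \<open>x\<close> is spherical iff \<open>(x - a)(x - b) = 0\<close> for some
  \<open>a\<close> and \<open>b\<close>.

  If a Borel subgroup \<open>B\<close> has a dense orbit, then by the Lie-Kolchin theorem \<open>B\<close> has a common eigenvector
  \<open>v\<close> and a common eigenfunctional \<open>w\<close>. The functions \<open>w(A v)\<close> and \<open>w(A\<^sup>2 v)\<close> of a matrix \<open>A\<close> transform
  under conjugation by \<open>B\<close> with the same character, so their ratio is constant on the class. Hence a
  fixed nontrivial combination \<open>\<alpha> A + \<gamma> A\<^sup>2\<close> satisfies \<open>w((\<alpha> A + \<gamma> A\<^sup>2) v) = 0\<close> on the whole class, which
  forces \<open>\<alpha> x + \<gamma> x\<^sup>2\<close> to be scalar.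

  Conversely, a quadratic \<open>x\<close> is similar to an explicit matrix \<open>y\<close> built from the antidiagonal. Every
  elementary lower triangular matrix \<open>1 + t E\<^sub>i\<^sub>+\<^sub>1\<^sub>,\<^sub>i\<close> with \<open>t\<close> generic conjugates \<open>y\<close> to a point of its
  orbit under the upper triangular group, so the closure of that orbit is stable under generators of
  the general linear group.
\<close>

section \<open>Regular functions and the Zariski topology\<close>

text \<open>Sphericity asks for some Borel subgroup: Lie-Kolchin handles an arbitrary one in the
  necessary condition, and for sufficiency the upper triangular group is shown to be a Borel
  subgroup. Over an algebraically closed field every invertible matrix is a scalar times an element
  of \<open>SL N\<close>, so classes are similarity classes and orbits may be computed with all
  invertible upper triangular matrices. The functions w(A v) and w(A^2 v) share a character because
  squaring commutes with conjugation; two powers already give a ratio, which is where degree two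
  comes from. The matrix \<open>y\<close> sends e_i to e_(N-1-i), which puts its kernel and image in
  general position to the flag fixed by the upper triangular group. Odd characteristic enters twice:
  a second difference carries the factor 2, and the involution attached to a matrix \<open>s\<close>
  with two eigenvalues is 1 - 2/(b-a) (s-a). Once (x-a)(x-b) = 0, the three statements separate: a
  \<noteq> b makes x diagonalizable, while a = b makes x equal to a times a unipotent matrix with
  Jordan blocks of size at most 2, and det x = 1 makes that scalar central.\<close>

abbreviation SL :: "nat \<Rightarrow> 'a::field mat monoid" where
  "SL \<equiv> special_linear"

lemmas mat_assoc = assoc_mult_mat[of _ N N _ N _ N] for N

text \<open>Functions such as \<open>det\<close> or \<open>adj_mat\<close> are total in HOL but
  polynomial only on N by N matrices, so agreement with a polynomial is demanded there and nowhere
  else. The notion is stable under composition with \<open>regular_map\<close>.\<close>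

definition regular_fun :: "nat \<Rightarrow> ('a::field mat \<Rightarrow> 'a) \<Rightarrow> bool" where
  "regular_fun N f \<longleftrightarrow> (\<exists>p\<in>polynomial_funs N. \<forall>A\<in>carrier_mat N N. f A = p A)"

definition regular_map :: "nat \<Rightarrow> nat \<Rightarrow> ('a::field mat \<Rightarrow> 'a mat) \<Rightarrow> bool" where
  "regular_map N M \<phi> \<longleftrightarrow> (\<forall>A\<in>carrier_mat N N. \<phi> A \<in> carrier_mat M M) \<and>
     (\<forall>i<M. \<forall>j<M. regular_fun N (\<lambda>A. \<phi> A $$ (i, j)))"

lemma regular_fun_cong:
  "(\<And>A. A \<in> carrier_mat N N \<Longrightarrow> f A = g A) \<Longrightarrow> regular_fun N g \<Longrightarrow> regular_fun N f"
  unfolding regular_fun_def by metis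

lemma regular_fun_polynomial: "f \<in> polynomial_funs N \<Longrightarrow> regular_fun N f"
  unfolding regular_fun_def by blast

lemma regular_fun_const [intro]: "regular_fun N (\<lambda>_. c)"
  by (intro regular_fun_polynomial polynomial_funs.const)

lemma regular_fun_entry [intro]: "i < N \<Longrightarrow> j < N \<Longrightarrow> regular_fun N (\<lambda>A. A $$ (i, j))"
  by (intro regular_fun_polynomial polynomial_funs.entry)

lemma regular_fun_add [intro]:
  assumes "regular_fun N f" "regular_fun N g"
  shows "regular_fun N (\<lambda>A. f A + g A)"
proof -
  obtain p q where "p \<in> polynomial_funs N" "\<forall>A\<in>carrier_mat N N. f A = p A"
    "q \<in> polynomial_funs N" "\<forall>A\<in>carrier_mat N N. g A = q A"
    using assms unfolding regular_fun_def by blast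
  then show ?thesis
    unfolding regular_fun_def by (intro bexI[of _ "\<lambda>A. p A + q A"] polynomial_funs.add) auto
qed

lemma regular_fun_mult [intro]:
  assumes "regular_fun N f" "regular_fun N g"
  shows "regular_fun N (\<lambda>A. f A * g A)"
proof -
  obtain p q where "p \<in> polynomial_funs N" "\<forall>A\<in>carrier_mat N N. f A = p A"
    "q \<in> polynomial_funs N" "\<forall>A\<in>carrier_mat N N. g A = q A"
    using assms unfolding regular_fun_def by blast
  then show ?thesis
    unfolding regular_fun_def by (intro bexI[of _ "\<lambda>A. p A * q A"] polynomial_funs.mult) auto
qed

lemma regular_fun_diff [intro]:
  assumes "regular_fun N f" "regular_fun N g"
  shows "regular_fun N (\<lambda>A. f A - g A)"
proof -
  have "regular_fun N (\<lambda>A. f A + (-1) * g A)"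
    by (intro regular_fun_add assms regular_fun_mult regular_fun_const)
  then show ?thesis by simp
qed

lemma regular_fun_sum [intro]:
  "(\<And>i. i \<in> I \<Longrightarrow> regular_fun N (f i)) \<Longrightarrow> regular_fun N (\<lambda>A. \<Sum>i\<in>I. f i A)"
  by (induction I rule: infinite_finite_induct) auto

lemma regular_fun_prod [intro]:
  "(\<And>i. i \<in> I \<Longrightarrow> regular_fun N (f i)) \<Longrightarrow> regular_fun N (\<lambda>A. \<Prod>i\<in>I. f i A)"
  by (induction I rule: infinite_finite_induct) auto

lemma regular_map_carrier: "regular_map N M \<phi> \<Longrightarrow> A \<in> carrier_mat N N \<Longrightarrow> \<phi> A \<in> carrier_mat M M"
  unfolding regular_map_def by blast

lemma regular_map_entry:
  "regular_map N M \<phi> \<Longrightarrow> i < M \<Longrightarrow> j < M \<Longrightarrow> regular_fun N (\<lambda>A. \<phi> A $$ (i, j))"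
  unfolding regular_map_def by blast

lemma regular_map_id: "regular_map N N (\<lambda>A. A)"
  unfolding regular_map_def by auto

lemma regular_map_const: "C \<in> carrier_mat M M \<Longrightarrow> regular_map N M (\<lambda>_. C)"
  unfolding regular_map_def by auto

lemma regular_map_mult:
  assumes f: "regular_map N M \<phi>" and g: "regular_map N M \<psi>"
  shows "regular_map N M (\<lambda>A. \<phi> A * \<psi> A)"
  unfolding regular_map_def
proof (intro conjI ballI allI impI)
  fix i j assume ij: "i < M" "j < M"
  have "regular_fun N (\<lambda>A. \<Sum>k = 0..<M. \<phi> A $$ (i, k) * \<psi> A $$ (k, j))"
    using ij by (intro regular_fun_sum regular_fun_mult regular_map_entry[OF f] regular_map_entry[OF g]) auto
  then show "regular_fun N (\<lambda>A. (\<phi> A * \<psi> A) $$ (i, j))"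
    by (rule regular_fun_cong[rotated])
      (use ij regular_map_carrier[OF f] regular_map_carrier[OF g] in
        \<open>force simp: scalar_prod_def\<close>)
qed (use f g in \<open>auto dest!: regular_map_carrier intro!: mult_carrier_mat\<close>)

lemma regular_map_transpose:
  assumes f: "regular_map N M \<phi>"
  shows "regular_map N M (\<lambda>A. transpose_mat (\<phi> A))"
  unfolding regular_map_def
proof (intro conjI ballI allI impI)
  fix i j assume ij: "i < M" "j < M"
  show "regular_fun N (\<lambda>A. transpose_mat (\<phi> A) $$ (i, j))"
    by (rule regular_fun_cong[OF _ regular_map_entry[OF f ij(2,1)]])
      (use ij in \<open>auto dest!: regular_map_carrier[OF f]\<close>)
qed (use f in \<open>auto dest!: regular_map_carrier\<close>)

lemma regular_fun_det:
  assumes f: "regular_map N M \<phi>"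
  shows "regular_fun N (\<lambda>A. det (\<phi> A))"
proof -
  have "regular_fun N (\<lambda>A. \<Sum>p | p permutes {0..<M}. of_int (sign p) * (\<Prod>i = 0..<M. \<phi> A $$ (i, p i)))"
    by (intro regular_fun_sum regular_fun_mult regular_fun_const regular_fun_prod regular_map_entry[OF f])
      (auto simp: permutes_in_image)
  then show ?thesis
    by (rule regular_fun_cong[rotated]) (auto dest!: regular_map_carrier[OF f] simp: det_def')
qed

text \<open>The entries of the adjugate are signed minors, and on determinant 1 the adjugate is the
  inverse. Inversion is therefore polynomial, which makes conjugation and commutator maps
  continuous.\<close>

lemma regular_map_adj:
  assumes f: "regular_map N M \<phi>"
  shows "regular_map N M (\<lambda>A. adj_mat (\<phi> A))"
  unfolding regular_map_def
proof (intro conjI ballI allI impI)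
  fix i j assume ij: "i < M" "j < M"
  have "regular_map N (M - 1) (\<lambda>A. mat_delete (\<phi> A) j i)"
    unfolding regular_map_def
  proof (intro conjI ballI allI impI)
    fix k l assume kl: "k < M - 1" "l < M - 1"
    have "regular_fun N (\<lambda>A. \<phi> A $$ (insert_index j k, insert_index i l))"
      using kl ij by (intro regular_map_entry[OF f]) (auto simp: insert_index_def)
    then show "regular_fun N (\<lambda>A. mat_delete (\<phi> A) j i $$ (k, l))"
      by (rule regular_fun_cong[rotated])
        (use ij kl in \<open>auto dest!: regular_map_carrier[OF f] simp: mat_delete_def insert_index_def\<close>)
  qed (use f in \<open>blast dest: regular_map_carrier intro: mat_delete_carrier\<close>)
  from regular_fun_det[OF this]
  have "regular_fun N (\<lambda>A. cofactor (\<phi> A) j i)"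
    unfolding cofactor_def by (intro regular_fun_mult regular_fun_const)
  then show "regular_fun N (\<lambda>A. adj_mat (\<phi> A) $$ (i, j))"
    by (rule regular_fun_cong[rotated]) (use ij in \<open>auto dest!: regular_map_carrier[OF f] simp: adj_mat_def\<close>)
qed (use f in \<open>blast dest: regular_map_carrier intro: adj_mat(1)\<close>)

lemma regular_fun_compose:
  assumes f: "regular_fun M f" and g: "regular_map N M \<phi>"
  shows "regular_fun N (\<lambda>A. f (\<phi> A))"
proof -
  obtain p where p: "p \<in> polynomial_funs M" and fp: "\<And>A. A \<in> carrier_mat M M \<Longrightarrow> f A = p A"
    using f unfolding regular_fun_def by blast
  from p have "regular_fun N (\<lambda>A. p (\<phi> A))"
    by induction (auto intro: regular_map_entry[OF g])
  then show ?thesis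
    by (rule regular_fun_cong[rotated]) (auto intro: fp regular_map_carrier[OF g])
qed

section \<open>Closed sets, continuity and closures\<close>

lemma closedin_zariski_regular:
  assumes "\<And>f. f \<in> F \<Longrightarrow> regular_fun N f"
  shows "closedin (zariski N) {A \<in> carrier_mat N N. \<forall>f\<in>F. f A = 0}"
proof -
  have "\<forall>f\<in>F. \<exists>p\<in>polynomial_funs N. \<forall>A\<in>carrier_mat N N. f A = p A"
    using assms unfolding regular_fun_def by blast
  then obtain p where p: "\<And>f. f \<in> F \<Longrightarrow> p f \<in> polynomial_funs N"
    "\<And>f A. f \<in> F \<Longrightarrow> A \<in> carrier_mat N N \<Longrightarrow> f A = p f A"
    by metis
  have "{A \<in> carrier_mat N N. \<forall>f\<in>F. f A = 0} = zero_locus N (p ` F)"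
    unfolding zero_locus_def using p(2) by auto
  with p(1) show ?thesis
    unfolding closedin_zariski by blast
qed

lemma closedin_zariski_regular1:
  "regular_fun N f \<Longrightarrow> closedin (zariski N) {A \<in> carrier_mat N N. f A = 0}"
  using closedin_zariski_regular[of "{f}" N] by simp

lemma continuous_map_zariski:
  assumes f: "regular_map N M \<phi>"
  shows "continuous_map (zariski N) (zariski M) \<phi>"
  unfolding continuous_map_closedin
proof (intro conjI ballI allI impI)
  fix C :: "'a mat set" assume "closedin (zariski M) C"
  then obtain F where F: "F \<subseteq> polynomial_funs M" "C = zero_locus M F"
    unfolding closedin_zariski by blast
  have "{x \<in> topspace (zariski N). \<phi> x \<in> C} = {A \<in> carrier_mat N N. \<forall>g\<in>(\<lambda>p A. p (\<phi> A)) ` F. g A = 0}"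
    unfolding F zero_locus_def topspace_zariski using regular_map_carrier[OF f] by auto
  also have "closedin (zariski N) \<dots>"
    using F by (intro closedin_zariski_regular) (auto intro: regular_fun_compose[OF _ f] regular_fun_polynomial)
  finally show "closedin (zariski N) {x \<in> topspace (zariski N). \<phi> x \<in> C}" .
qed (use f in \<open>auto dest!: regular_map_carrier simp: topspace_zariski\<close>)

text \<open>Turns density into vanishing: the closure consists of the points where every regular
  function that is zero on \<open>S\<close> is zero. Density of orbits is used and proved only in
  this form.\<close>

lemma zariski_closure_of:
  assumes "S \<subseteq> carrier_mat N N"
  shows "zariski N closure_of S =
    {A \<in> carrier_mat N N. \<forall>f. regular_fun N f \<longrightarrow> (\<forall>B\<in>S. f B = 0) \<longrightarrow> f A = 0}" (is "_ = ?R")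
proof
  have "closedin (zariski N) {A \<in> carrier_mat N N. \<forall>f\<in>{f. regular_fun N f \<and> (\<forall>B\<in>S. f B = 0)}. f A = 0}"
    by (rule closedin_zariski_regular) auto
  also have "{A \<in> carrier_mat N N. \<forall>f\<in>{f. regular_fun N f \<and> (\<forall>B\<in>S. f B = 0)}. f A = 0} = ?R"
    by blast
  finally show "zariski N closure_of S \<subseteq> ?R"
    using assms by (intro closure_of_minimal) auto
  show "?R \<subseteq> zariski N closure_of S"
  proof
    fix A assume A: "A \<in> ?R"
    obtain F where F: "F \<subseteq> polynomial_funs N" "zariski N closure_of S = zero_locus N F"
      using closedin_closure_of[of "zariski N" S] unfolding closedin_zariski by blast
    have S: "S \<subseteq> zariski N closure_of S"
      using assms by (intro closure_of_subset) (simp add: topspace_zariski)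
    show "A \<in> zariski N closure_of S"
      unfolding F zero_locus_def
    proof (intro CollectI conjI ballI)
      fix f assume f: "f \<in> F"
      then have "\<forall>B\<in>S. f B = 0"
        using S unfolding F zero_locus_def by blast
      moreover have "regular_fun N f"
        using f F by (intro regular_fun_polynomial) blast
      ultimately show "f A = 0" using A by blast
    qed (use A in auto)
  qed
qed

text \<open>A fibre of \<open>f\<close> is closed, and so is the union of the finitely many other
  fibres, so a connected set lies in one of the two. In Lie-Kolchin this turns "an eigenvalue, hence
  finitely many values" into "constant".\<close>

lemma connected_regular_fun_constant:
  assumes H: "connectedin (zariski N) H" and f: "regular_fun N f" and fin: "finite (f ` H)"
    and x: "x \<in> H" and y: "y \<in> H"
  shows "f x = f y"
proof (rule ccontr)
  assume ne: "f x \<noteq> f y"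
  let ?c = "f x"
  define E where "E S = {A \<in> carrier_mat N N. (\<Prod>c\<in>S. f A - c) = 0}" for S
  have Hc: "H \<subseteq> carrier_mat N N"
    using connectedin_subset_topspace[OF H] by (simp add: topspace_zariski)
  have cl: "closedin (zariski N) (E S)" for S
    unfolding E_def
    by (intro closedin_zariski_regular1 regular_fun_prod regular_fun_diff f regular_fun_const)
  have E: "A \<in> E S \<longleftrightarrow> f A \<in> S" if "A \<in> H" "finite S" for A S
    using that Hc by (auto simp: E_def)
  define S where "S = f ` H - {?c}"
  have fS: "finite S" using fin by (simp add: S_def)
  have E1: "A \<in> E {?c} \<longleftrightarrow> f A = ?c" and E2: "A \<in> E S \<longleftrightarrow> f A \<noteq> ?c" if "A \<in> H" for A
    using E[OF that, of "{?c}"] E[OF that fS] that by (auto simp: S_def)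
  have "H \<subseteq> E {?c} \<union> E S" "E {?c} \<inter> E S \<inter> H = {}" "x \<in> E {?c} \<inter> H" "y \<in> E S \<inter> H"
    using E1 E2 x y ne by (blast, blast, simp, simp)
  then have "\<exists>E1 E2. closedin (zariski N) E1 \<and> closedin (zariski N) E2 \<and> H \<subseteq> E1 \<union> E2 \<and>
    E1 \<inter> E2 \<inter> H = {} \<and> E1 \<inter> H \<noteq> {} \<and> E2 \<inter> H \<noteq> {}"
    by (intro exI[of _ "E {?c}"] exI[of _ "E S"] conjI cl) auto
  then show False
    by (rule notE[OF conjunct2[OF connectedin_closedin[THEN iffD1, OF H]]])
qed

section \<open>Polynomial identities along rational curves\<close>

lemma infinite_UNIV_alg_closed: "infinite (UNIV :: 'a::alg_closed_field set)"
proof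
  assume fin: "finite (UNIV :: 'a set)"
  \<comment> \<open>The product vanishes at every element of a finite field, so \<open>?p\<close> is
    1 everywhere although its degree is positive.\<close>
  let ?p = "(\<Prod>a\<in>UNIV. [:-a, 1:]) + 1 :: 'a poly"
  have "degree (\<Prod>a\<in>(UNIV :: 'a set). [:-a, 1:]) = card (UNIV :: 'a set)"
    by (subst degree_prod_eq_sum_degree) auto
  moreover have "card (UNIV :: 'a set) > 0"
    using fin by (simp add: card_gt_0_iff)
  ultimately have "degree ?p > 0"
    by (metis degree_1 degree_add_eq_left)
  then obtain x where "poly ?p x = 0"
    using alg_closed_imp_poly_has_root by blast
  moreover have "poly (\<Prod>a\<in>(UNIV :: 'a set). [:-a, 1:]) x = 0"
    using fin by (auto simp: poly_prod prod_zero_iff)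
  ultimately show False by simp
qed

lemma poly_eq_0_if_cofinite:
  fixes p q :: "'a::alg_closed_field poly"
  assumes "q \<noteq> 0" "\<And>t. poly q t \<noteq> 0 \<Longrightarrow> poly p t = 0"
  shows "p = 0"
proof -
  have "poly (p * q) t = 0" for t
    using assms(2)[of t] by auto
  then have "p * q = 0"
    using poly_roots_finite[of "p * q"] infinite_UNIV_alg_closed by (auto simp del: mult_eq_0_iff)
  with assms(1) show ?thesis by simp
qed

text \<open>All entries share the denominator \<delta>, and the curve is meaningful only where
  \<delta> is nonzero. Clearing the denominator by multiplication keeps all arguments inside
  polynomials.\<close>

definition rational_curve :: "nat \<Rightarrow> 'a::field poly \<Rightarrow> ('a \<Rightarrow> 'a mat) \<Rightarrow> bool" where
  "rational_curve N \<delta> \<gamma> \<longleftrightarrow> (\<forall>t. poly \<delta> t \<noteq> 0 \<longrightarrow> \<gamma> t \<in> carrier_mat N N) \<and>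
     (\<forall>i<N. \<forall>j<N. \<exists>q. \<forall>t. poly \<delta> t \<noteq> 0 \<longrightarrow> \<gamma> t $$ (i, j) * poly \<delta> t = poly q t)"

text \<open>Each entry costs one factor \<delta>, so a monomial of degree k costs \<delta>^k; the
  exponent grows with the polynomial and is therefore existential.\<close>

lemma rational_curve_regular_fun:
  assumes \<gamma>: "rational_curve N \<delta> \<gamma>" and f: "regular_fun N f"
  shows "\<exists>p k. \<forall>t. poly \<delta> t \<noteq> 0 \<longrightarrow> f (\<gamma> t) * poly \<delta> t ^ k = poly p t"
proof -
  obtain h where h: "h \<in> polynomial_funs N" and fh: "\<And>A. A \<in> carrier_mat N N \<Longrightarrow> f A = h A"
    using f unfolding regular_fun_def by blast
  from h have "\<exists>p k. \<forall>t. poly \<delta> t \<noteq> 0 \<longrightarrow> h (\<gamma> t) * poly \<delta> t ^ k = poly p t"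
  proof induction
    case (const c)
    show ?case by (rule exI[of _ "[:c:]"], rule exI[of _ 0]) simp
  next
    case (entry i j)
    then obtain q where "\<forall>t. poly \<delta> t \<noteq> 0 \<longrightarrow> \<gamma> t $$ (i, j) * poly \<delta> t = poly q t"
      using \<gamma> unfolding rational_curve_def by blast
    then show ?case by (intro exI[of _ q] exI[of _ 1]) simp
  next
    case (add f g)
    then obtain p k q l where pq: "\<And>t. poly \<delta> t \<noteq> 0 \<Longrightarrow> f (\<gamma> t) * poly \<delta> t ^ k = poly p t"
      "\<And>t. poly \<delta> t \<noteq> 0 \<Longrightarrow> g (\<gamma> t) * poly \<delta> t ^ l = poly q t" by blast
    have "(f (\<gamma> t) + g (\<gamma> t)) * poly \<delta> t ^ (k + l) = poly (p * \<delta> ^ l + q * \<delta> ^ k) t"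
      if "poly \<delta> t \<noteq> 0" for t
      unfolding power_add poly_mult poly_add poly_power pq[OF that, symmetric] by (simp add: algebra_simps)
    then show ?case by blast
  next
    case (mult f g)
    then obtain p k q l where pq: "\<And>t. poly \<delta> t \<noteq> 0 \<Longrightarrow> f (\<gamma> t) * poly \<delta> t ^ k = poly p t"
      "\<And>t. poly \<delta> t \<noteq> 0 \<Longrightarrow> g (\<gamma> t) * poly \<delta> t ^ l = poly q t" by blast
    have "f (\<gamma> t) * g (\<gamma> t) * poly \<delta> t ^ (k + l) = poly (p * q) t" if "poly \<delta> t \<noteq> 0" for t
      unfolding power_add poly_mult pq[OF that, symmetric] by (simp add: algebra_simps)
    then show ?case by blast
  qed
  then show ?thesis
    using \<gamma> fh unfolding rational_curve_def by metis
qed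

text \<open>After clearing denominators, \<open>f\<close> along the curve becomes a polynomial that
  vanishes wherever \<delta> and \<open>q\<close> are both nonzero, hence is zero. This passes from
  generic parameters to all admissible ones.\<close>

lemma rational_curve_vanishing:
  fixes \<delta> :: "'a::alg_closed_field poly"
  assumes "rational_curve N \<delta> \<gamma>" and "regular_fun N f"
    and "q \<noteq> 0" and "\<And>t. poly \<delta> t \<noteq> 0 \<Longrightarrow> poly q t \<noteq> 0 \<Longrightarrow> f (\<gamma> t) = 0"
    and "poly \<delta> t \<noteq> 0"
  shows "f (\<gamma> t) = 0"
proof -
  obtain p k where p: "\<And>t. poly \<delta> t \<noteq> 0 \<Longrightarrow> f (\<gamma> t) * poly \<delta> t ^ k = poly p t"
    using rational_curve_regular_fun[OF assms(1,2)] by blast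
  have "\<delta> \<noteq> 0" using assms(5) by auto
  then have "p = 0"
    using assms(3,4) p by (intro poly_eq_0_if_cofinite[of "\<delta> * q"]) force+
  then show ?thesis
    using p[OF assms(5)] assms(5) by simp
qed

text \<open>The reason is irreducibility of the line. If two closed sets disconnected the image,
  some \<open>f\<close> vanishing on the first would be nonzero at a point of the second; generic
  points would then lie in the second set, and \<open>rational_curve_vanishing\<close> would spread
  its equations over the whole curve.\<close>

lemma connectedin_rational_curve:
  fixes \<delta> :: "'a::alg_closed_field poly"
  assumes \<gamma>: "rational_curve N \<delta> \<gamma>"
  shows "connectedin (zariski N) (\<gamma> ` {t. poly \<delta> t \<noteq> 0})" (is "connectedin _ ?S")
  unfolding connectedin_closedin
proof (intro conjI notI)
  show "?S \<subseteq> topspace (zariski N)"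
    using \<gamma> by (auto simp: topspace_zariski rational_curve_def)
next
  assume "\<exists>E1 E2. closedin (zariski N) E1 \<and> closedin (zariski N) E2 \<and> ?S \<subseteq> E1 \<union> E2 \<and>
    E1 \<inter> E2 \<inter> ?S = {} \<and> E1 \<inter> ?S \<noteq> {} \<and> E2 \<inter> ?S \<noteq> {}"
  then obtain E1 E2 where E: "closedin (zariski N) E1" "closedin (zariski N) E2" "?S \<subseteq> E1 \<union> E2"
    "E1 \<inter> E2 \<inter> ?S = {}" "E1 \<inter> ?S \<noteq> {}" "E2 \<inter> ?S \<noteq> {}"
    by (elim exE conjE)
  obtain F where F: "F \<subseteq> polynomial_funs N" "E1 = zero_locus N F"
    using E(1) unfolding closedin_zariski by blast
  obtain G where G: "G \<subseteq> polynomial_funs N" "E2 = zero_locus N G"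
    using E(2) unfolding closedin_zariski by blast
  note FG = F(1) G(1)
  note E = E[unfolded F G]
  have cover: "?S \<subseteq> zero_locus N F \<union> zero_locus N G"
    and disj: "zero_locus N F \<inter> zero_locus N G \<inter> ?S = {}"
    and ne: "zero_locus N F \<inter> ?S \<noteq> {}" "zero_locus N G \<inter> ?S \<noteq> {}"
    using E(3-6) by auto
  obtain s where s: "poly \<delta> s \<noteq> 0" "\<gamma> s \<in> zero_locus N F" "\<gamma> s \<notin> zero_locus N G"
    using ne(1) disj by blast
  obtain t where t: "poly \<delta> t \<noteq> 0" "\<gamma> t \<in> zero_locus N G" "\<gamma> t \<notin> zero_locus N F"
    using ne(2) disj by blast
  have car: "\<gamma> r \<in> carrier_mat N N" if "poly \<delta> r \<noteq> 0" for r
    using \<gamma> that unfolding rational_curve_def by blast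
  obtain f where f: "f \<in> F" "f (\<gamma> t) \<noteq> 0"
    using t car[OF t(1)] unfolding zero_locus_def by blast
  obtain g where g: "g \<in> G" "g (\<gamma> s) \<noteq> 0"
    using s car[OF s(1)] unfolding zero_locus_def by blast
  have rf: "regular_fun N f" and rg: "regular_fun N g"
    using f g FG by (auto intro: regular_fun_polynomial)
  obtain p k where p: "\<And>t. poly \<delta> t \<noteq> 0 \<Longrightarrow> f (\<gamma> t) * poly \<delta> t ^ k = poly p t"
    using rational_curve_regular_fun[OF \<gamma> rf] by blast
  have "p \<noteq> 0" using p[OF t(1)] f(2) t(1) by auto
  have "g (\<gamma> s) = 0"
  proof (rule rational_curve_vanishing[OF \<gamma> rg \<open>p \<noteq> 0\<close> _ s(1)])
    fix r assume r: "poly \<delta> r \<noteq> 0" "poly p r \<noteq> 0"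
    then have "f (\<gamma> r) \<noteq> 0" using p[OF r(1)] by auto
    then have "\<gamma> r \<notin> zero_locus N F" using f(1) unfolding zero_locus_def by blast
    then have "\<gamma> r \<in> zero_locus N G" using cover r(1) by blast
    then show "g (\<gamma> r) = 0" using g(1) unfolding zero_locus_def by blast
  qed
  with g(2) show False by simp
qed

section \<open>The Lie-Kolchin theorem\<close>

lemma special_linear_simps [simp]:
  "A \<in> carrier (SL N) \<longleftrightarrow> A \<in> carrier_mat N N \<and> det A = 1"
  "A \<otimes>\<^bsub>SL N\<^esub> B = A * B"
  "\<one>\<^bsub>SL N\<^esub> = 1\<^sub>m N"
  by (auto simp: special_linear_def)

lemma adj_mat_special_linear:
  assumes "A \<in> carrier_mat N N" "det A = 1"
  shows "adj_mat A \<in> carrier_mat N N" "A * adj_mat A = 1\<^sub>m N" "adj_mat A * A = 1\<^sub>m N" "det (adj_mat A) = 1"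
proof -
  show 1: "adj_mat A \<in> carrier_mat N N" "A * adj_mat A = 1\<^sub>m N" "adj_mat A * A = 1\<^sub>m N"
    using adj_mat[OF assms(1)] assms(2) by (auto intro: eq_matI)
  show "det (adj_mat A) = 1"
    using det_mult[OF 1(1) assms(1)] 1(3) assms(2) by simp
qed

lemma inv_special_linear:
  assumes "A \<in> carrier_mat N N" "det A = 1"
  shows "inv\<^bsub>SL N\<^esub> A = adj_mat A"
  using adj_mat_special_linear[OF assms] assms
  by (intro group.inv_equality[OF group_special_linear]) auto

lemma subgroup_special_linearD:
  assumes "subgroup H (SL N)"
  shows "g \<in> H \<Longrightarrow> g \<in> carrier_mat N N" "g \<in> H \<Longrightarrow> det g = 1" "1\<^sub>m N \<in> H"
    "g \<in> H \<Longrightarrow> h \<in> H \<Longrightarrow> g * h \<in> H" "g \<in> H \<Longrightarrow> adj_mat g \<in> H"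
    "g \<in> H \<Longrightarrow> g * adj_mat g = 1\<^sub>m N" "g \<in> H \<Longrightarrow> adj_mat g * g = 1\<^sub>m N"
proof -
  interpret H: subgroup H "SL N" by fact
  show g: "g \<in> carrier_mat N N" "det g = 1" if "g \<in> H" for g
    using H.mem_carrier[OF that] by auto
  show "1\<^sub>m N \<in> H" using H.one_closed by simp
  show "g * h \<in> H" if "g \<in> H" "h \<in> H" using H.m_closed[OF that] by simp
  show "adj_mat g \<in> H" if "g \<in> H" using H.m_inv_closed[OF that] inv_special_linear[OF g[OF that]] by simp
  show "g \<in> H \<Longrightarrow> g * adj_mat g = 1\<^sub>m N" "g \<in> H \<Longrightarrow> adj_mat g * g = 1\<^sub>m N"
    using adj_mat_special_linear[OF g] by auto
qed

text \<open>The adjugate stands for the group inverse throughout because it is polynomial; the laws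
  of inverses are transported to it from the group.\<close>

lemma adj_mat_subgroup:
  fixes H :: "'a::field mat set"
  assumes H: "subgroup H (SL N)"
  shows "adj_mat (1\<^sub>m N) = (1\<^sub>m N :: 'a mat)" "g \<in> H \<Longrightarrow> adj_mat (adj_mat g) = g"
    "g \<in> H \<Longrightarrow> h \<in> H \<Longrightarrow> adj_mat (g * h) = adj_mat h * adj_mat g"
proof -
  interpret SL: group "SL N :: 'a mat monoid" by (rule group_special_linear)
  note Hd = subgroup_special_linearD[OF H]
  have inv: "inv\<^bsub>SL N\<^esub> g = adj_mat g" if "g \<in> H" for g
    by (rule inv_special_linear[OF Hd(1,2)[OF that]])
  have car: "g \<in> carrier (SL N)" if "g \<in> H" for g
    using subgroup.mem_carrier[OF H that] .
  show "adj_mat (1\<^sub>m N) = (1\<^sub>m N :: 'a mat)"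
    using SL.inv_one inv[OF Hd(3)] by simp
  show "adj_mat (adj_mat g) = g" if "g \<in> H"
    using SL.inv_inv[OF car[OF that]] inv[OF that] inv[OF Hd(5)[OF that]] by simp
  show "adj_mat (g * h) = adj_mat h * adj_mat g" if "g \<in> H" "h \<in> H"
    using SL.inv_mult_group[OF car[OF that(1)] car[OF that(2)]] inv[OF that(1)] inv[OF that(2)]
      inv[OF Hd(4)[OF that]] by simp
qed

lemma derived_set_special_linear:
  assumes H: "subgroup H (SL N)"
  shows "derived_set (SL N) H = (\<Union>a\<in>H. \<Union>b\<in>H. {a * b * adj_mat a * adj_mat b})"
  using subgroup_special_linearD(1,2)[OF H] by (simp add: inv_special_linear)

text \<open>Letting the first entry of a commutator run over the connected set \<open>H\<close>
  joins \<open>x\<close> to \<open>x\<close> times that commutator inside the derived group.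
  Chaining such moves along a word in the generators joins every element to 1.\<close>

lemma connectedin_derived:
  assumes H: "subgroup H (SL N)" and con: "connectedin (zariski N) H"
  shows "connectedin (zariski N) (derived (SL N) H)"
proof -
  let ?D = "derived (SL N) H"
  let ?S = "derived_set (SL N) H"
  let ?X = "subtopology (zariski N) ?D"
  note Hd = subgroup_special_linearD[OF H]
  interpret SL: group "SL N" by (rule group_special_linear)
  have Hc: "H \<subseteq> carrier (SL N)" using H by (rule subgroup.subset)
  have D: "subgroup ?D (SL N)" by (rule SL.derived_is_subgroup[OF Hc])
  note Dd = subgroup_special_linearD[OF D]
  have Dg: "?D = generate (SL N) ?S" unfolding derived_def by simp
  have comm: "a * b * adj_mat a * adj_mat b \<in> ?D" if "a \<in> H" "b \<in> H" for a b
    unfolding Dg derived_set_special_linear[OF H] using that by (intro generate.incl) blast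
  have base: "connected_component_of ?X x (x * h)" if "h \<in> ?S" "x \<in> ?D" for x h
  proof -
    from that(1) obtain a b where ab: "a \<in> H" "b \<in> H" "h = a * b * adj_mat a * adj_mat b"
      unfolding derived_set_special_linear[OF H] by blast
    \<comment> \<open>At c = 1 this is \<open>x\<close>, and at c = \<open>a\<close> it is
      \<open>x * h\<close>.\<close>
    let ?\<phi> = "\<lambda>c. x * (c * b * adj_mat c * adj_mat b)"
    have "regular_map N N ?\<phi>"
      by (intro regular_map_mult regular_map_adj regular_map_id regular_map_const)
        (use Dd(1)[OF that(2)] Hd(1)[OF ab(2)] Hd(1,5) ab(2) in auto)
    then have "connectedin (zariski N) (?\<phi> ` H)"
      by (rule connectedin_continuous_map_image[OF continuous_map_zariski con])
    moreover have "?\<phi> ` H \<subseteq> ?D"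
      using comm[OF _ ab(2)] Dd(4)[OF that(2)] by blast
    ultimately have "connectedin ?X (?\<phi> ` H)"
      by (simp add: connectedin_subtopology)
    moreover have "?\<phi> (1\<^sub>m N) = x"
      by (simp only: adj_mat_subgroup(1)[OF H] left_mult_one_mat[OF Hd(1)[OF ab(2)]]
          right_mult_one_mat[OF Hd(1)[OF ab(2)]] Hd(6)[OF ab(2)] right_mult_one_mat[OF Dd(1)[OF that(2)]])
    then have "x \<in> ?\<phi> ` H" by (rule image_eqI[OF sym Hd(3)])
    moreover have "x * h \<in> ?\<phi> ` H" using ab by blast
    ultimately show ?thesis unfolding connected_component_of_def by blast
  qed
  have step: "connected_component_of ?X x (x * g)" if "g \<in> generate (SL N) ?S" "x \<in> ?D" for x g
    using that
  proof (induction arbitrary: x)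
    case one
    have "x * \<one>\<^bsub>SL N\<^esub> = x" using Dd(1)[OF one] by simp
    then show ?case using Dd(1)[OF one] one
      by (simp add: connected_component_of_refl topspace_zariski)
  next
    case (incl h)
    then show ?case by (rule base)
  next
    case (inv h)
    have h: "h \<in> ?D" unfolding Dg by (rule generate.incl[OF inv(1)])
    have i: "inv\<^bsub>SL N\<^esub> h = adj_mat h" by (rule inv_special_linear[OF Dd(1,2)[OF h]])
    \<comment> \<open>The path for \<open>h\<close> that starts at x h^-1 ends at x; reversed, it
      serves the inverse generator.\<close>
    have "x * adj_mat h \<in> ?D" using Dd h inv by blast
    from base[OF inv(1) this]
    have "connected_component_of ?X (x * adj_mat h) (x * adj_mat h * h)" .
    also have "x * adj_mat h * h = x"
      using Dd(1)[OF inv(2)] Dd(1)[OF h] Dd(7)[OF h] Dd(1)[OF Dd(5)[OF h]] by (simp add: mat_assoc[where N = N])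
    finally show ?case unfolding i by (rule connected_component_of_sym[THEN iffD1])
  next
    case (eng h1 h2)
    have h: "h1 \<in> ?D" "h2 \<in> ?D" using eng unfolding Dg by auto
    have "x * h1 \<in> ?D" using Dd(4)[OF eng.prems h(1)] .
    from eng.IH(2)[OF this] eng.IH(1)[OF eng.prems]
    have "connected_component_of ?X x (x * h1 * h2)"
      by (metis connected_component_of_trans)
    also have "x * h1 * h2 = x * (h1 * h2)"
      using Dd(1)[OF eng.prems] Dd(1)[OF h(1)] Dd(1)[OF h(2)] by (rule assoc_mult_mat)
    finally show ?case by simp
  qed
  have one: "connected_component_of ?X (1\<^sub>m N) g" if "g \<in> ?D" for g
    using step[of g "1\<^sub>m N"] that Dd(1)[OF that] Dd(3) unfolding Dg[symmetric] by simp
  have "connected_space ?X"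
    unfolding connected_space_iff_connected_component
    by (metis one connected_component_of_sym connected_component_of_trans topspace_subtopology IntD2)
  moreover have "?D \<subseteq> topspace (zariski N)" using Dd(1) by (auto simp: topspace_zariski)
  ultimately show ?thesis unfolding connectedin_def by blast
qed

section \<open>Dimension counting and eigenvectors in invariant subspaces\<close>

definition vec_subspace :: "nat \<Rightarrow> 'a::field vec set \<Rightarrow> bool" where
  "vec_subspace m W \<longleftrightarrow> W \<subseteq> carrier_vec m \<and> 0\<^sub>v m \<in> W \<and> (\<forall>u\<in>W. \<forall>v\<in>W. u + v \<in> W) \<and> (\<forall>c. \<forall>v\<in>W. c \<cdot>\<^sub>v v \<in> W)"

text \<open>The number of pivots is the dimension of the subspace.\<close>

definition pivots :: "nat \<Rightarrow> 'a::field vec set \<Rightarrow> nat set" where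
  "pivots m W = {i. i < m \<and> (\<exists>w\<in>W. w $ i \<noteq> 0 \<and> (\<forall>j<i. w $ j = 0))}"

text \<open>Echelon reduction: a vector of \<open>W\<close> with leading index k is reduced, by a
  multiple of a vector of \<open>W'\<close> with the same leading index, to one that starts later.
  The induction runs downwards on the number of known leading zeros.\<close>

lemma eq_if_pivots_eq:
  assumes W: "vec_subspace m W" and W': "vec_subspace m W'" and sub: "W' \<subseteq> W"
    and piv: "pivots m W' = pivots m W"
  shows "W' = W"
proof -
  have "w \<in> W'" if "w \<in> W" "\<forall>j<k. w $ j = 0" "k \<le> m" for w k
    using that(3,1,2)
  proof (induction arbitrary: w rule: inc_induct)
    case base
    then have "w = 0\<^sub>v m" using W by (intro eq_vecI) (auto simp: vec_subspace_def)
    then show ?case using W' by (simp add: vec_subspace_def)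
  next
    case (step k)
    show ?case
    proof (cases "w $ k = 0")
      case True
      then show ?thesis using step by (auto simp: less_Suc_eq)
    next
      case False
      then have "k \<in> pivots m W'"
        unfolding piv unfolding pivots_def using step.hyps step.prems by (intro CollectI conjI bexI[of _ w]) auto
      then obtain w' where w': "w' \<in> W'" "w' $ k \<noteq> 0" "\<forall>j<k. w' $ j = 0"
        unfolding pivots_def by blast
      have cw: "w \<in> carrier_vec m" "w' \<in> carrier_vec m"
        using W W' step.prems(1) w'(1) by (auto simp: vec_subspace_def)
      define c where "c = w $ k / w' $ k"
      define u where "u = w + (- c) \<cdot>\<^sub>v w'"
      have "u \<in> W" unfolding u_def using W step.prems(1) w'(1) sub by (auto simp: vec_subspace_def)
      moreover have "\<forall>j<Suc k. u $ j = 0"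
        using cw step w' by (auto simp: u_def c_def less_Suc_eq)
      ultimately have "u \<in> W'" using step.IH by blast
      moreover have "w = u + c \<cdot>\<^sub>v w'"
        using cw by (intro eq_vecI) (auto simp: u_def)
      ultimately show ?thesis using W' w'(1) by (auto simp: vec_subspace_def)
    qed
  qed
  from this[of _ 0] sub show ?thesis by auto
qed

text \<open>A member with the fewest pivots is minimal: a member inside it cannot lose a pivot, so
  it is equal.\<close>

lemma minimal_subspace_exists:
  assumes "W0 \<in> \<W>" and "\<And>W. W \<in> \<W> \<Longrightarrow> vec_subspace m W"
  obtains W where "W \<in> \<W>" "\<And>W'. W' \<in> \<W> \<Longrightarrow> W' \<subseteq> W \<Longrightarrow> W' = W"
proof -
  obtain W where W: "W \<in> \<W>" "\<And>W'. W' \<in> \<W> \<Longrightarrow> card (pivots m W) \<le> card (pivots m W')"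
    using ex_has_least_nat[of "\<lambda>W. W \<in> \<W>" W0 "\<lambda>W. card (pivots m W)"] assms(1) by blast
  show ?thesis
  proof (rule that[OF W(1)])
    fix W' assume W': "W' \<in> \<W>" "W' \<subseteq> W"
    have "pivots m W' \<subseteq> pivots m W" using W'(2) unfolding pivots_def by blast
    moreover have "finite (pivots m W)" unfolding pivots_def by simp
    ultimately have "pivots m W' = pivots m W" using W(2)[OF W'(1)] by (simp add: card_seteq)
    then show "W' = W" by (rule eq_if_pivots_eq[OF assms(2)[OF W(1)] assms(2)[OF W'(1)] W'(2)])
  qed
qed

text \<open>The iterates A^k w stay in \<open>W\<close>. A polynomial p of least degree with p(A) w
  = 0 has a root a; writing p = (X - a) q, minimality makes q(A) w nonzero, and it is an eigenvector
  for a.\<close>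

lemma eigenvector_in_invariant_subspace:
  fixes A :: "'a::alg_closed_field mat"
  assumes A: "A \<in> carrier_mat m m" and W: "vec_subspace m W" and inv: "\<And>w. w \<in> W \<Longrightarrow> A *\<^sub>v w \<in> W"
    and w: "w \<in> W" "w \<noteq> 0\<^sub>v m"
  obtains v c where "v \<in> W" "v \<noteq> 0\<^sub>v m" "A *\<^sub>v v = c \<cdot>\<^sub>v v"
proof -
  define u where "u k = ((*\<^sub>v) A ^^ k) w" for k
  have uW: "u k \<in> W" for k
    by (induction k) (auto simp: u_def w inv)
  then have uc: "u k \<in> carrier_vec m" for k
    using W by (auto simp: vec_subspace_def)
  have uS: "u (Suc k) $ i = (\<Sum>j<m. A $$ (i, j) * u k $ j)" if "i < m" for k i
  proof -
    have "u (Suc k) = A *\<^sub>v u k" by (simp add: u_def)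
    then show ?thesis using that A uc[of k] by (simp add: scalar_prod_def atLeast0LessThan)
  qed
  define annih where "annih p \<longleftrightarrow> p \<noteq> 0 \<and> (\<forall>i<m. (\<Sum>k\<le>degree p. coeff p k * u k $ i) = 0)" for p
  have ex: "\<exists>p. annih p"
  proof -
    \<comment> \<open>The m + 1 iterates have m coordinates each. A zero row makes the matrix square
      and singular, and a kernel vector gives a linear dependence.\<close>
    define B where "B = mat (Suc m) (Suc m) (\<lambda>(i, k). if i < m then u k $ i else 0)"
    have B: "B \<in> carrier_mat (Suc m) (Suc m)" unfolding B_def by simp
    have "transpose_mat B *\<^sub>v unit_vec (Suc m) m = 0\<^sub>v (Suc m)"
      by (intro eq_vecI) (auto simp: B_def)
    moreover have "unit_vec (Suc m) m \<noteq> (0\<^sub>v (Suc m) :: 'a vec)"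
      by (metis index_unit_vec(2) index_zero_vec(1) lessI zero_neq_one)
    ultimately have "det (transpose_mat B) = 0"
      using B by (subst det_0_iff_vec_prod_zero[of _ "Suc m"]) (auto intro!: exI[of _ "unit_vec (Suc m) m"])
    then have "det B = 0" using det_transpose[OF B] by simp
    then obtain c where c: "c \<in> carrier_vec (Suc m)" "c \<noteq> 0\<^sub>v (Suc m)" "B *\<^sub>v c = 0\<^sub>v (Suc m)"
      using det_0_iff_vec_prod_zero[OF B] by blast
    define p where "p = Poly (list_of_vec c)"
    have cp: "coeff p k = (if k \<le> m then c $ k else 0)" for k
      using c(1) by (auto simp: p_def nth_default_def list_of_vec_index)
    have "p \<noteq> 0"
    proof
      assume "p = 0"
      then have "c $ k = 0" if "k \<le> m" for k using cp[of k] that by simp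
      then have "c = 0\<^sub>v (Suc m)" using c(1) by (intro eq_vecI) auto
      with c(2) show False by simp
    qed
    moreover have "(\<Sum>k\<le>degree p. coeff p k * u k $ i) = 0" if i: "i < m" for i
    proof -
      have d: "degree p \<le> m" by (rule degree_le) (simp add: cp)
      have "(\<Sum>k\<le>degree p. coeff p k * u k $ i) = (\<Sum>k\<le>m. coeff p k * u k $ i)"
        using d by (intro sum.mono_neutral_left) (auto simp: coeff_eq_0)
      also have "\<dots> = (B *\<^sub>v c) $ i"
        using i c(1) by (auto simp: B_def scalar_prod_def cp atLeast0LessThan lessThan_Suc_atMost mult.commute)
      finally show ?thesis using c(3) i by simp
    qed
    ultimately show ?thesis unfolding annih_def by blast
  qed
  obtain p where p: "annih p" and pmin: "\<And>q. annih q \<Longrightarrow> degree p \<le> degree q"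
    using ex_has_least_nat[of annih _ degree] ex by blast
  have "degree p > 0"
  proof (rule ccontr)
    assume "\<not> degree p > 0"
    then have "degree p = 0" by simp
    moreover from this have "coeff p 0 \<noteq> 0" using p unfolding annih_def by (metis leading_coeff_0_iff)
    ultimately have "u 0 $ i = 0" if "i < m" for i
      using p that unfolding annih_def by auto
    then have "u 0 = 0\<^sub>v m" using uc[of 0] by (intro eq_vecI) auto
    then show False using w(2) by (simp add: u_def)
  qed
  then obtain a where "poly p a = 0" using alg_closed_imp_poly_has_root by blast
  then obtain q where q: "p = [:-a, 1:] * q" by (metis dvdE poly_eq_0_iff_dvd)
  have q0: "q \<noteq> 0" using p q unfolding annih_def by auto
  then have dp: "degree p = Suc (degree q)" unfolding q by (subst degree_mult_eq) auto
  define v where "v = vec m (\<lambda>i. \<Sum>k\<le>degree q. coeff q k * u k $ i)"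
  have vc: "v \<in> carrier_vec m" by (simp add: v_def)
  have "v \<noteq> 0\<^sub>v m"
  proof
    assume "v = 0\<^sub>v m"
    then have "v $ i = 0" if "i < m" for i
      using that by simp
    then have "(\<Sum>k\<le>degree q. coeff q k * u k $ i) = 0" if "i < m" for i
      using that by (simp add: v_def)
    then have "annih q" using q0 unfolding annih_def by blast
    then show False using pmin dp by fastforce
  qed
  moreover have "v \<in> W"
  proof -
    have "vec m (\<lambda>i. \<Sum>k<n. f k * u k $ i) \<in> W" for n f
    proof (induction n)
      case 0
      have "vec m (\<lambda>i. \<Sum>k<0. f k * u k $ i) = 0\<^sub>v m" by (intro eq_vecI) auto
      then show ?case using W by (simp add: vec_subspace_def)
    next
      case (Suc n)
      have "vec m (\<lambda>i. \<Sum>k<Suc n. f k * u k $ i) = vec m (\<lambda>i. \<Sum>k<n. f k * u k $ i) + f n \<cdot>\<^sub>v u n"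
        using uc[of n] by (intro eq_vecI) auto
      then show ?case using Suc uW[of n] W by (auto simp: vec_subspace_def)
    qed
    then show ?thesis unfolding v_def lessThan_Suc_atMost[symmetric] .
  qed
  moreover have "A *\<^sub>v v = a \<cdot>\<^sub>v v"
  proof (rule eq_vecI)
    fix i assume "i < dim_vec (a \<cdot>\<^sub>v v)"
    then have i: "i < m" by (simp add: v_def)
    let ?d = "degree q"
    have "(A *\<^sub>v v) $ i = (\<Sum>j<m. A $$ (i, j) * (\<Sum>k\<le>?d. coeff q k * u k $ j))"
      using i A by (simp add: v_def scalar_prod_def atLeast0LessThan)
    also have "\<dots> = (\<Sum>k\<le>?d. coeff q k * u (Suc k) $ i)"
      unfolding sum_distrib_left uS[OF i] by (subst sum.swap) (simp add: mult_ac)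
    also have "\<dots> = (\<Sum>k\<le>Suc ?d. coeff (pCons 0 q) k * u k $ i)"
      by (simp add: sum.atMost_Suc_shift del: sum.atMost_Suc)
    \<comment> \<open>\<open>pCons 0 q\<close> is X q, and p = X q - a q, so the difference of the
      two sides is a coordinate of p(A) w = 0.\<close>
    also have "\<dots> - (\<Sum>k\<le>Suc ?d. coeff (Polynomial.smult a q) k * u k $ i) = (\<Sum>k\<le>Suc ?d. coeff p k * u k $ i)"
      unfolding sum_subtractf[symmetric] by (intro sum.cong refl) (simp add: q algebra_simps coeff_pCons split: nat.split)
    also have "(\<Sum>k\<le>Suc ?d. coeff p k * u k $ i) = 0"
      using p i unfolding annih_def dp by blast
    also have "(\<Sum>k\<le>Suc ?d. coeff (Polynomial.smult a q) k * u k $ i) = (a \<cdot>\<^sub>v v) $ i"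
      using i by (simp add: v_def coeff_eq_0 sum_distrib_left mult.assoc)
    finally show "(A *\<^sub>v v) $ i = (a \<cdot>\<^sub>v v) $ i" by simp
  qed (use A vc in auto)
  ultimately show ?thesis by (intro that)
qed


text \<open>The derived group acts by a character \<open>\<chi>\<close> on some vector. Connectedness makes \<open>\<chi>\<close>
  conjugation invariant, so the \<open>\<chi>\<close>-weight space is invariant, and makes \<open>\<chi>\<close> trivial on commutators
  \<open>a b a\<^sup>-\<^sup>1 b\<^sup>-\<^sup>1\<close>, so the group acts on the weight space by commuting operators.\<close>

theorem lie_kolchin:
  fixes \<rho> :: "'a::alg_closed_field mat \<Rightarrow> 'a mat"
  assumes "subgroup H (SL N)" "connectedin (zariski N) H"
    and "(derived (SL N) ^^ d) H = {1\<^sub>m N}"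
    and reg: "\<And>i j. i < m \<Longrightarrow> j < m \<Longrightarrow> regular_fun N (\<lambda>A. \<rho> A $$ (i, j))"
    and "\<And>g. g \<in> H \<Longrightarrow> \<rho> g \<in> carrier_mat m m"
    and "\<And>g h. g \<in> H \<Longrightarrow> h \<in> H \<Longrightarrow> \<rho> (g * h) = \<rho> g * \<rho> h"
    and one: "\<rho> (1\<^sub>m N) = 1\<^sub>m m" and m: "m > 0"
  shows "\<exists>v\<in>carrier_vec m. v \<noteq> 0\<^sub>v m \<and> (\<forall>h\<in>H. \<exists>c. \<rho> h *\<^sub>v v = c \<cdot>\<^sub>v v)"
  using assms(1-3,5,6)
proof (induction d arbitrary: H)
  case 0
  have "unit_vec m 0 \<noteq> (0\<^sub>v m :: 'a vec)"
    using m by (metis index_unit_vec(2) index_zero_vec(1) zero_neq_one)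
  moreover have "\<forall>h\<in>H. \<rho> h *\<^sub>v unit_vec m 0 = 1 \<cdot>\<^sub>v unit_vec m 0"
    using 0 one by simp
  moreover have "unit_vec m 0 \<in> (carrier_vec m :: 'a vec set)"
    by (rule unit_vec_carrier)
  ultimately show ?case by blast
next
  case (Suc d)
  note car = Suc.prems(4) and mul = Suc.prems(5)
  note H = Suc.prems(1) and con = Suc.prems(2)
  define D where "D = derived (SL N) H"
  note Hd = subgroup_special_linearD[OF H]
  interpret SL: group "SL N" by (rule group_special_linear)
  have D: "subgroup D (SL N)"
    unfolding D_def by (rule SL.derived_is_subgroup[OF subgroup.subset[OF H]])
  have DH: "D \<subseteq> H" unfolding D_def by (rule SL.derived_incl[OF subset_refl H])
  have comm: "a * b * adj_mat a * adj_mat b \<in> D" if "a \<in> H" "b \<in> H" for a b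
    unfolding D_def derived_def derived_set_special_linear[OF H] using that by (intro generate.incl) blast
  have "\<exists>v\<in>carrier_vec m. v \<noteq> 0\<^sub>v m \<and> (\<forall>h\<in>D. \<exists>c. \<rho> h *\<^sub>v v = c \<cdot>\<^sub>v v)"
  proof (rule Suc.IH[OF D])
    show "connectedin (zariski N) D" unfolding D_def by (rule connectedin_derived[OF H con])
    show "(derived (SL N) ^^ d) D = {1\<^sub>m N}"
      using Suc.prems(3) by (simp add: D_def funpow_swap1)
  qed (use DH car mul in blast)+
  then obtain v0 where v0: "v0 \<in> carrier_vec m" "v0 \<noteq> 0\<^sub>v m"
    and ev0: "\<And>h. h \<in> D \<Longrightarrow> \<exists>c. \<rho> h *\<^sub>v v0 = c \<cdot>\<^sub>v v0" by blast
  obtain i0 where i0: "i0 < m" "v0 $ i0 \<noteq> 0"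
    using v0 by (metis carrier_vecD eq_vecI index_zero_vec)
  \<comment> \<open>Reading the eigenvalue off one coordinate where \<open>v0\<close> is nonzero
    extends it to a regular function of all matrices, so that connectedness can be applied to
    it.\<close>
  define \<chi> where "\<chi> h = (\<Sum>j<m. \<rho> h $$ (i0, j) * v0 $ j) / v0 $ i0" for h
  have \<chi>: "\<rho> h *\<^sub>v v0 = \<chi> h \<cdot>\<^sub>v v0" if h: "h \<in> D" for h
  proof -
    obtain c where c: "\<rho> h *\<^sub>v v0 = c \<cdot>\<^sub>v v0" using ev0[OF h] by blast
    have "h \<in> H" using DH h by blast
    have "(\<rho> h *\<^sub>v v0) $ i0 = (\<Sum>j<m. \<rho> h $$ (i0, j) * v0 $ j)"
      using car[OF \<open>h \<in> H\<close>] v0(1) i0(1) by (simp add: scalar_prod_def atLeast0LessThan)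
    then have "c = \<chi> h" using i0 v0(1) by (simp add: c \<chi>_def eq_divide_eq)
    then show ?thesis using c by simp
  qed
  have reg\<chi>: "regular_fun N \<chi>"
  proof -
    have "regular_fun N (\<lambda>h. (\<Sum>j<m. \<rho> h $$ (i0, j) * v0 $ j) * (1 / v0 $ i0))"
      by (intro regular_fun_mult regular_fun_sum regular_fun_const reg i0) auto
    then show ?thesis unfolding \<chi>_def by simp
  qed
  have act: "\<rho> g *\<^sub>v (\<rho> h *\<^sub>v v) = \<rho> (g * h) *\<^sub>v v" if "g \<in> H" "h \<in> H" "v \<in> carrier_vec m" for g h v
    using that car[OF that(1)] car[OF that(2)] mul[OF that(1,2)] by simp
  have inj: "\<rho> g *\<^sub>v v \<noteq> 0\<^sub>v m" if g: "g \<in> H" and v: "v \<in> carrier_vec m" "v \<noteq> 0\<^sub>v m" for g v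
  proof
    assume "\<rho> g *\<^sub>v v = 0\<^sub>v m"
    then have "\<rho> (adj_mat g) *\<^sub>v (\<rho> g *\<^sub>v v) = 0\<^sub>v m"
      using car[OF Hd(5)[OF g]] by auto
    then show False using act[OF Hd(5)[OF g] g v(1)] Hd(7)[OF g] one v by simp
  qed
  have finite_ev: "finite (spectrum (\<rho> g))" if "g \<in> H" for g
    by (rule card_finite_spectrum(1)[OF car[OF that]])
  have ev: "c \<in> spectrum (\<rho> g)" if "g \<in> H" "v \<in> carrier_vec m" "v \<noteq> 0\<^sub>v m" "\<rho> g *\<^sub>v v = c \<cdot>\<^sub>v v" for g v c
    using that car[OF that(1)] unfolding spectrum_def eigenvalue_def eigenvector_def by auto
  have conj: "adj_mat g * h * g \<in> D" if "g \<in> H" "h \<in> D" for g h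
  proof -
    have h: "h \<in> H" using DH that by blast
    have "adj_mat g * h * adj_mat (adj_mat g) * adj_mat h * h \<in> D"
      using subgroup_special_linearD(4)[OF D comm[OF Hd(5)[OF that(1)] h] that(2)] .
    also have "adj_mat g * h * adj_mat (adj_mat g) * adj_mat h * h = adj_mat g * h * g * (adj_mat h * h)"
      unfolding adj_mat_subgroup(2)[OF H that(1)]
      using Hd(1)[OF h] Hd(1)[OF Hd(5)[OF h]] Hd(1)[OF that(1)] Hd(1)[OF Hd(5)[OF that(1)]]
      by (simp add: mat_assoc[where N = N])
    also have "\<dots> = adj_mat g * h * g"
      using Hd(7)[OF h] Hd(1)[OF h] Hd(1)[OF that(1)] Hd(1)[OF Hd(5)[OF that(1)]] by simp
    finally show ?thesis .
  qed
  have swap: "h * g = g * (adj_mat g * h * g)" if "g \<in> H" "h \<in> H" for g h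
  proof -
    have "g * (adj_mat g * h * g) = (g * adj_mat g) * (h * g)"
      using Hd(1)[OF that(1)] Hd(1)[OF that(2)] Hd(1)[OF Hd(5)[OF that(1)]]
      by (simp add: mat_assoc[where N = N])
    then show ?thesis using Hd(6)[OF that(1)] Hd(1)[OF that(1)] Hd(1)[OF that(2)] by simp
  qed
  have \<chi>conj: "\<chi> (adj_mat g * h * g) = \<chi> h" if g: "g \<in> H" and h: "h \<in> D" for g h
  proof -
    have hH: "h \<in> H" using DH h by blast
    \<comment> \<open>Each value is an eigenvalue of \<rho> h, with eigenvector \<rho> x v0, so only
      finitely many values occur; at x = 1 the value is \<chi> h.\<close>
    let ?F = "\<lambda>x. \<chi> (adj_mat x * h * x)"
    have "regular_fun N ?F"
      by (intro regular_fun_compose[OF reg\<chi>] regular_map_mult regular_map_adj regular_map_id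
          regular_map_const Hd(1)[OF hH])
    moreover have "?F ` H \<subseteq> spectrum (\<rho> h)"
    proof
      fix c assume "c \<in> ?F ` H"
      then obtain x where x: "x \<in> H" and c: "c = ?F x" by blast
      have "\<rho> h *\<^sub>v (\<rho> x *\<^sub>v v0) = \<rho> x *\<^sub>v (\<rho> (adj_mat x * h * x) *\<^sub>v v0)"
        using act[OF hH x v0(1)] act[OF x _ v0(1)] conj[OF x h] DH swap[OF x hH] by auto
      also have "\<dots> = c \<cdot>\<^sub>v (\<rho> x *\<^sub>v v0)"
        unfolding \<chi>[OF conj[OF x h]] c using car[OF x] v0(1) by (simp add: mult_mat_vec)
      finally show "c \<in> spectrum (\<rho> h)"
        using car[OF x] v0(1) inj[OF x v0] by (intro ev[OF hH]) auto
    qed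
    then have "finite (?F ` H)" using finite_ev[OF hH] finite_subset by blast
    ultimately have "?F g = ?F (1\<^sub>m N)"
      by (rule connected_regular_fun_constant[OF con _ _ g Hd(3)])
    then show ?thesis using Hd(1)[OF hH] by (simp add: adj_mat_subgroup(1)[OF H])
  qed
  define V where "V = {v \<in> carrier_vec m. \<forall>h\<in>D. \<rho> h *\<^sub>v v = \<chi> h \<cdot>\<^sub>v v}"
  \<comment> \<open>Nonzero \<open>H\<close>-invariant subspaces of the weight space. In a minimal
    one every element of \<open>H\<close> acts by a scalar, since an eigenspace of it there is again
    such a subspace.\<close>
  define \<W> where "\<W> = {W. vec_subspace m W \<and> W \<subseteq> V \<and> (\<exists>w\<in>W. w \<noteq> 0\<^sub>v m) \<and> (\<forall>g\<in>H. \<forall>w\<in>W. \<rho> g *\<^sub>v w \<in> W)}"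
  have "V \<in> \<W>"
    unfolding \<W>_def
  proof (intro CollectI conjI ballI)
    have hm: "h \<in> D \<Longrightarrow> \<rho> h \<in> carrier_mat m m" for h using DH car by blast
    have "\<rho> h *\<^sub>v 0\<^sub>v m = \<chi> h \<cdot>\<^sub>v 0\<^sub>v m" if "h \<in> D" for h
      using hm[OF that] by (intro eq_vecI) auto
    then show "vec_subspace m V"
      unfolding vec_subspace_def V_def
      by (auto simp: mult_add_distrib_mat_vec[OF hm] mult_mat_vec[OF hm] smult_add_distrib_vec
          smult_smult_assoc mult.commute)
    show "\<exists>w\<in>V. w \<noteq> 0\<^sub>v m" using v0 \<chi> unfolding V_def by blast
  next
    fix g w assume g: "g \<in> H" and w: "w \<in> V"
    have wc: "w \<in> carrier_vec m" using w unfolding V_def by blast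
    have "\<rho> h *\<^sub>v (\<rho> g *\<^sub>v w) = \<chi> h \<cdot>\<^sub>v (\<rho> g *\<^sub>v w)" if h: "h \<in> D" for h
    proof -
      have hH: "h \<in> H" using DH h by blast
      have "\<rho> h *\<^sub>v (\<rho> g *\<^sub>v w) = \<rho> g *\<^sub>v (\<rho> (adj_mat g * h * g) *\<^sub>v w)"
        using act[OF hH g wc] act[OF g _ wc] conj[OF g h] DH swap[OF g hH] by auto
      also have "\<rho> (adj_mat g * h * g) *\<^sub>v w = \<chi> h \<cdot>\<^sub>v w"
        using w conj[OF g h] \<chi>conj[OF g h] unfolding V_def by auto
      also have "\<rho> g *\<^sub>v (\<chi> h \<cdot>\<^sub>v w) = \<chi> h \<cdot>\<^sub>v (\<rho> g *\<^sub>v w)"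
        by (rule mult_mat_vec[OF car[OF g] wc])
      finally show ?thesis .
    qed
    then show "\<rho> g *\<^sub>v w \<in> V"
      using car[OF g] wc unfolding V_def by auto
  qed auto
  then obtain W where W: "W \<in> \<W>" and Wmin: "\<And>W'. W' \<in> \<W> \<Longrightarrow> W' \<subseteq> W \<Longrightarrow> W' = W"
    by (rule minimal_subspace_exists[where m = m]) (auto simp: \<W>_def)
  have Ws: "vec_subspace m W" and WV: "W \<subseteq> V" and Winv: "\<And>g w. g \<in> H \<Longrightarrow> w \<in> W \<Longrightarrow> \<rho> g *\<^sub>v w \<in> W"
    using W unfolding \<W>_def by blast+
  obtain w0 where w0: "w0 \<in> W" "w0 \<noteq> 0\<^sub>v m" using W unfolding \<W>_def by blast
  have Wc: "w \<in> carrier_vec m" if "w \<in> W" for w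
    using that Ws unfolding vec_subspace_def by blast
  have "\<exists>c. \<rho> a *\<^sub>v w0 = c \<cdot>\<^sub>v w0" if a: "a \<in> H" for a
  proof -
    obtain w1 c where w1: "w1 \<in> W" "w1 \<noteq> 0\<^sub>v m" and c: "\<rho> a *\<^sub>v w1 = c \<cdot>\<^sub>v w1"
      by (rule eigenvector_in_invariant_subspace[OF car[OF a] Ws Winv[OF a] w0]) blast+
    have c0: "c \<noteq> 0"
    proof
      assume "c = 0"
      then have "\<rho> a *\<^sub>v w1 = 0\<^sub>v m" using c Wc[OF w1(1)] by auto
      then show False using inj[OF a Wc[OF w1(1)] w1(2)] by simp
    qed
    \<comment> \<open>Moving \<open>a\<close> past \<open>b\<close> costs this commutator, which
      acts on the weight space through \<chi>. Hence \<rho> b sends eigenvectors of \<rho> a to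
      eigenvectors, with \<open>c\<close> multiplied by \<chi> of the commutator.\<close>
    let ?k = "\<lambda>b. a * b * adj_mat a * adj_mat b"
    have ab: "a * b = ?k b * (b * a)" if b: "b \<in> H" for b
    proof -
      have "?k b * (b * a) = a * b * (adj_mat a * ((adj_mat b * b) * a))"
        using Hd(1)[OF a] Hd(1)[OF b] Hd(1)[OF Hd(5)[OF a]] Hd(1)[OF Hd(5)[OF b]]
        by (simp add: mat_assoc[where N = N])
      then show ?thesis using Hd(1)[OF a] Hd(1)[OF b] Hd(7)[OF a] Hd(7)[OF b] by simp
    qed
    have rel: "\<rho> a *\<^sub>v (\<rho> b *\<^sub>v w) = (\<chi> (?k b) * c) \<cdot>\<^sub>v (\<rho> b *\<^sub>v w)"
      if b: "b \<in> H" and w: "w \<in> W" "\<rho> a *\<^sub>v w = c \<cdot>\<^sub>v w" for b w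
    proof -
      have k: "?k b \<in> D" "?k b \<in> H" using comm[OF a b] DH by blast+
      have "\<rho> a *\<^sub>v (\<rho> b *\<^sub>v w) = \<rho> (?k b * (b * a)) *\<^sub>v w"
        using act[OF a b Wc[OF w(1)]] ab[OF b] by simp
      also have "\<dots> = \<rho> (?k b) *\<^sub>v (\<rho> b *\<^sub>v (\<rho> a *\<^sub>v w))"
        using act[OF k(2) Hd(4)[OF b a] Wc[OF w(1)]] act[OF b a Wc[OF w(1)]] by simp
      also have "\<rho> b *\<^sub>v (\<rho> a *\<^sub>v w) = c \<cdot>\<^sub>v (\<rho> b *\<^sub>v w)"
        unfolding w(2) by (rule mult_mat_vec[OF car[OF b] Wc[OF w(1)]])
      also have "\<rho> (?k b) *\<^sub>v (c \<cdot>\<^sub>v (\<rho> b *\<^sub>v w)) = c \<cdot>\<^sub>v (\<rho> (?k b) *\<^sub>v (\<rho> b *\<^sub>v w))"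
        by (rule mult_mat_vec[OF car[OF k(2)] Wc[OF Winv[OF b w(1)]]])
      also have "\<rho> (?k b) *\<^sub>v (\<rho> b *\<^sub>v w) = \<chi> (?k b) \<cdot>\<^sub>v (\<rho> b *\<^sub>v w)"
        using WV Winv[OF b w(1)] k(1) unfolding V_def by blast
      finally show ?thesis by (simp add: smult_smult_assoc mult.commute)
    qed
    \<comment> \<open>The product of this value with the nonzero \<open>c\<close> is an eigenvalue
      of \<rho> a, so finitely many values occur as \<open>b\<close> varies over the connected
      group; at b = 1 the value is 1.\<close>
    have \<chi>1: "\<chi> (?k b) = 1" if b: "b \<in> H" for b
    proof -
      have "regular_fun N (\<lambda>b. \<chi> (?k b))"
        by (intro regular_fun_compose[OF reg\<chi>] regular_map_mult regular_map_adj regular_map_id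
            regular_map_const Hd(1)[OF a])
      moreover have "(\<lambda>b. \<chi> (?k b)) ` H \<subseteq> (\<lambda>x. x / c) ` spectrum (\<rho> a)"
      proof
        fix x assume "x \<in> (\<lambda>b. \<chi> (?k b)) ` H"
        then obtain b where b: "b \<in> H" "x = \<chi> (?k b)" by blast
        have "x * c \<in> spectrum (\<rho> a)"
          using rel[OF b(1) w1(1) c] inj[OF b(1) Wc[OF w1(1)] w1(2)] Wc[OF Winv[OF b(1) w1(1)]] b(2)
          by (intro ev[OF a]) auto
        moreover have "x = x * c / c" using c0 by simp
        ultimately show "x \<in> (\<lambda>x. x / c) ` spectrum (\<rho> a)" by (intro image_eqI[of x _ "x * c"])
      qed
      then have "finite ((\<lambda>b. \<chi> (?k b)) ` H)"
        using finite_ev[OF a] by (meson finite_imageI finite_subset)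
      ultimately have "\<chi> (?k b) = \<chi> (?k (1\<^sub>m N))"
        by (rule connected_regular_fun_constant[OF con _ _ b Hd(3)])
      also have "?k (1\<^sub>m N) = 1\<^sub>m N"
        using Hd(1)[OF a] Hd(6)[OF a] by (simp add: adj_mat_subgroup(1)[OF H])
      also have "\<chi> (1\<^sub>m N) = 1"
        using i0 v0(1) unfolding \<chi>_def one
        by (simp add: if_distrib[of "\<lambda>x. x * _"] cong: if_cong)
      finally show ?thesis .
    qed
    let ?W = "{w \<in> W. \<rho> a *\<^sub>v w = c \<cdot>\<^sub>v w}"
    have "?W \<in> \<W>"
      unfolding \<W>_def
    proof (intro CollectI conjI ballI)
      have "\<rho> a *\<^sub>v 0\<^sub>v m = c \<cdot>\<^sub>v 0\<^sub>v m" using car[OF a] by (auto intro!: eq_vecI)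
      then show "vec_subspace m ?W"
        using Ws car[OF a] unfolding vec_subspace_def
        by (auto simp: mult_add_distrib_mat_vec[OF car[OF a]] mult_mat_vec[OF car[OF a]] subset_iff
            smult_add_distrib_vec[of _ m] smult_smult_assoc mult.commute)
      show "\<exists>w\<in>?W. w \<noteq> 0\<^sub>v m" using w1 c by blast
    next
      fix b w assume b: "b \<in> H" and w: "w \<in> ?W"
      then show "\<rho> b *\<^sub>v w \<in> W" "\<rho> a *\<^sub>v (\<rho> b *\<^sub>v w) = c \<cdot>\<^sub>v (\<rho> b *\<^sub>v w)"
        using Winv[OF b, of w] rel[OF b, of w] \<chi>1[OF b] by auto
    qed (use WV in auto)
    then have "?W = W" by (rule Wmin) blast
    then show ?thesis using w0(1) by blast
  qed
  then show ?case using w0 Wc by blast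
qed

section \<open>The upper triangular Borel subgroup\<close>

text \<open>The derived series of \<open>H\<close> as a group of its own and as a subset of
  \<open>SL N\<close> coincide, so solvability can be read in the ambient group.\<close>

lemma solvable_subgroup_special_linear:
  assumes H: "subgroup H (SL N)"
  shows "solvable (SL N \<lparr>carrier := H\<rparr>) \<longleftrightarrow> (\<exists>d. (derived (SL N) ^^ d) H = {1\<^sub>m N})"
proof -
  interpret SL: group "SL N" by (rule group_special_linear)
  interpret S: group "special_linear N \<lparr>carrier := H\<rparr>" by (rule SL.subgroup_imp_group[OF H])
  have "(derived (SL N \<lparr>carrier := H\<rparr>) ^^ d) H = (derived (SL N) ^^ d) H \<and>
      (derived (SL N) ^^ d) H \<subseteq> H" for d
    by (induction d) (use SL.derived_consistent[OF _ H] SL.derived_incl[OF _ H] in auto)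
  then show ?thesis
    unfolding S.solvable_iff_trivial_derived_seq by simp
qed

lemma lie_kolchin_solvable:
  fixes \<rho> :: "'a::alg_closed_field mat \<Rightarrow> 'a mat"
  assumes H: "closed_connected_solvable N H"
    and "\<And>i j. i < m \<Longrightarrow> j < m \<Longrightarrow> regular_fun N (\<lambda>A. \<rho> A $$ (i, j))"
    and "\<And>g. g \<in> H \<Longrightarrow> \<rho> g \<in> carrier_mat m m"
    and "\<And>g h. g \<in> H \<Longrightarrow> h \<in> H \<Longrightarrow> \<rho> (g * h) = \<rho> g * \<rho> h"
    and "\<rho> (1\<^sub>m N) = 1\<^sub>m m" and "m > 0"
  obtains v where "v \<in> carrier_vec m" "v \<noteq> 0\<^sub>v m" "\<And>h. h \<in> H \<Longrightarrow> \<exists>c. \<rho> h *\<^sub>v v = c \<cdot>\<^sub>v v"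
proof -
  have s: "subgroup H (SL N)" "connectedin (zariski N) H"
    "solvable (SL N \<lparr>carrier := H\<rparr>)"
    using H unfolding closed_connected_solvable_def by auto
  obtain d where "(derived (SL N) ^^ d) H = {1\<^sub>m N}"
    using s(3) solvable_subgroup_special_linear[OF s(1)] by blast
  from lie_kolchin[OF s(1,2) this assms(2-6)] show ?thesis
    using that by blast
qed

section \<open>The upper triangular group and its filtration by superdiagonals\<close>

definition upper_SL :: "nat \<Rightarrow> 'a::field mat set" where
  "upper_SL N = {A \<in> carrier_mat N N. upper_triangular A \<and> det A = 1}"

text \<open>Filtration by superdiagonals: index 0 means upper triangular, index 1 strictly upper
  triangular. The index adds under products, which drives the solvability proof.\<close>

definition upper_from :: "nat \<Rightarrow> nat \<Rightarrow> 'a::field mat \<Rightarrow> bool" where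
  "upper_from N k A \<longleftrightarrow> A \<in> carrier_mat N N \<and> (\<forall>i<N. \<forall>j<N. j < i + k \<longrightarrow> A $$ (i, j) = 0)"

lemma upper_from_0: "A \<in> carrier_mat N N \<Longrightarrow> upper_from N 0 A \<longleftrightarrow> upper_triangular A"
  unfolding upper_from_def upper_triangular_def by auto

lemma upper_from_mono: "upper_from N k A \<Longrightarrow> l \<le> k \<Longrightarrow> upper_from N l A"
  unfolding upper_from_def by auto

lemma upper_from_mult:
  assumes A: "upper_from N k A" and B: "upper_from N l B"
  shows "upper_from N (k + l) (A * B)"
  unfolding upper_from_def
proof (intro conjI allI impI)
  fix i j assume ij: "i < N" "j < N" "j < i + (k + l)"
  have "A $$ (i, p) * B $$ (p, j) = 0" if "p < N" for p
    using A B ij that unfolding upper_from_def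
    by (cases "p < i + k") auto
  then have "(\<Sum>p = 0..<N. A $$ (i, p) * B $$ (p, j)) = 0"
    by (intro sum.neutral) (simp del: mult_eq_0_iff)
  moreover have car: "A \<in> carrier_mat N N" "B \<in> carrier_mat N N"
    using A B by (auto simp: upper_from_def)
  moreover have "(A * B) $$ (i, j) = (\<Sum>p = 0..<N. A $$ (i, p) * B $$ (p, j))"
    using car ij(1,2) by (simp add: scalar_prod_def)
  ultimately show "(A * B) $$ (i, j) = 0" by simp
qed (use A B in \<open>auto simp: upper_from_def\<close>)

lemma upper_from_add: "upper_from N k A \<Longrightarrow> upper_from N k B \<Longrightarrow> upper_from N k (A + B)"
  unfolding upper_from_def by auto

lemma upper_from_diff: "upper_from N k A \<Longrightarrow> upper_from N k B \<Longrightarrow> upper_from N k (A - B)"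
  unfolding upper_from_def by auto

lemma upper_triangular_mult:
  fixes A B :: "'a::field mat"
  assumes "A \<in> carrier_mat N N" "B \<in> carrier_mat N N" "upper_triangular A" "upper_triangular B"
  shows "upper_triangular (A * B)"
  using upper_from_mult[of N 0 A 0 B] assms by (simp add: upper_from_0)

lemma upper_triangular_diag_nonzero:
  fixes A :: "'a::field mat"
  assumes "A \<in> carrier_mat N N" "upper_triangular A" "det A \<noteq> 0" "i < N"
  shows "A $$ (i, i) \<noteq> 0"
  using assms upper_triangular_imp_det_eq_0_iff[OF assms(1,2)] by (auto simp: diag_mat_def)

text \<open>Along row i: with the earlier entries of that row of \<open>B\<close> already zero, the
  (i, j) entry of \<open>B * A\<close> is B_ij A_jj, and A_jj is nonzero.\<close>

lemma upper_triangular_left_inverse: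
  fixes A B :: "'a::field mat"
  assumes A: "A \<in> carrier_mat N N" and B: "B \<in> carrier_mat N N"
    and up: "upper_triangular A" and BA: "B * A = 1\<^sub>m N"
  shows "upper_triangular B"
proof -
  have "det A \<noteq> 0" using det_mult[OF B A] BA by auto
  have "B $$ (i, j) = 0" if "i < N" "j < i" for i j
    using that(2)
  proof (induction j rule: less_induct)
    case (less j)
    have "0 = (B * A) $$ (i, j)" using less(2) that(1) by (simp add: BA)
    also have "\<dots> = (\<Sum>p = 0..<N. B $$ (i, p) * A $$ (p, j))"
      using A B less(2) that(1) by (simp add: scalar_prod_def)
    also have "\<dots> = (\<Sum>p\<in>{j}. B $$ (i, p) * A $$ (p, j))"
      using less that(1) up A
      by (intro sum.mono_neutral_right) (auto simp: upper_triangular_def, metis less_trans linorder_neqE_nat)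
    finally show ?case
      using upper_triangular_diag_nonzero[OF A up \<open>det A \<noteq> 0\<close>, of j] less(2) that(1) by simp
  qed
  then show ?thesis using B by (auto simp: upper_triangular_def)
qed

text \<open>At k = 0 this is the whole group, at k = 1 the unitriangular matrices, and at k = N only
  the identity; it dominates the derived series term by term.\<close>

definition unipotent_filtration :: "nat \<Rightarrow> nat \<Rightarrow> 'a::field mat set" where
  "unipotent_filtration N k = {A \<in> upper_SL N. upper_from N k (A - 1\<^sub>m N)}"

lemma unipotent_filtration_0: "unipotent_filtration N 0 = upper_SL N"
  unfolding unipotent_filtration_def upper_SL_def
  by (auto simp: upper_from_def upper_triangular_def)

text \<open>Closure follows from a b - 1 = a (b - 1) + (a - 1) and a^-1 - 1 = - a^-1 (a - 1), as
  upper triangular factors preserve the superdiagonal index.\<close>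

lemma subgroup_unipotent_filtration:
  "subgroup (unipotent_filtration N k) (SL N :: 'a::field mat monoid)"
proof (rule group.subgroupI[OF group_special_linear])
  show "unipotent_filtration N k \<subseteq> carrier (SL N)"
    by (auto simp: unipotent_filtration_def upper_SL_def)
  have "1\<^sub>m N \<in> unipotent_filtration N k"
    by (auto simp: unipotent_filtration_def upper_SL_def upper_from_def)
  then show "unipotent_filtration N k \<noteq> {}" by blast
next
  fix a :: "'a mat" assume a: "a \<in> unipotent_filtration N k"
  then have ac: "a \<in> carrier_mat N N" "det a = 1" and ua: "upper_triangular a"
    by (auto simp: unipotent_filtration_def upper_SL_def)
  note adj = adj_mat_special_linear[OF ac]
  have up: "upper_triangular (adj_mat a)"
    by (rule upper_triangular_left_inverse[OF ac(1) adj(1) ua adj(3)])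
  have "upper_from N (0 + k) (adj_mat a * (a - 1\<^sub>m N))"
    using a by (intro upper_from_mult) (auto simp: upper_from_0[OF adj(1)] up unipotent_filtration_def)
  moreover have "adj_mat a - 1\<^sub>m N = 0\<^sub>m N N - adj_mat a * (a - 1\<^sub>m N)"
    using adj ac by (subst mult_minus_distrib_mat[of _ N N]) auto
  moreover have "upper_from N k (0\<^sub>m N N)" by (auto simp: upper_from_def)
  ultimately show "inv\<^bsub>SL N\<^esub> a \<in> unipotent_filtration N k"
    using adj up by (auto simp: inv_special_linear[OF ac] unipotent_filtration_def upper_SL_def intro: upper_from_diff)
next
  fix a b :: "'a mat" assume a: "a \<in> unipotent_filtration N k" and b: "b \<in> unipotent_filtration N k"
  then have ac: "a \<in> carrier_mat N N" "det a = 1" and ua: "upper_triangular a"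
    and bc: "b \<in> carrier_mat N N" "det b = 1" and ub: "upper_triangular b"
    by (auto simp: unipotent_filtration_def upper_SL_def)
  have "upper_from N (0 + k) (a * (b - 1\<^sub>m N))"
    using b by (intro upper_from_mult) (auto simp: upper_from_0[OF ac(1)] ua unipotent_filtration_def)
  moreover have "a * b - 1\<^sub>m N = a * (b - 1\<^sub>m N) + (a - 1\<^sub>m N)"
    using ac bc by (subst mult_minus_distrib_mat[of _ N N]) auto
  ultimately show "a \<otimes>\<^bsub>SL N\<^esub> b \<in> unipotent_filtration N k"
    using a ac bc ua ub det_mult[OF ac(1) bc(1)] upper_triangular_mult[OF ac(1) bc(1)]
    by (auto simp: unipotent_filtration_def upper_SL_def intro!: upper_from_add)
qed

text \<open>For k > 0 the difference a b - b a equals the additive commutator of a - 1 and b - 1,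
  which has index 2k, at least k + 1. For k = 0 this gains nothing; there the diagonals of a b and b
  a agree.\<close>

lemma commutator_upper_from:
  assumes a: "a \<in> unipotent_filtration N k" and b: "b \<in> unipotent_filtration N k"
  shows "upper_from N (Suc k) (a * b - b * a)"
proof (cases k)
  case 0
  have ac: "a \<in> carrier_mat N N" "upper_triangular a" and bc: "b \<in> carrier_mat N N" "upper_triangular b"
    using a b by (auto simp: unipotent_filtration_def upper_SL_def)
  have diag: "(x * y) $$ (i, i) = x $$ (i, i) * y $$ (i, i)"
    if x: "x \<in> carrier_mat N N" "upper_triangular x" and y: "y \<in> carrier_mat N N" "upper_triangular y" and i: "i < N"
    for x y :: "'a mat" and i
  proof -
    have "(x * y) $$ (i, i) = (\<Sum>p = 0..<N. x $$ (i, p) * y $$ (p, i))"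
      using x y i by (simp add: scalar_prod_def)
    also have "\<dots> = (\<Sum>p\<in>{i}. x $$ (i, p) * y $$ (p, i))"
      using x y i by (intro sum.mono_neutral_right)
        (auto simp: upper_triangular_def, metis linorder_neqE_nat)
    finally show ?thesis by simp
  qed
  have "upper_from N 0 (a * b - b * a)"
    using upper_triangular_mult[OF ac(1) bc(1) ac(2) bc(2)] upper_triangular_mult[OF bc(1) ac(1) bc(2) ac(2)] ac bc
    by (intro upper_from_diff) (auto simp: upper_from_0)
  moreover have "(a * b - b * a) $$ (i, i) = 0" if "i < N" for i
  proof -
    have "(a * b - b * a) $$ (i, i) = (a * b) $$ (i, i) - (b * a) $$ (i, i)"
      using ac bc that by auto
    then show ?thesis using diag[OF ac bc that] diag[OF bc ac that] by simp
  qed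
  ultimately show ?thesis unfolding 0 upper_from_def
    by (auto simp: less_Suc_eq_le le_less simp del: index_mult_mat index_minus_mat)
next
  case (Suc l)
  let ?a = "a - 1\<^sub>m N" and ?b = "b - 1\<^sub>m N"
  have ac: "a \<in> carrier_mat N N" and bc: "b \<in> carrier_mat N N"
    using a b by (auto simp: unipotent_filtration_def upper_SL_def)
  have "upper_from N (k + k) (?a * ?b - ?b * ?a)"
    using a b by (intro upper_from_diff[OF upper_from_mult upper_from_mult])
      (simp_all add: unipotent_filtration_def)
  moreover have "?a * ?b - ?b * ?a = a * b - b * a"
  proof -
    have e: "(x - 1\<^sub>m N) * (y - 1\<^sub>m N) = x * y - x - y + 1\<^sub>m N"
      if "x \<in> carrier_mat N N" "y \<in> carrier_mat N N" for x y :: "'a mat"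
    proof -
      have "(x - 1\<^sub>m N) * (y - 1\<^sub>m N) = x * (y - 1\<^sub>m N) - 1\<^sub>m N * (y - 1\<^sub>m N)"
        using that by (intro minus_mult_distrib_mat) auto
      also have "x * (y - 1\<^sub>m N) = x * y - x"
        using that mult_minus_distrib_mat[of x N N y N "1\<^sub>m N"] by simp
      also have "1\<^sub>m N * (y - 1\<^sub>m N) = y - 1\<^sub>m N"
        using that by (intro left_mult_one_mat) auto
      also have "x * y - x - (y - 1\<^sub>m N) = x * y - x - y + 1\<^sub>m N"
        using that by (intro eq_matI) auto
      finally show ?thesis .
    qed
    show ?thesis unfolding e[OF ac bc] e[OF bc ac] using ac bc
      by (intro eq_matI) (auto simp del: index_mult_mat(1))
  qed
  ultimately have "upper_from N (k + k) (a * b - b * a)" by simp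
  then show ?thesis using Suc by (rule_tac upper_from_mono) auto
qed

text \<open>A commutator minus 1 is (a b - b a) (b a)^-1, and the last factor is upper
  triangular.\<close>

lemma derived_unipotent_filtration:
  "derived (SL N :: 'a::field mat monoid) (unipotent_filtration N k) \<subseteq> unipotent_filtration N (Suc k)"
proof -
  interpret SL: group "SL N :: 'a mat monoid" by (rule group_special_linear)
  note S = subgroup_unipotent_filtration[of N k, where 'a = 'a]
  note Sd = subgroup_special_linearD[OF S]
  show ?thesis unfolding derived_def derived_set_special_linear[OF S]
  proof (rule SL.generate_subgroup_incl[OF _ subgroup_unipotent_filtration], intro UN_least, simp)
    fix a b :: "'a mat" assume a: "a \<in> unipotent_filtration N k" and b: "b \<in> unipotent_filtration N k"
    let ?a' = "adj_mat a" and ?b' = "adj_mat b"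
    note car = Sd(1)[OF a] Sd(1)[OF b] Sd(1)[OF Sd(5)[OF a]] Sd(1)[OF Sd(5)[OF b]]
    have w: "a * b * ?a' * ?b' \<in> unipotent_filtration N k"
      using Sd(4,5) a b by blast
    have ab: "?a' * ?b' \<in> unipotent_filtration N k"
      using Sd(4,5) a b by blast
    have "b * a * (?a' * ?b') = b * ((a * ?a') * ?b')"
      using car by (simp add: mat_assoc[where N = N])
    also have "\<dots> = 1\<^sub>m N" using Sd(6)[OF a] Sd(6)[OF b] car by simp
    finally have inv: "b * a * (?a' * ?b') = 1\<^sub>m N" .
    have "a * b * ?a' * ?b' = a * b * (?a' * ?b')"
      using car by (simp add: mat_assoc[where N = N])
    then have "a * b * ?a' * ?b' - 1\<^sub>m N = (a * b - b * a) * (?a' * ?b')"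
      using car inv minus_mult_distrib_mat[of "a * b" N N "b * a" "?a' * ?b'" N] by simp
    moreover have "upper_from N (Suc k + 0) ((a * b - b * a) * (?a' * ?b'))"
      using ab by (intro upper_from_mult commutator_upper_from a b)
        (auto simp: unipotent_filtration_def upper_SL_def upper_from_0)
    ultimately show "a * b * ?a' * ?b' \<in> unipotent_filtration N (Suc k)"
      using w by (simp add: unipotent_filtration_def)
  qed
qed

lemma closed_connected_solvable_upper_SL:
  assumes N: "N > 0"
  shows "closed_connected_solvable N (upper_SL N :: 'a::alg_closed_field mat set)"
proof -
  let ?T = "upper_SL N :: 'a mat set"
  interpret SL: group "SL N :: 'a mat monoid" by (rule group_special_linear)
  have sub: "subgroup ?T (SL N)"
    using subgroup_unipotent_filtration[of N 0] by (simp add: unipotent_filtration_0)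
  have "closedin (zariski N) ?T"
  proof -
    let ?F = "insert (\<lambda>A. det A - 1) ((\<lambda>(i, j) A. A $$ (i, j)) ` {(i, j). i < N \<and> j < i})"
    have "closedin (zariski N) {A \<in> carrier_mat N N. \<forall>f\<in>?F. f A = (0 :: 'a)}"
      by (rule closedin_zariski_regular)
        (auto intro!: regular_fun_diff regular_fun_det regular_map_id)
    also have "{A \<in> carrier_mat N N. \<forall>f\<in>?F. f A = (0 :: 'a)} = ?T"
      by (auto simp: upper_SL_def upper_triangular_def)
    finally show ?thesis .
  qed
  moreover have "connectedin (zariski N) ?T"
  proof -
    have sub: "?T \<subseteq> carrier_mat N N" by (auto simp: upper_SL_def)
    have "connected_component_of (subtopology (zariski N) ?T) a b" if a: "a \<in> ?T" and b: "b \<in> ?T" for a b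
    proof -
      \<comment> \<open>\<delta> is the determinant along the line from \<open>a\<close> to
        \<open>b\<close>. Dividing row 0 by it restores determinant 1 and gives a rational curve
        through both points, since \<delta> is 1 at t = 0 and at t = 1.\<close>
      define \<delta> where "\<delta> = (\<Prod>i<N. [:a $$ (i, i), b $$ (i, i) - a $$ (i, i):])"
      define M where "M t i j = a $$ (i, j) + t * (b $$ (i, j) - a $$ (i, j))" for t i j
      define \<gamma> where "\<gamma> t = mat N N (\<lambda>(i, j). if i = 0 then M t i j / poly \<delta> t else M t i j)" for t
      have \<delta>: "poly \<delta> t = (\<Prod>i<N. M t i i)" for t
        by (simp add: \<delta>_def poly_prod M_def)
      have det_diag: "det A = (\<Prod>i<N. A $$ (i, i))" if "A \<in> carrier_mat N N" "upper_triangular A" for A :: "'a mat"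
        using det_upper_triangular[OF that(2,1)] that(1)
        by (simp add: diag_mat_def prod.list_conv_set_nth atLeast0LessThan)
      have rc: "rational_curve N \<delta> \<gamma>"
        unfolding rational_curve_def
      proof (intro conjI allI impI)
        fix i j assume ij: "i < N" "j < N"
        define p where "p = [:a $$ (i, j), b $$ (i, j) - a $$ (i, j):]"
        have p: "poly p t = M t i j" for t
          by (simp add: p_def M_def)
        show "\<exists>q. \<forall>t. poly \<delta> t \<noteq> 0 \<longrightarrow> \<gamma> t $$ (i, j) * poly \<delta> t = poly q t"
          by (rule exI[of _ "p * (if i = 0 then 1 else \<delta>)"])
            (use ij in \<open>auto simp: \<gamma>_def p\<close>)
      qed (auto simp: \<gamma>_def)
      have "\<gamma> t \<in> ?T" if "poly \<delta> t \<noteq> 0" for t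
      proof -
        have up: "upper_triangular (\<gamma> t)"
          using a b by (auto simp: \<gamma>_def M_def upper_SL_def upper_triangular_def)
        obtain n where n: "N = Suc n" using N by (cases N) auto
        have "(\<Prod>i<N. \<gamma> t $$ (i, i)) = (\<Prod>i<N. M t i i) / poly \<delta> t"
          unfolding n prod.lessThan_Suc_shift by (simp add: \<gamma>_def n)
        also have "\<dots> = 1" using that \<delta> by simp
        finally show ?thesis using det_diag[OF _ up] up by (auto simp: upper_SL_def \<gamma>_def)
      qed
      moreover have "poly \<delta> 0 = 1"
        using det_diag[of a] a \<delta>[of 0] by (simp add: upper_SL_def M_def)
      moreover have "poly \<delta> 1 = 1"
        using det_diag[of b] b \<delta>[of 1] by (simp add: upper_SL_def M_def)
      moreover from calculation have "\<gamma> 0 = a" "\<gamma> 1 = b"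
        using a b by (auto intro!: eq_matI simp: \<gamma>_def M_def upper_SL_def)
      moreover have "connectedin (zariski N) (\<gamma> ` {t. poly \<delta> t \<noteq> 0})"
        by (rule connectedin_rational_curve[OF rc])
      ultimately show ?thesis
        unfolding connected_component_of_def connectedin_subtopology
        by (intro exI[of _ "\<gamma> ` {t. poly \<delta> t \<noteq> 0}"]) force
    qed
    then have "connected_space (subtopology (zariski N) ?T)"
      unfolding connected_space_iff_connected_component by auto
    then show ?thesis using sub by (simp add: connectedin_def topspace_zariski)
  qed
  moreover have "solvable (SL N \<lparr>carrier := ?T\<rparr>)"
  proof -
    have "(derived (SL N) ^^ k) ?T \<subseteq> unipotent_filtration N k" for k
    proof (induction k)
      case (Suc k)
      have "derived (SL N) ((derived (SL N) ^^ k) ?T) \<subseteq>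
          derived (SL N) (unipotent_filtration N k)"
        by (rule SL.mono_derived[OF Suc])
      then show ?case using derived_unipotent_filtration by auto
    qed (simp add: unipotent_filtration_0)
    from this[of N] have "(derived (SL N) ^^ N) ?T \<subseteq> {1\<^sub>m N}"
      by (auto simp: unipotent_filtration_def upper_from_def upper_SL_def intro!: eq_matI)
    moreover have "1\<^sub>m N \<in> (derived (SL N) ^^ N) ?T"
      using subgroup.one_closed[OF SL.exp_of_derived_is_subgroup[OF sub, of N]] by simp
    ultimately show ?thesis
      unfolding solvable_subgroup_special_linear[OF sub] by blast
  qed
  ultimately show ?thesis using sub unfolding closed_connected_solvable_def by blast
qed

text \<open>Columns are cleared one at a time. Once the first i columns are zero below the diagonal
  on all of \<open>B\<close>, the trailing block is a representation of \<open>B\<close>.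
  Lie-Kolchin gives it a common eigenvector, which the elementary matrices of
  \<open>upper_SL N\<close> force to be a multiple of the first basis vector, and this clears column
  i.\<close>

lemma upper_SL_maximal:
  fixes B :: "'a::alg_closed_field mat set"
  assumes B: "closed_connected_solvable N B" and TB: "upper_SL N \<subseteq> B"
  shows "B = upper_SL N"
proof -
  have sub: "subgroup B (SL N)" using B unfolding closed_connected_solvable_def by blast
  note Bd = subgroup_special_linearD[OF sub]
  have "\<forall>b\<in>B. \<forall>c<i. \<forall>r<N. c < r \<longrightarrow> b $$ (r, c) = 0" if "i \<le> N" for i
    using that
  proof (induction i)
    case (Suc i)
    then have IH: "b $$ (r, c) = 0" if "b \<in> B" "c < i" "r < N" "c < r" for b r c
      using that by auto
    have i: "i < N" using Suc by simp
    define m where "m = N - i"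
    have m: "m > 0" "i + m = N" using i by (auto simp: m_def)
    define \<rho> where "\<rho> b = mat m m (\<lambda>(r, c). b $$ (i + r, i + c))" for b :: "'a mat"
    obtain v where v: "v \<in> carrier_vec m" "v \<noteq> 0\<^sub>v m" and ev: "\<And>h. h \<in> B \<Longrightarrow> \<exists>c. \<rho> h *\<^sub>v v = c \<cdot>\<^sub>v v"
    proof (rule lie_kolchin_solvable[OF B, of m \<rho>])
      fix r c assume "r < m" "c < m"
      then show "regular_fun N (\<lambda>A. \<rho> A $$ (r, c))"
        using m by (auto simp: \<rho>_def)
    next
      fix g h assume g: "g \<in> B" and h: "h \<in> B"
      show "\<rho> (g * h) = \<rho> g * \<rho> h"
      proof (rule eq_matI)
        fix r c assume rc: "r < dim_row (\<rho> g * \<rho> h)" "c < dim_col (\<rho> g * \<rho> h)"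
        then have rc: "r < m" "c < m" by (auto simp: \<rho>_def)
        have "\<rho> (g * h) $$ (r, c) = (\<Sum>p = 0..<i + m. g $$ (i + r, p) * h $$ (p, i + c))"
          using rc Bd(1)[OF g] Bd(1)[OF h] m by (simp add: \<rho>_def scalar_prod_def)
        \<comment> \<open>The columns of \<open>g\<close> before i are zero in these rows; this is
          what makes the trailing block multiplicative.\<close>
        also have "\<dots> = (\<Sum>p = i..<i + m. g $$ (i + r, p) * h $$ (p, i + c))"
          using IH[OF g] rc m by (intro sum.mono_neutral_right) auto
        also have "\<dots> = (\<Sum>p = 0..<m. g $$ (i + r, i + p) * h $$ (i + p, i + c))"
          using sum.shift_bounds_nat_ivl[of "\<lambda>p. g $$ (i + r, p) * h $$ (p, i + c)" 0 i m]
          by (simp add: add.commute)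
        also have "\<dots> = (\<rho> g * \<rho> h) $$ (r, c)"
          using rc by (simp add: \<rho>_def scalar_prod_def)
        finally show "\<rho> (g * h) $$ (r, c) = (\<rho> g * \<rho> h) $$ (r, c)" .
      qed (auto simp: \<rho>_def)
    next
      show "\<rho> (1\<^sub>m N) = 1\<^sub>m m" using m by (auto simp: \<rho>_def intro!: eq_matI)
    qed (use m in \<open>auto simp: \<rho>_def\<close>)
    have v0: "v $ j = 0" if j: "0 < j" "j < m" for j
    proof (rule ccontr)
      assume nz: "v $ j \<noteq> 0"
      \<comment> \<open>If v_j were nonzero, coordinate j would give this elementary matrix the
        eigenvalue 1 on \<open>v\<close>, yet it changes coordinate 0 by v_j.\<close>
      define e where "e = addrow_mat N (1 :: 'a) i (i + j)"
      have "e \<in> upper_SL N"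
        using j m det_addrow_mat[of i "i + j" N 1] by (auto simp: e_def upper_SL_def upper_triangular_def)
      then obtain c where c: "\<rho> e *\<^sub>v v = c \<cdot>\<^sub>v v" using ev TB by blast
      have ent: "(\<rho> e *\<^sub>v v) $ r = v $ r + (if r = 0 then v $ j else 0)" if r: "r < m" for r
      proof -
        have "\<rho> e $$ (r, p) = (if r = p then 1 else 0) + (if r = 0 \<and> p = j then 1 else 0)" if "p < m" for p
          using r that m j by (auto simp: \<rho>_def e_def)
        then have "(\<rho> e *\<^sub>v v) $ r =
            (\<Sum>p = 0..<m. ((if r = p then 1 else 0) + (if r = 0 \<and> p = j then 1 else 0)) * v $ p)"
          using r v(1) by (simp add: scalar_prod_def \<rho>_def)
        also have "\<dots> = v $ r + (if r = 0 then v $ j else 0)"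
          using r j by (cases "r = 0") (simp_all add: sum.distrib distrib_right if_distrib[of "\<lambda>x. x * _"] cong: if_cong)
        finally show ?thesis .
      qed
      have "v $ j = c * v $ j" using ent[OF j(2)] j v(1) by (simp add: c)
      then have "c = 1" using nz by simp
      then show False using ent[OF m(1)] nz v(1) m(1) by (simp add: c)
    qed
    have v00: "v $ 0 \<noteq> 0"
    proof
      assume "v $ 0 = 0"
      then have "v $ j = 0" if "j < m" for j using v0[of j] that by (cases "j = 0") auto
      then show False using v by auto
    qed
    have new: "b $$ (i + r, i) = 0" if b: "b \<in> B" and r: "0 < r" "r < m" for b r
    proof -
      obtain c where c: "\<rho> b *\<^sub>v v = c \<cdot>\<^sub>v v" using ev[OF b] by blast
      have "(\<rho> b *\<^sub>v v) $ r = (\<Sum>p = 0..<m. b $$ (i + r, i + p) * v $ p)"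
        using r v(1) by (simp add: \<rho>_def scalar_prod_def)
      also have "\<dots> = (\<Sum>p\<in>{0}. b $$ (i + r, i + p) * v $ p)"
        using m v0 by (intro sum.mono_neutral_right) auto
      finally show ?thesis using c r v(1) v0[OF r] v00 by simp
    qed
    show ?case
    proof (intro ballI allI impI)
      fix b c r assume *: "b \<in> B" "c < Suc i" "r < N" "c < r"
      show "b $$ (r, c) = 0"
        using IH[of b c r] new[of b "r - i"] * m by (cases "c = i") auto
    qed
  qed auto
  from this[of N] have "B \<subseteq> upper_SL N"
    using Bd(1,2) by (force simp: upper_SL_def upper_triangular_def)
  with TB show ?thesis by blast
qed

lemma borel_subgroup_upper_SL:
  "N > 0 \<Longrightarrow> borel_subgroup N (upper_SL N :: 'a::alg_closed_field mat set)"
  unfolding borel_subgroup_def using closed_connected_solvable_upper_SL upper_SL_maximal by metis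

section \<open>Spherical classes satisfy a quadratic equation\<close>

lemma conj_act_special_linear:
  "g \<in> carrier_mat N N \<Longrightarrow> det g = 1 \<Longrightarrow> conj_act (SL N) g x = g * x * adj_mat g"
  by (simp add: conj_act_def inv_special_linear)

lemma similar_mat_carrier:
  assumes "similar_mat A B" "B \<in> carrier_mat N N"
  shows "A \<in> carrier_mat N N"
proof -
  obtain n P Q where "{A, B, P, Q} \<subseteq> carrier_mat n n"
    using similar_matD[OF assms(1)] by blast
  with assms(2) show ?thesis by auto
qed

text \<open>An N-th root \<mu> of 1 / det P scales \<open>P\<close> to determinant 1, and the scalar
  cancels in conjugation.\<close>

lemma rescale_to_special_linear:
  fixes P Q :: "'a::alg_closed_field mat"
  assumes P: "P \<in> carrier_mat N N" and Q: "Q \<in> carrier_mat N N" and PQ: "P * Q = 1\<^sub>m N" and N: "N > 0"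
  obtains \<mu> where "\<mu> \<noteq> 0" "det (\<mu> \<cdot>\<^sub>m P) = 1"
    "\<And>x. x \<in> carrier_mat N N \<Longrightarrow> (\<mu> \<cdot>\<^sub>m P) * x * adj_mat (\<mu> \<cdot>\<^sub>m P) = P * x * Q"
proof -
  have one_smult: "1 \<cdot>\<^sub>m M = M" for M :: "'a mat" by (intro eq_matI) auto
  have d: "det P \<noteq> 0" using det_mult[OF P Q] PQ by auto
  obtain \<mu> where \<mu>: "\<mu> ^ N = 1 / det P" using nth_root_exists[OF N] by blast
  have \<mu>0: "\<mu> \<noteq> 0" using \<mu> d N by (auto simp: zero_power)
  have det: "det (\<mu> \<cdot>\<^sub>m P) = 1" using \<mu> d P by (simp add: det_smult)
  let ?g = "\<mu> \<cdot>\<^sub>m P"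
  have g: "?g \<in> carrier_mat N N" using P by simp
  note adj = adj_mat_special_linear[OF g det]
  have "adj_mat ?g = adj_mat ?g * (?g * ((1 / \<mu>) \<cdot>\<^sub>m Q))"
  proof -
    have "?g * ((1 / \<mu>) \<cdot>\<^sub>m Q) = (\<mu> * (1 / \<mu>)) \<cdot>\<^sub>m (P * Q)"
      using mult_smult_assoc_mat[OF P smult_carrier_mat[OF Q]] mult_smult_distrib[OF P Q]
      by (auto intro!: eq_matI)
    then show ?thesis using \<mu>0 PQ adj(1) by (simp add: one_smult)
  qed
  also have "\<dots> = (adj_mat ?g * ?g) * ((1 / \<mu>) \<cdot>\<^sub>m Q)"
    by (rule assoc_mult_mat[symmetric, OF adj(1) g smult_carrier_mat[OF Q]])
  also have "\<dots> = (1 / \<mu>) \<cdot>\<^sub>m Q" using adj(3) Q by simp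
  finally have inv: "adj_mat ?g = (1 / \<mu>) \<cdot>\<^sub>m Q" .
  have "?g * x * adj_mat ?g = P * x * Q" if x: "x \<in> carrier_mat N N" for x
  proof -
    have Px: "P * x \<in> carrier_mat N N" using P x by simp
    have "?g * x * adj_mat ?g = (\<mu> * (1 / \<mu>)) \<cdot>\<^sub>m (P * x * Q)"
      unfolding inv mult_smult_assoc_mat[OF P x] mult_smult_assoc_mat[OF Px smult_carrier_mat[OF Q]]
        mult_smult_distrib[OF Px Q] by (auto intro!: eq_matI)
    then show ?thesis using \<mu>0 by (simp add: one_smult)
  qed
  then show ?thesis using that \<mu>0 det by blast
qed

text \<open>Conjugation by any invertible matrix can be rescaled into \<open>SL N\<close>, so a
  similarity class does not split. Classes are handled through \<open>similar_mat\<close> from here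
  on.\<close>

lemma conj_class_special_linear:
  fixes x :: "'a::alg_closed_field mat"
  assumes x: "x \<in> carrier_mat N N" and N: "N > 0"
  shows "conj_class (SL N) x = {A. similar_mat A x}"
proof (intro equalityI subsetI CollectI)
  fix A assume "A \<in> conj_class (SL N) x"
  then obtain g where g: "g \<in> carrier_mat N N" "det g = 1" and A: "A = g * x * adj_mat g"
    by (auto simp: conj_class_def orbit_def conj_act_special_linear)
  note adj = adj_mat_special_linear[OF g]
  show "similar_mat A x"
    by (rule similar_matI[of A x g "adj_mat g" N]) (use g x adj A in auto)
next
  fix A assume "A \<in> {A. similar_mat A x}"
  then obtain P Q where "similar_mat_wit A x P Q" unfolding similar_mat_def by blast
  moreover have "dim_row A = N"
    using similar_mat_carrier[OF _ x, of A] \<open>A \<in> _\<close> by auto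
  ultimately have PQ: "P * Q = 1\<^sub>m N" "A = P * x * Q" "P \<in> carrier_mat N N" "Q \<in> carrier_mat N N"
    by (auto simp: similar_mat_wit_def Let_def)
  obtain \<mu> where "det (\<mu> \<cdot>\<^sub>m P) = 1" "(\<mu> \<cdot>\<^sub>m P) * x * adj_mat (\<mu> \<cdot>\<^sub>m P) = A"
    using rescale_to_special_linear[OF PQ(3,4,1) N] x PQ(2) by metis
  then show "A \<in> conj_class (SL N) x"
    using PQ(3) unfolding conj_class_def orbit_def
    by (intro CollectI exI[of _ "\<mu> \<cdot>\<^sub>m P"]) (auto simp: conj_act_special_linear)
qed

section \<open>Conjugates with a nonzero matrix coefficient\<close>

lemma similar_mat_permute:
  fixes X :: "'a::field mat"
  assumes X: "X \<in> carrier_mat N N" and \<pi>: "\<pi> permutes {..<N}"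
  shows "similar_mat (mat N N (\<lambda>(a, b). X $$ (\<pi> a, \<pi> b))) X"
proof -
  let ?P = "mat N N (\<lambda>(a, b). if b = \<pi> a then 1 else 0) :: 'a mat"
  let ?Q = "mat N N (\<lambda>(a, b). if a = \<pi> b then 1 else 0) :: 'a mat"
  have lt: "\<pi> a < N" if "a < N" for a using permutes_in_image[OF \<pi>] that by auto
  have inj: "\<pi> a = \<pi> b \<longleftrightarrow> a = b" for a b using permutes_inj[OF \<pi>] by (auto dest: injD)
  have PQ: "?P * ?Q = 1\<^sub>m N"
  proof (rule eq_matI)
    fix a b assume ab: "a < dim_row (1\<^sub>m N :: 'a mat)" "b < dim_col (1\<^sub>m N :: 'a mat)"
    then have "(?P * ?Q) $$ (a, b) = (\<Sum>c = 0..<N. if c = \<pi> a then (if c = \<pi> b then 1 else 0) else 0)"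
      by (simp add: scalar_prod_def if_distrib[of "\<lambda>x. x * _"] cong: if_cong)
    then show "(?P * ?Q) $$ (a, b) = 1\<^sub>m N $$ (a, b)" using ab lt inj by simp
  qed auto
  have "?P * X * ?Q = mat N N (\<lambda>(a, b). X $$ (\<pi> a, \<pi> b))"
  proof (rule eq_matI)
    fix a b assume "a < dim_row (mat N N (\<lambda>(a, b). X $$ (\<pi> a, \<pi> b)))"
      "b < dim_col (mat N N (\<lambda>(a, b). X $$ (\<pi> a, \<pi> b)))"
    then have ab: "a < N" "b < N" by auto
    have PX: "(?P * X) $$ (a, c) = X $$ (\<pi> a, c)" if "c < N" for c
      using ab that lt X by (simp add: scalar_prod_def if_distrib[of "\<lambda>x. x * _"] cong: if_cong)
    have "(?P * X * ?Q) $$ (a, b) = (\<Sum>c = 0..<N. (?P * X) $$ (a, c) * ?Q $$ (c, b))"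
      using ab X by (simp add: scalar_prod_def)
    also have "\<dots> = (\<Sum>c = 0..<N. if c = \<pi> b then X $$ (\<pi> a, c) else 0)"
      using ab by (intro sum.cong refl) (subst PX, auto)
    also have "\<dots> = X $$ (\<pi> a, \<pi> b)" using lt[OF ab(2)] by simp
    finally show "(?P * X * ?Q) $$ (a, b) = mat N N (\<lambda>(a, b). X $$ (\<pi> a, \<pi> b)) $$ (a, b)"
      using ab by simp
  qed (use X in auto)
  then show ?thesis
    using X mat_mult_left_right_inverse[OF _ _ PQ] PQ
    by (intro similar_matI[of _ X ?P ?Q N]) auto
qed

text \<open>A nonscalar matrix either has a nonzero off-diagonal entry or is diagonal with two
  distinct entries; in the second case an elementary conjugation puts their difference off the
  diagonal. A permutation then moves that entry to (i, j).\<close>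

lemma similar_nonzero_entry:
  fixes X :: "'a::field mat"
  assumes X: "X \<in> carrier_mat N N" and ns: "\<And>c. X \<noteq> c \<cdot>\<^sub>m 1\<^sub>m N" and ij: "i < N" "j < N" "i \<noteq> j"
  obtains Z where "similar_mat Z X" "Z $$ (i, j) \<noteq> 0"
proof -
  have "\<exists>Z k l. similar_mat Z X \<and> k < N \<and> l < N \<and> k \<noteq> l \<and> Z $$ (k, l) \<noteq> 0"
  proof (cases "\<exists>k l. k < N \<and> l < N \<and> k \<noteq> l \<and> X $$ (k, l) \<noteq> 0")
    case True
    then show ?thesis using similar_mat_refl[OF X] by blast
  next
    case False
    have "\<exists>k<N. \<exists>l<N. X $$ (k, k) \<noteq> X $$ (l, l)"
    proof (rule ccontr)
      assume "\<not> ?thesis"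
      then have diag: "X $$ (k, k) = X $$ (i, i)" if "k < N" for k using that ij(1) by blast
      have off: "X $$ (k, l) = 0" if "k < N" "l < N" "k \<noteq> l" for k l using False that by blast
      have "X = X $$ (i, i) \<cdot>\<^sub>m 1\<^sub>m N"
        using X by (intro eq_matI) (simp_all add: diag off)
      then show False using ns by blast
    qed
    then obtain k l where kl: "k < N" "l < N" "X $$ (k, k) \<noteq> X $$ (l, l)" by blast
    then have ne: "k \<noteq> l" by auto
    have "X $$ (k, l) = 0" "X $$ (l, k) = 0" using False kl(1,2) ne by auto
    then have "add_col_sub_row 1 k l X $$ (k, l) = X $$ (k, k) - X $$ (l, l)"
      using kl X ne by simp
    then show ?thesis
      using add_col_sub_row_similar[OF X kl(1,2) ne] kl ne by (metis right_minus_eq)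
  qed
  then obtain Z k l where Z: "similar_mat Z X" and kl: "k < N" "l < N" "k \<noteq> l" "Z $$ (k, l) \<noteq> 0" by blast
  have Zc: "Z \<in> carrier_mat N N" using similar_mat_carrier[OF Z X] .
  let ?\<tau> = "Transposition.transpose i k"
  \<comment> \<open>The inner transposition fixes i and sends j to the \<tau>-preimage of l; then
    \<tau> sends i to k and that preimage to l.\<close>
  let ?\<pi> = "Transposition.transpose i k \<circ> Transposition.transpose j (?\<tau> l)"
  have lt: "?\<tau> l < N" using ij kl by (auto simp: Transposition.transpose_def)
  have p: "?\<pi> permutes {..<N}"
    using ij kl lt by (intro permutes_compose permutes_swap_id) auto
  have "?\<tau> l \<noteq> i" using kl by (auto simp: Transposition.transpose_def)
  then have "?\<pi> i = k" "?\<pi> j = l"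
    using ij kl by (auto simp: Transposition.transpose_def)
  then have "mat N N (\<lambda>(a, b). Z $$ (?\<pi> a, ?\<pi> b)) $$ (i, j) \<noteq> 0"
    using ij kl(4) by simp
  then show ?thesis
    using that similar_mat_trans[OF similar_mat_permute[OF Zc p] Z] by blast
qed

text \<open>Conjugation by \<open>1 \<plusminus> E\<^sub>a\<^sub>b\<close> has second difference \<open>- 2 Z\<^sub>b\<^sub>a E\<^sub>a\<^sub>b\<close>. If the form vanished on the whole
  class, this would give \<open>w\<^sub>a v\<^sub>b = 0\<close> for all \<open>a \<noteq> b\<close>.\<close>

lemma similar_bilinear_nonzero:
  fixes X :: "'a::field mat" and v w :: "nat \<Rightarrow> 'a"
  assumes two: "(2 :: 'a) \<noteq> 0" and X: "X \<in> carrier_mat N N" and ns: "\<And>c. X \<noteq> c \<cdot>\<^sub>m 1\<^sub>m N"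
    and v: "p < N" "v p \<noteq> 0" and w: "q < N" "w q \<noteq> 0"
  shows "\<exists>Z. similar_mat Z X \<and> (\<Sum>i<N. \<Sum>j<N. w i * Z $$ (i, j) * v j) \<noteq> 0"
proof (rule ccontr)
  define \<beta> where "\<beta> Z = (\<Sum>i<N. \<Sum>j<N. w i * Z $$ (i, j) * v j)" for Z
  assume "\<not> ?thesis"
  then have zero: "\<beta> Z = 0" if "similar_mat Z X" for Z
    using that unfolding \<beta>_def by blast
  have single: "(\<Sum>i<N. \<Sum>j<N. if i = a \<and> j = b then c else 0) = c" if "a < N" "b < N" for a b and c :: 'a
  proof -
    have "(\<Sum>i<N. \<Sum>j<N. if i = a \<and> j = b then c else 0) = (\<Sum>i<N. if i = a then c else 0)"
      using that by (intro sum.cong refl) auto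
    then show ?thesis using that by simp
  qed
  have off: "w a * v b = 0" if ab: "a < N" "b < N" "a \<noteq> b" for a b
  proof -
    obtain Z where Z: "similar_mat Z X" "Z $$ (b, a) \<noteq> 0"
      using similar_nonzero_entry[OF X ns ab(2,1) ab(3)[symmetric]] by blast
    have Zc: "Z \<in> carrier_mat N N" using similar_mat_carrier[OF Z(1) X] .
    define Y where "Y t = add_col_sub_row t a b Z" for t
    have Y: "\<beta> (Y t) = 0" for t
      unfolding Y_def by (intro zero similar_mat_trans[OF add_col_sub_row_similar[OF Zc ab] Z(1)])
    have "\<beta> (Y 1) + \<beta> (Y (-1)) - 2 * \<beta> Z =
        (\<Sum>i<N. \<Sum>j<N. w i * (Y 1 $$ (i, j) + Y (-1) $$ (i, j) - 2 * Z $$ (i, j)) * v j)"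
      unfolding \<beta>_def sum_distrib_left sum.distrib[symmetric] sum_subtractf[symmetric]
      by (intro sum.cong refl) (simp add: algebra_simps)
    also have "\<dots> = (\<Sum>i<N. \<Sum>j<N. if i = a \<and> j = b then - 2 * Z $$ (b, a) * (w a * v b) else 0)"
      using Zc ab by (intro sum.cong refl) (auto simp: Y_def algebra_simps)
    also have "\<dots> = - 2 * Z $$ (b, a) * (w a * v b)" by (rule single[OF ab(1,2)])
    finally have "- 2 * Z $$ (b, a) * (w a * v b) = 0" using Y zero[OF Z(1)] by simp
    then show ?thesis using two Z(2) by simp
  qed
  \<comment> \<open>All products w_a v_b with a \<noteq> b vanish, so \<open>v\<close> and
    \<open>w\<close> are supported on one common index, and the form is a multiple of the (q, q)
    entry.\<close>
  then have pq: "p = q" using v w by (metis mult_eq_0_iff)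
  have v0: "v b = 0" if "b < N" "b \<noteq> q" for b using off[of q b] w that by auto
  have w0: "w b = 0" if "b < N" "b \<noteq> q" for b using off[of b q] v pq that by auto
  have \<beta>: "\<beta> Z = w q * Z $$ (q, q) * v q" for Z
  proof -
    have "\<beta> Z = (\<Sum>i<N. \<Sum>j<N. if i = q \<and> j = q then w q * Z $$ (q, q) * v q else 0)"
      unfolding \<beta>_def using v0 w0 by (intro sum.cong refl) auto
    also have "\<dots> = w q * Z $$ (q, q) * v q" by (rule single) (use w in auto)
    finally show ?thesis .
  qed
  have diag: "Z $$ (q, q) = 0" if "similar_mat Z X" for Z
    using zero[OF that] \<beta>[of Z] v w pq by simp
  have "\<exists>b<N. b \<noteq> q"
  proof (rule ccontr)
    assume "\<not> ?thesis"
    then have all: "i = q" if "i < N" for i using that by blast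
    have "X = X $$ (q, q) \<cdot>\<^sub>m 1\<^sub>m N"
    proof (rule eq_matI)
      fix i j assume "i < dim_row (X $$ (q, q) \<cdot>\<^sub>m 1\<^sub>m N)" "j < dim_col (X $$ (q, q) \<cdot>\<^sub>m 1\<^sub>m N)"
      then show "X $$ (i, j) = (X $$ (q, q) \<cdot>\<^sub>m 1\<^sub>m N) $$ (i, j)"
        using all[of i] all[of j] by simp
    qed (use X in auto)
    then show False using ns by blast
  qed
  then obtain b where b: "b < N" "b \<noteq> q" by blast
  obtain Z where Z: "similar_mat Z X" "Z $$ (b, q) \<noteq> 0"
    using similar_nonzero_entry[OF X ns b(1) w(1) b(2)] by blast
  have Zc: "Z \<in> carrier_mat N N" using similar_mat_carrier[OF Z(1) X] .
  \<comment> \<open>This conjugation changes the (q, q) entry by the nonzero - Z_bq, so that entry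
    cannot be zero on the whole class.\<close>
  have "add_col_sub_row 1 q b Z $$ (q, q) = 0"
    using similar_mat_trans[OF add_col_sub_row_similar[OF Zc w(1) b(1)] Z(1)] b by (intro diag) auto
  moreover have "add_col_sub_row 1 q b Z $$ (q, q) = Z $$ (q, q) - Z $$ (b, q)"
    using Zc w b by simp
  ultimately show False using diag[OF Z(1)] Z(2) by simp
qed

text \<open>\<open>a\<close> and \<open>b\<close> may coincide and need not both be eigenvalues:
  scalar matrices qualify, and so do scalar matrices plus a square-zero one.\<close>

definition quadratic_mat :: "nat \<Rightarrow> 'a::field \<Rightarrow> 'a \<Rightarrow> 'a mat \<Rightarrow> bool" where
  "quadratic_mat N a b A \<longleftrightarrow> A \<in> carrier_mat N N \<and> (A - a \<cdot>\<^sub>m 1\<^sub>m N) * (A - b \<cdot>\<^sub>m 1\<^sub>m N) = 0\<^sub>m N N"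

lemma quadratic_mat_expand:
  fixes A :: "'a::field mat"
  assumes "A \<in> carrier_mat N N"
  shows "(A - a \<cdot>\<^sub>m 1\<^sub>m N) * (A - b \<cdot>\<^sub>m 1\<^sub>m N) = A * A - (a + b) \<cdot>\<^sub>m A + (a * b) \<cdot>\<^sub>m 1\<^sub>m N"
proof -
  let ?I = "1\<^sub>m N :: 'a mat"
  have "(A - a \<cdot>\<^sub>m ?I) * (A - b \<cdot>\<^sub>m ?I) = A * (A - b \<cdot>\<^sub>m ?I) - (a \<cdot>\<^sub>m ?I) * (A - b \<cdot>\<^sub>m ?I)"
    using assms by (intro minus_mult_distrib_mat) auto
  also have "A * (A - b \<cdot>\<^sub>m ?I) = A * A - A * (b \<cdot>\<^sub>m ?I)"
    using assms by (intro mult_minus_distrib_mat) auto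
  also have "A * (b \<cdot>\<^sub>m ?I) = b \<cdot>\<^sub>m A"
    using assms mult_smult_distrib[OF assms, of ?I N b] by simp
  also have "(a \<cdot>\<^sub>m ?I) * (A - b \<cdot>\<^sub>m ?I) = a \<cdot>\<^sub>m (A - b \<cdot>\<^sub>m ?I)"
    using assms mult_smult_assoc_mat[of ?I N N "A - b \<cdot>\<^sub>m ?I" N a] by (simp add: minus_carrier_mat)
  finally show ?thesis
    using assms by (auto intro!: eq_matI simp: algebra_simps simp del: index_mult_mat(1))
qed

text \<open>If \<gamma> is nonzero, \<open>a\<close> and \<open>b\<close> are the two roots of X^2 +
  (\<alpha>/\<gamma>) X - c/\<gamma>; if \<gamma> = 0, the matrix is scalar and a = b =
  c/\<alpha>.\<close>

lemma quadratic_matI: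
  fixes A :: "'a::alg_closed_field mat"
  assumes A: "A \<in> carrier_mat N N" and rel: "\<alpha> \<cdot>\<^sub>m A + \<gamma> \<cdot>\<^sub>m (A * A) = c \<cdot>\<^sub>m 1\<^sub>m N" and nz: "\<alpha> \<noteq> 0 \<or> \<gamma> \<noteq> 0"
  shows "\<exists>a b. quadratic_mat N a b A"
proof (cases "\<gamma> = 0")
  case True
  have "A $$ (i, j) = (c / \<alpha>) * 1\<^sub>m N $$ (i, j)" if "i < N" "j < N" for i j
  proof -
    have "(\<alpha> \<cdot>\<^sub>m A + \<gamma> \<cdot>\<^sub>m (A * A)) $$ (i, j) = (c \<cdot>\<^sub>m 1\<^sub>m N) $$ (i, j)" using rel by simp
    then show ?thesis using A that True nz by (auto simp: field_simps)
  qed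
  then have "A - (c / \<alpha>) \<cdot>\<^sub>m 1\<^sub>m N = 0\<^sub>m N N" using A by (intro eq_matI) auto
  then show ?thesis using A unfolding quadratic_mat_def by (intro exI[of _ "c / \<alpha>"]) simp
next
  case False
  define p where "p = [:- c / \<gamma>, \<alpha> / \<gamma>, 1:]"
  have "degree p > 0" by (simp add: p_def)
  then obtain a where a: "poly p a = 0" using alg_closed_imp_poly_has_root by blast
  define b where "b = - \<alpha> / \<gamma> - a"
  have sum: "a + b = - (\<alpha> / \<gamma>)" by (simp add: b_def)
  have prod: "a * b = - (c / \<gamma>)" using a False by (simp add: b_def p_def field_simps) algebra
  have "(A * A) $$ (i, j) = (c / \<gamma>) * 1\<^sub>m N $$ (i, j) - (\<alpha> / \<gamma>) * A $$ (i, j)" if "i < N" "j < N" for i j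
  proof -
    have "(\<alpha> \<cdot>\<^sub>m A + \<gamma> \<cdot>\<^sub>m (A * A)) $$ (i, j) = (c \<cdot>\<^sub>m 1\<^sub>m N) $$ (i, j)" using rel by simp
    then have "\<alpha> * A $$ (i, j) + \<gamma> * (A * A) $$ (i, j) = c * 1\<^sub>m N $$ (i, j)"
      using A that by (simp del: index_mult_mat(1) index_one_mat(1))
    then show ?thesis using False by (simp add: field_simps del: index_mult_mat(1) index_one_mat(1))
  qed
  then have "A * A - (a + b) \<cdot>\<^sub>m A + (a * b) \<cdot>\<^sub>m 1\<^sub>m N = 0\<^sub>m N N"
    unfolding sum prod using A
    by (intro eq_matI) (simp_all del: index_mult_mat(1) index_one_mat(1))
  then show ?thesis
    using A quadratic_mat_expand[OF A, of a b] unfolding quadratic_mat_def by auto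
qed

text \<open>The identity principle for a dense orbit: an equation that holds on the orbit of
  \<open>B\<close> holds on the class.\<close>

lemma spherical_class_closure:
  assumes "spherical_class N C" and C: "C \<subseteq> carrier_mat N N"
  obtains B y where "borel_subgroup N B" "y \<in> C"
    "\<And>f A. regular_fun N f \<Longrightarrow> (\<And>b. b \<in> B \<Longrightarrow> f (b * y * adj_mat b) = 0) \<Longrightarrow> A \<in> C \<Longrightarrow> f A = 0"
proof -
  obtain B y where B: "borel_subgroup N B" and y: "y \<in> C" and cl: "(subtopology (zariski N) C) closure_of
      (orbit ((SL N)\<lparr>carrier := B\<rparr>) (conj_act (SL N)) y) = C" (is "_ closure_of ?O = _")
    using assms unfolding spherical_class_def by blast
  have sub: "subgroup B (SL N)"
    using B unfolding borel_subgroup_def closed_connected_solvable_def by blast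
  note Bd = subgroup_special_linearD[OF sub]
  have O: "?O = {b * y * adj_mat b | b. b \<in> B}"
  proof -
    have "conj_act (SL N) b y = b * y * adj_mat b" if "b \<in> B" for b
      by (rule conj_act_special_linear[OF Bd(1,2)[OF that]])
    then have "(\<exists>b. z = conj_act (SL N) b y \<and> b \<in> B) \<longleftrightarrow> (\<exists>b. z = b * y * adj_mat b \<and> b \<in> B)" for z
      by (metis (no_types, lifting))
    then show ?thesis unfolding orbit_def by simp
  qed
  show ?thesis
  proof (rule that[OF B y])
    fix f A assume f: "regular_fun N f" and 0: "\<And>b. b \<in> B \<Longrightarrow> f (b * y * adj_mat b) = 0" and A: "A \<in> C"
    have "?O \<subseteq> carrier_mat N N"
    proof
      fix z assume "z \<in> ?O"
      then obtain b where b: "b \<in> B" and z: "z = b * y * adj_mat b" unfolding O by blast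
      show "z \<in> carrier_mat N N"
        unfolding z by (rule mult_carrier_mat[OF mult_carrier_mat[OF Bd(1)[OF b]] Bd(1)[OF Bd(5)[OF b]]])
          (use y C in blast)
    qed
    note Oc = this
    have "A \<in> (subtopology (zariski N) C) closure_of ?O" using A cl by simp
    then have "A \<in> zariski N closure_of ?O"
      using closure_of_subtopology_subset[of "zariski N" C ?O] by (rule rev_subsetD)
    moreover have "\<forall>z\<in>?O. f z = 0" unfolding O using 0 by auto
    ultimately show "f A = 0"
      using f unfolding zariski_closure_of[OF Oc] by blast
  qed
qed


lemma spherical_class_quadratic:
  fixes x :: "'a::alg_closed_field mat"
  assumes two: "(2 :: 'a) \<noteq> 0" and N: "N > 0" and x: "x \<in> carrier_mat N N"
    and sph: "spherical_class N (conj_class (SL N) x)"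
  shows "\<exists>a b. quadratic_mat N a b x"
proof -
  let ?C = "conj_class (SL N) x"
  have C: "?C = {A. similar_mat A x}" by (rule conj_class_special_linear[OF x N])
  have Cc: "?C \<subseteq> carrier_mat N N" unfolding C using similar_mat_carrier[OF _ x] by blast
  obtain B y where B: "borel_subgroup N B" and y: "y \<in> ?C"
    and cl: "\<And>f A. regular_fun N f \<Longrightarrow> (\<And>b. b \<in> B \<Longrightarrow> f (b * y * adj_mat b) = 0) \<Longrightarrow> A \<in> ?C \<Longrightarrow> f A = 0"
    using spherical_class_closure[OF sph Cc] by blast
  have ccs: "closed_connected_solvable N B" using B unfolding borel_subgroup_def by blast
  have sub: "subgroup B (SL N)" using ccs unfolding closed_connected_solvable_def by blast
  note Bd = subgroup_special_linearD[OF sub]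
  have yc: "y \<in> carrier_mat N N" using y Cc by blast
  obtain v where v: "v \<in> carrier_vec N" "v \<noteq> 0\<^sub>v N" and ev: "\<And>h. h \<in> B \<Longrightarrow> \<exists>c. h *\<^sub>v v = c \<cdot>\<^sub>v v"
    by (rule lie_kolchin_solvable[OF ccs, of N "\<lambda>A. A"]) (use N Bd in auto)
  note adj = adj_mat_subgroup[OF sub]
  \<comment> \<open>A common eigenfunctional is a common eigenvector of the dual representation,
    which sends h to the transpose of h^-1 and is again polynomial.\<close>
  obtain w where w: "w \<in> carrier_vec N" "w \<noteq> 0\<^sub>v N"
    and ew: "\<And>h. h \<in> B \<Longrightarrow> \<exists>c. transpose_mat (adj_mat h) *\<^sub>v w = c \<cdot>\<^sub>v w"
  proof (rule lie_kolchin_solvable[OF ccs, of N "\<lambda>A. transpose_mat (adj_mat A)"])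
    fix i j assume "i < N" "j < N"
    then show "regular_fun N (\<lambda>A. transpose_mat (adj_mat A) $$ (i, j))"
      using regular_map_entry[OF regular_map_transpose[OF regular_map_adj[OF regular_map_id]]] by blast
  next
    fix g h assume g: "g \<in> B" and h: "h \<in> B"
    show "transpose_mat (adj_mat (g * h)) = transpose_mat (adj_mat g) * transpose_mat (adj_mat h)"
      unfolding adj(3)[OF g h] by (rule transpose_mult[OF Bd(1)[OF Bd(5)[OF h]] Bd(1)[OF Bd(5)[OF g]]])
  next
    show "transpose_mat (adj_mat (1\<^sub>m N)) = (1\<^sub>m N :: 'a mat)" by (simp add: adj(1))
  qed (use N Bd in auto)
  have ew: "\<exists>c. transpose_mat h *\<^sub>v w = c \<cdot>\<^sub>v w" if h: "h \<in> B" for h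
    using ew[OF Bd(5)[OF h]] by (simp add: adj(2)[OF h])
  define \<beta> where "\<beta> Z = (\<Sum>i<N. \<Sum>j<N. w $ i * Z $$ (i, j) * v $ j)" for Z
  have \<beta>: "\<beta> Z = w \<bullet> (Z *\<^sub>v v)" if "Z \<in> carrier_mat N N" for Z
    using that v(1) w(1) by (simp add: \<beta>_def scalar_prod_def sum_distrib_left mult.assoc atLeast0LessThan)
  have reg\<beta>: "regular_fun N \<beta>"
    unfolding \<beta>_def by (intro regular_fun_sum regular_fun_mult regular_fun_const regular_fun_entry) auto
  \<comment> \<open>The factor is the eigenvalue of b^-1 on \<open>v\<close> times that of the
    transpose of \<open>b\<close> on \<open>w\<close>. It does not involve Z, hence is common to y
    and y^2.\<close>
  have semi: "\<exists>c. \<forall>Z\<in>carrier_mat N N. \<beta> (b * Z * adj_mat b) = c * \<beta> Z" if b: "b \<in> B" for b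
  proof -
    note bc = Bd(1)[OF b] Bd(1)[OF Bd(5)[OF b]]
    obtain c where c: "adj_mat b *\<^sub>v v = c \<cdot>\<^sub>v v" using ev[OF Bd(5)[OF b]] by blast
    obtain d where d: "transpose_mat b *\<^sub>v w = d \<cdot>\<^sub>v w" using ew[OF b] by blast
    have "\<beta> (b * Z * adj_mat b) = (d * c) * \<beta> Z" if Z: "Z \<in> carrier_mat N N" for Z
    proof -
      have "\<beta> (b * Z * adj_mat b) = w \<bullet> (b *\<^sub>v (Z *\<^sub>v (adj_mat b *\<^sub>v v)))"
        using bc Z v(1) by (subst \<beta>) (auto simp: assoc_mult_mat_vec[of _ N N _ N])
      also have "\<dots> = (transpose_mat b *\<^sub>v w) \<bullet> (Z *\<^sub>v (adj_mat b *\<^sub>v v))"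
        using bc Z v(1) w(1) by (intro transpose_vec_mult_scalar[symmetric, of _ N N]) auto
      also have "\<dots> = (d * c) * (w \<bullet> (Z *\<^sub>v v))"
        unfolding c d using Z v(1) w(1) by (simp add: mult_mat_vec[OF Z v(1)] mult_ac)
      finally show ?thesis using \<beta>[OF Z] by simp
    qed
    then show ?thesis by blast
  qed
  have sq: "(P * Z * Q) * (P * Z * Q) = P * (Z * Z) * Q"
    if "P \<in> carrier_mat N N" "Q \<in> carrier_mat N N" "Z \<in> carrier_mat N N" "Q * P = 1\<^sub>m N" for P Z Q :: "'a mat"
  proof -
    have "(P * Z * Q) * (P * Z * Q) = P * (Z * ((Q * P) * (Z * Q)))"
      using that(1-3) by (simp add: mat_assoc[where N = N])
    also have "\<dots> = P * (Z * Z) * Q"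
      unfolding that(4) using that(1-3) by (simp add: mat_assoc[where N = N])
    finally show ?thesis .
  qed
  have "\<exists>\<alpha> \<gamma>. (\<alpha> \<noteq> 0 \<or> \<gamma> \<noteq> 0) \<and> (\<forall>A\<in>?C. \<alpha> * \<beta> A + \<gamma> * \<beta> (A * A) = 0)"
  proof (cases "\<beta> y = 0")
    case True
    have "\<beta> A = 0" if "A \<in> ?C" for A
    proof (rule cl[OF reg\<beta> _ that])
      fix b assume "b \<in> B"
      then show "\<beta> (b * y * adj_mat b) = 0" using semi[of b] yc True by auto
    qed
    then show ?thesis by (intro exI[of _ 1] exI[of _ 0]) simp
  next
    case False
    \<comment> \<open>At b y b^-1 the two terms become c \<beta>(y) \<beta>(y^2) with opposite
      signs. The relation is nontrivial because \<beta>(y) is nonzero.\<close>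
    have "\<beta> (y * y) * \<beta> A + (- \<beta> y) * \<beta> (A * A) = 0" if "A \<in> ?C" for A
    proof (rule cl[OF _ _ that])
      show "regular_fun N (\<lambda>A. \<beta> (y * y) * \<beta> A + (- \<beta> y) * \<beta> (A * A))"
        by (intro regular_fun_add regular_fun_mult regular_fun_const reg\<beta>
            regular_fun_compose[OF reg\<beta>] regular_map_mult regular_map_id)
      fix b assume b: "b \<in> B"
      obtain c where c: "\<And>Z. Z \<in> carrier_mat N N \<Longrightarrow> \<beta> (b * Z * adj_mat b) = c * \<beta> Z"
        using semi[OF b] by blast
      show "\<beta> (y * y) * \<beta> (b * y * adj_mat b) +
          (- \<beta> y) * \<beta> ((b * y * adj_mat b) * (b * y * adj_mat b)) = 0"
        unfolding sq[OF Bd(1)[OF b] Bd(1)[OF Bd(5)[OF b]] yc Bd(7)[OF b]] using c yc by simp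
    qed
    then show ?thesis using False by (intro exI[of _ "\<beta> (y * y)"] exI[of _ "- \<beta> y"]) auto
  qed
  then obtain \<alpha> \<gamma> where nz: "\<alpha> \<noteq> 0 \<or> \<gamma> \<noteq> 0" and rel: "\<And>A. A \<in> ?C \<Longrightarrow> \<alpha> * \<beta> A + \<gamma> * \<beta> (A * A) = 0" by blast
  define X where "X = \<alpha> \<cdot>\<^sub>m x + \<gamma> \<cdot>\<^sub>m (x * x)"
  have X: "X \<in> carrier_mat N N" using x by (simp add: X_def)
  have "\<exists>c. X = c \<cdot>\<^sub>m 1\<^sub>m N"
  proof (rule ccontr)
    assume ns: "\<not> ?thesis"
    obtain p where p: "p < N" "v $ p \<noteq> 0"
      using v by (metis carrier_vecD eq_vecI index_zero_vec)
    obtain q where q: "q < N" "w $ q \<noteq> 0"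
      using w by (metis carrier_vecD eq_vecI index_zero_vec)
    obtain Z where Z: "similar_mat Z X" "\<beta> Z \<noteq> 0"
      using similar_bilinear_nonzero[where v = "\<lambda>i. v $ i" and w = "\<lambda>i. w $ i", OF two X _ p q] ns unfolding \<beta>_def by blast
    obtain P Q where wit: "similar_mat_wit Z X P Q" using Z(1) unfolding similar_mat_def by blast
    note PQ = similar_mat_witD2[OF similar_mat_carrier[OF Z(1) X] wit]
    \<comment> \<open>A conjugate of \<open>X\<close> is the same polynomial in the corresponding
      conjugate of x, so the relation on the class makes \<beta> vanish at it.\<close>
    define A where "A = P * x * Q"
    have "similar_mat A x"
      unfolding A_def using PQ x by (intro similar_matI[of _ x P Q N]) auto
    then have A: "A \<in> ?C" and Ac: "A \<in> carrier_mat N N" using C similar_mat_carrier[OF _ x] by auto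
    have "A * A = P * (x * x) * Q" unfolding A_def by (rule sq[OF PQ(6,7) x PQ(2)])
    have "Z = P * (\<alpha> \<cdot>\<^sub>m x + \<gamma> \<cdot>\<^sub>m (x * x)) * Q" using PQ(3) unfolding X_def .
    also have "P * (\<alpha> \<cdot>\<^sub>m x + \<gamma> \<cdot>\<^sub>m (x * x)) = \<alpha> \<cdot>\<^sub>m (P * x) + \<gamma> \<cdot>\<^sub>m (P * (x * x))"
      using PQ(6) x by (simp add: mult_add_distrib_mat[of P N N _ N] mult_smult_distrib[of P N N _ N])
    also have "\<dots> * Q = \<alpha> \<cdot>\<^sub>m (P * x * Q) + \<gamma> \<cdot>\<^sub>m (P * (x * x) * Q)"
      using PQ(6,7) x by (simp add: add_mult_distrib_mat[of _ N N _ _ N] mult_smult_assoc_mat[of _ N N _ N])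
    finally have "Z = \<alpha> \<cdot>\<^sub>m A + \<gamma> \<cdot>\<^sub>m (A * A)" using \<open>A * A = _\<close> by (simp add: A_def)
    then have "\<beta> Z = \<alpha> * \<beta> A + \<gamma> * \<beta> (A * A)"
      using Ac unfolding \<beta>_def sum_distrib_left sum.distrib[symmetric]
      by (intro sum.cong refl) (simp add: algebra_simps del: index_mult_mat(1))
    then show False using rel[OF A] Z(2) by simp
  qed
  then show ?thesis
    using quadratic_matI[OF x _ nz] unfolding X_def by blast
qed

section \<open>Density of upper triangular orbits\<close>

text \<open>Operations between neighbouring rows suffice: each column is cleared from the bottom up,
  an entry being killed by the row directly above it, and a zero in that row is first repaired by
  adding the row below. Hence only adjacent elementary matrices have to lie in
  \<open>S\<close>.\<close>

lemma gauss_elimination: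
  fixes S :: "'a::field mat set"
  assumes Sc: "S \<subseteq> carrier_mat N N" and one: "1\<^sub>m N \<in> S"
    and mult: "\<And>g h. g \<in> S \<Longrightarrow> h \<in> S \<Longrightarrow> g * h \<in> S"
    and lower: "\<And>i a. Suc i < N \<Longrightarrow> addrow_mat N a (Suc i) i \<in> S"
    and upper: "\<And>i a. Suc i < N \<Longrightarrow> addrow_mat N a i (Suc i) \<in> S"
    and A: "A \<in> carrier_mat N N"
  shows "\<exists>s\<in>S. \<exists>U\<in>carrier_mat N N. upper_triangular U \<and> A = s * U"
proof -
  define Q where "Q A \<longleftrightarrow> (\<exists>s\<in>S. \<exists>U\<in>carrier_mat N N. upper_triangular U \<and> A = s * U)" for A
  \<comment> \<open>Records progress: below the diagonal, the columns before \<open>j\<close> are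
    zero, and column \<open>j\<close> is zero below row \<open>i\<close>.\<close>
  define Z where "Z j i A \<longleftrightarrow> (\<forall>a<N. \<forall>b<a. b < j \<or> (b = j \<and> a > i) \<longrightarrow> A $$ (a, b) = 0)" for j i and A :: "'a mat"
  have Qmult: "Q A" if "Q A'" and s: "s \<in> S" "A = s * A'" for A A' s
  proof -
    obtain s' U where "s' \<in> S" "U \<in> carrier_mat N N" "upper_triangular U" "A' = s' * U"
      using \<open>Q A'\<close> unfolding Q_def by blast
    moreover from this have "A = (s * s') * U"
      using s Sc by (simp add: mat_assoc[where N = N] subset_iff)
    ultimately show ?thesis using mult[OF s(1)] unfolding Q_def by blast
  qed
  have row: "Q A" if "Q (addrow a k l A)" "A \<in> carrier_mat N N"
    "(l = Suc k \<and> Suc k < N) \<or> (k = Suc l \<and> Suc l < N)" for A a k l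
  proof (rule Qmult[OF that(1)])
    have kl: "k < N" "l < N" "k \<noteq> l" using that(3) by auto
    show "addrow_mat N (- a) k l \<in> S" using that(3) lower upper by auto
    have "addrow_mat N (- a) k l * addrow_mat N a k l = 1\<^sub>m N"
      using addrow_mat_inv[OF kl, of "- a"] by simp
    then show "A = addrow_mat N (- a) k l * addrow a k l A"
      unfolding addrow_mat[OF that(2) kl(2)]
      using that(2) assoc_mult_mat[of "addrow_mat N (- a) k l" N N "addrow_mat N a k l" N A N] by simp
  qed
  have "Q A" if "j \<le> N" "Z j N A" "A \<in> carrier_mat N N" for A j
    using that
  proof (induction j arbitrary: A rule: inc_induct)
    case base
    then have "upper_triangular A" unfolding upper_triangular_def Z_def by auto
    then show ?case using base one unfolding Q_def by (intro bexI[of _ "1\<^sub>m N"] bexI[of _ A]) auto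
  next
    case (step j)
    have "Q A" if "i \<ge> j" "Z j i A" "A \<in> carrier_mat N N" for A i
      using that
    proof (induction i arbitrary: A rule: dec_induct)
      case base
      then have "Z (Suc j) N A" unfolding Z_def by (auto simp: less_Suc_eq)
      then show ?case using step.IH base by blast
    next
      case (step i)
      show ?case
      proof (cases "Suc i < N \<and> A $$ (Suc i, j) \<noteq> 0")
        case False
        then have "Z j i A"
          using step.prems unfolding Z_def by (auto simp: Suc_lessI) (metis Suc_lessI)+
        then show ?thesis using step by blast
      next
        case True
        then have i: "Suc i < N" "j < N" using step.hyps by auto
        have kill: "Q B" if B: "B \<in> carrier_mat N N" "Z j (Suc i) B" "B $$ (i, j) \<noteq> 0" for B
        proof -
          let ?c = "- B $$ (Suc i, j) / B $$ (i, j)"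
          have "Z j i (addrow ?c (Suc i) i B)"
            unfolding Z_def
          proof (intro allI impI)
            fix a b assume ab: "a < N" "b < a" "b < j \<or> b = j \<and> i < a"
            then have "a = Suc i \<and> b = j \<or> a \<noteq> Suc i \<and> (b < j \<or> b = j \<and> Suc i < a) \<or> a = Suc i \<and> b < j \<and> b < i"
              using step.hyps by auto
            then show "addrow ?c (Suc i) i B $$ (a, b) = 0"
              using B ab i unfolding Z_def by (auto simp: carrier_matD[OF B(1)])
          qed
          then have "Q (addrow ?c (Suc i) i B)" using step.IH B(1) by simp
          then show ?thesis using row B(1) i by blast
        qed
        show ?thesis
        proof (cases "A $$ (i, j) = 0")
          case False
          then show ?thesis using kill step.prems by blast
        next
          case zero: True
          \<comment> \<open>The pivot is zero, so row i + 1 is added to row i. Both rows vanish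
            before column j, so the zeros already made survive.\<close>
          have "Z j (Suc i) (addrow 1 i (Suc i) A)"
            unfolding Z_def
          proof (intro allI impI)
            fix a b assume ab: "a < N" "b < a" "b < j \<or> b = j \<and> Suc i < a"
            then show "addrow 1 i (Suc i) A $$ (a, b) = 0"
              using step.prems i unfolding Z_def by (auto simp: carrier_matD[OF step.prems(2)])
          qed
          moreover have "addrow 1 i (Suc i) A $$ (i, j) \<noteq> 0"
            using step.prems i True zero by simp
          ultimately have "Q (addrow 1 i (Suc i) A)"
            using kill step.prems(2) by simp
          then show ?thesis using row[of 1 i "Suc i"] step.prems i by blast
        qed
      qed
    qed
    from this[of N A] step.hyps step.prems show ?case by auto
  qed
  from this[of 0 A] have "Q A" using A by (simp add: Z_def)
  then show ?thesis unfolding Q_def .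
qed

text \<open>The inverse is carried along explicitly and the determinant is left arbitrary: scalars
  cancel in conjugation, so the orbits agree with those of \<open>upper_SL N\<close>.\<close>

definition upper_pair :: "nat \<Rightarrow> 'a::field mat \<Rightarrow> 'a mat \<Rightarrow> bool" where
  "upper_pair N b b' \<longleftrightarrow> b \<in> carrier_mat N N \<and> b' \<in> carrier_mat N N \<and> b * b' = 1\<^sub>m N \<and> upper_triangular b"

lemma upper_pairD:
  assumes "upper_pair N b b'"
  shows "b \<in> carrier_mat N N" "b' \<in> carrier_mat N N" "b * b' = 1\<^sub>m N" "b' * b = 1\<^sub>m N"
    "upper_triangular b" "\<And>i. i < N \<Longrightarrow> b $$ (i, i) \<noteq> 0"
proof -
  show *: "b \<in> carrier_mat N N" "b' \<in> carrier_mat N N" "b * b' = 1\<^sub>m N" "upper_triangular b"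
    using assms unfolding upper_pair_def by auto
  show "b' * b = 1\<^sub>m N" by (rule mat_mult_left_right_inverse[OF *(1-3)])
  have "det b \<noteq> 0" using det_mult[OF *(1,2)] *(3) by auto
  then show "b $$ (i, i) \<noteq> 0" if "i < N" for i
    using upper_triangular_diag_nonzero[OF *(1,4)] that by blast
qed

lemma inverse_pair_mult:
  fixes g h g' h' :: "'a::field mat"
  assumes "g \<in> carrier_mat N N" "h \<in> carrier_mat N N" "g' \<in> carrier_mat N N" "h' \<in> carrier_mat N N"
    and "g * g' = 1\<^sub>m N" "h * h' = 1\<^sub>m N"
  shows "(g * h) * (h' * g') = 1\<^sub>m N"
proof -
  have "(g * h) * (h' * g') = g * ((h * h') * g')"
    using assms(1-4) by (simp add: mat_assoc[where N = N])
  then show ?thesis using assms by (simp add: left_mult_one_mat[OF assms(3)])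
qed

lemma upper_pair_mult:
  "upper_pair N b b' \<Longrightarrow> upper_pair N c c' \<Longrightarrow> upper_pair N (b * c) (c' * b')"
  unfolding upper_pair_def using inverse_pair_mult upper_triangular_mult by auto

lemma conj_mult:
  fixes g h x h' g' :: "'a::field mat"
  assumes "g \<in> carrier_mat N N" "h \<in> carrier_mat N N" "x \<in> carrier_mat N N" "h' \<in> carrier_mat N N" "g' \<in> carrier_mat N N"
  shows "g * (h * x * h') * g' = (g * h) * x * (h' * g')"
  using assms by (simp add: mat_assoc[where N = N])

text \<open>Below, \<open>U\<^sub>i(t) = 1 + t E\<^sub>i\<^sub>+\<^sub>1\<^sub>,\<^sub>i\<close>. For generic \<open>t\<close> the product \<open>U\<^sub>i(t) b\<close> with \<open>b\<close> upper
  triangular factors as \<open>b\<^sub>2 U\<^sub>i(t')\<close> with \<open>b\<^sub>2\<close> upper triangular.\<close>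

lemma lower_root_times_upper:
  fixes b :: "'a::field mat"
  assumes b: "upper_pair N b b'" and i: "Suc i < N"
    and \<beta>: "b $$ (Suc i, Suc i) + t * b $$ (i, Suc i) \<noteq> 0" (is "?\<beta> \<noteq> 0")
  defines "t' \<equiv> t * b $$ (i, i) / (b $$ (Suc i, Suc i) + t * b $$ (i, Suc i))"
  obtains b2 b2' where "upper_pair N b2 b2'"
    "addrow_mat N t (Suc i) i * b = b2 * addrow_mat N t' (Suc i) i"
    "b' * addrow_mat N (- t) (Suc i) i = addrow_mat N (- t') (Suc i) i * b2'"
proof -
  define L where "L t = addrow_mat N t (Suc i) i" for t :: 'a
  note bd = upper_pairD[OF b]
  have L: "L s \<in> carrier_mat N N" "L s * L (- s) = 1\<^sub>m N" "L (- s) * L s = 1\<^sub>m N" for s :: 'a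
    using addrow_mat_inv[of "Suc i" N i s] addrow_mat_inv[of "Suc i" N i "- s"] i by (auto simp: L_def)
  note Lc = L(1)[of t] L(1)[of "- t"] L(1)[of t'] L(1)[of "- t'"]
  \<comment> \<open>The desired factorization forces this \<open>?b2\<close>, and t' is the value
    for which its (i+1, i) entry vanishes, the only entry below the diagonal in question.\<close>
  let ?b2 = "L t * b * L (- t')" and ?b2' = "L t' * b' * L (- t)"
  have Lb: "L t * b = addrow t (Suc i) i b"
    unfolding L_def by (rule addrow_mat[symmetric, OF bd(1)]) (use i in simp)
  have b2: "?b2 = addcol (- t') i (Suc i) (addrow t (Suc i) i b)"
    unfolding Lb unfolding L_def by (rule addcol_mat[symmetric]) (use bd i in auto)
  have "upper_triangular ?b2"
    unfolding upper_triangular_def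
  proof (intro allI impI)
    fix r c assume "r < dim_row ?b2" "c < r"
    then have rc: "r < N" "c < r" by (auto simp: b2 carrier_matD[OF bd(1)])
    have low: "b $$ (p, q) = 0" if "q < p" "p < N" for p q
      using bd(1,5) that by (auto simp: upper_triangular_def)
    show "?b2 $$ (r, c) = 0"
    proof (cases "c = i \<and> r = Suc i")
      case True
      have "?b2 $$ (r, c) = - t' * (t * b $$ (i, Suc i) + b $$ (Suc i, Suc i)) + t * b $$ (i, i)"
        using True i low[of i "Suc i"] unfolding b2 by (simp add: carrier_matD[OF bd(1)])
      also have "\<dots> = 0" using \<beta> by (simp add: t'_def add.commute)
      finally show ?thesis .
    next
      case False
      then show ?thesis using rc i low unfolding b2 by (auto simp: carrier_matD[OF bd(1)])
    qed
  qed
  moreover have "?b2 * ?b2' = 1\<^sub>m N"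
  proof -
    have "?b2 * ?b2' = L t * (b * ((L (- t') * L t') * (b' * L (- t))))"
      using Lc bd(1,2) by (simp add: mat_assoc[where N = N])
    also have "\<dots> = L t * ((b * b') * L (- t))"
      unfolding L(3) using Lc bd(1,2) by (simp add: mat_assoc[where N = N])
    finally show ?thesis unfolding bd(3) using L(2) Lc by simp
  qed
  ultimately have "upper_pair N ?b2 ?b2'"
    using Lc bd(1,2) unfolding upper_pair_def by auto
  moreover have "L t * b = ?b2 * L t'"
  proof -
    have "?b2 * L t' = L t * b * (L (- t') * L t')"
      using Lc bd(1) by (intro mat_assoc[where N = N]) auto
    then show ?thesis unfolding L(3) using Lc bd(1) by simp
  qed
  moreover have "b' * L (- t) = L (- t') * ?b2'"
  proof -
    have "L (- t') * ?b2' = (L (- t') * L t') * (b' * L (- t))"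
      using Lc bd(2) by (simp add: mat_assoc[where N = N])
    then show ?thesis unfolding L(3) using Lc bd(2) by simp
  qed
  ultimately show ?thesis unfolding L_def by (rule that)
qed

text \<open>If every generic \<open>U\<^sub>i(t)\<close> moves \<open>y\<close> inside its orbit under the upper triangular group, then the
  closure of that orbit is stable under all \<open>U\<^sub>i(t)\<close>, hence under the whole general linear group.\<close>

lemma upper_orbit_dense:
  fixes y :: "'a::alg_closed_field mat"
  assumes y: "y \<in> carrier_mat N N"
    and root: "\<And>i. Suc i < N \<Longrightarrow> \<exists>c. \<forall>t. 1 - t * c \<noteq> 0 \<longrightarrow> (\<exists>b b'. upper_pair N b b' \<and>
        (b' * addrow_mat N t (Suc i) i) * y = y * (b' * addrow_mat N t (Suc i) i))"
    and f: "regular_fun N f" and van: "\<And>b b'. upper_pair N b b' \<Longrightarrow> f (b * y * b') = 0"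
    and g: "g \<in> carrier_mat N N" "g' \<in> carrier_mat N N" "g * g' = 1\<^sub>m N"
  shows "f (g * y * g') = 0"
proof -
  \<comment> \<open>\<open>I\<close> is the vanishing ideal of the orbit under invertible upper
    triangular matrices, and \<open>S\<close> consists of the invertible matrices whose conjugation
    preserves \<open>I\<close>. The aim is to put every invertible matrix into
    \<open>S\<close>.\<close>
  define I where "I = {f. regular_fun N f \<and> (\<forall>b b'. upper_pair N b b' \<longrightarrow> f (b * y * b') = 0)}"
  define S where "S = {g \<in> carrier_mat N N. \<exists>g'\<in>carrier_mat N N. g * g' = 1\<^sub>m N \<and>
    (\<forall>f\<in>I. (\<lambda>A. f (g * A * g')) \<in> I)}"
  have regconj: "regular_fun N (\<lambda>A. f (g * A * g'))"
    if "regular_fun N f" "g \<in> carrier_mat N N" "g' \<in> carrier_mat N N" for f and g g' :: "'a mat"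
    by (intro regular_fun_compose[OF that(1)] regular_map_mult regular_map_const regular_map_id that)
  have upS: "b \<in> S" if b: "upper_pair N b b'" for b b' :: "'a mat"
  proof -
    note bd = upper_pairD[OF b]
    have "(\<lambda>A. f (b * A * b')) \<in> I" if f: "f \<in> I" for f :: "'a mat \<Rightarrow> 'a"
      unfolding I_def
    proof (intro CollectI conjI allI impI)
      show "regular_fun N (\<lambda>A. f (b * A * b'))" using f bd unfolding I_def by (blast intro: regconj)
      fix c c' :: "'a mat" assume c: "upper_pair N c c'"
      have "b * (c * y * c') * b' = (b * c) * y * (c' * b')"
        using bd(1,2) upper_pairD(1,2)[OF c] y by (intro conj_mult)
      then show "f (b * (c * y * c') * b') = 0"
        using f upper_pair_mult[OF b c] unfolding I_def by auto
    qed
    then show ?thesis unfolding S_def using bd by blast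
  qed
  have lowS: "addrow_mat N t (Suc i) i \<in> S" if i: "Suc i < N" for t i
  proof -
    define L where "L t = addrow_mat N t (Suc i) i" for t :: 'a
    have L: "L s \<in> carrier_mat N N" "L s * L (- s) = 1\<^sub>m N" for s :: 'a
      using addrow_mat_inv[of "Suc i" N i s] i by (auto simp: L_def)
    obtain c where c: "\<And>t. 1 - t * c \<noteq> 0 \<Longrightarrow> \<exists>b b'. upper_pair N b b' \<and> (b' * L t) * y = y * (b' * L t)"
      using root[OF i] unfolding L_def by blast
    have "(\<lambda>A. f (L t * A * L (- t))) \<in> I" if f: "f \<in> I" for f
      unfolding I_def
    proof (intro CollectI conjI allI impI)
      show "regular_fun N (\<lambda>A. f (L t * A * L (- t)))" using f L unfolding I_def by (blast intro: regconj)
      fix b b' :: "'a mat" assume b: "upper_pair N b b'"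
      note bd = upper_pairD[OF b]
      define M where "M = b * y * b'"
      have M: "M \<in> carrier_mat N N" using bd y by (simp add: M_def)
      define \<gamma> where "\<gamma> t = L t * M * L (- t)" for t
      have \<gamma>: "\<gamma> t = addcol (- t) i (Suc i) (addrow t (Suc i) i M)" for t
      proof -
        have "L t * M = addrow t (Suc i) i M"
          unfolding L_def by (rule addrow_mat[symmetric, OF M]) (use i in simp)
        then show ?thesis unfolding \<gamma>_def using M i
          by (simp add: addcol_mat[of _ N N] L_def)
      qed
      have rc: "rational_curve N 1 \<gamma>"
        unfolding rational_curve_def
      proof (intro conjI allI impI)
        fix r s assume rs: "r < N" "s < N"
        let ?p = "\<lambda>q. (if r = Suc i then [:M $$ (r, q), M $$ (i, q):] else [:M $$ (r, q):])"
        show "\<exists>q. \<forall>t. poly 1 t \<noteq> 0 \<longrightarrow> \<gamma> t $$ (r, s) * poly 1 t = poly q t"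
          by (rule exI[of _ "?p s + (if s = i then [:0, -1:] * ?p (Suc i) else 0)"])
            (use rs i in \<open>auto simp: \<gamma> carrier_matD[OF M] algebra_simps\<close>)
      qed (unfold \<gamma>_def, rule mult_carrier_mat[OF mult_carrier_mat[OF L(1) M] L(1)])
      define p where "p = [:b $$ (Suc i, Suc i), b $$ (i, Suc i):]"
      \<comment> \<open>Excludes two bad sets of parameters: zeros of \<open>p\<close>, where the
        factorization breaks down, and zeros of the second factor, where 1 - t' c = 0. At t = 0 both
        factors equal a diagonal entry of \<open>b\<close>, so \<open>q\<close> is not zero.\<close>
      define q where "q = p * (p - [:0, c * b $$ (i, i):])"
      have "poly q 0 \<noteq> 0" using bd(6)[OF i] by (simp add: q_def p_def)
      then have "q \<noteq> 0" by auto
      have "f (\<gamma> t) = 0"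
      proof (rule rational_curve_vanishing[OF rc _ \<open>q \<noteq> 0\<close>])
        show "regular_fun N f" using f unfolding I_def by blast
        fix t assume qt: "poly q t \<noteq> 0"
        have pt: "poly p t = b $$ (Suc i, Suc i) + t * b $$ (i, Suc i)" by (simp add: p_def)
        have "poly q t = poly p t * (poly p t - t * (c * b $$ (i, i)))"
          unfolding q_def poly_mult poly_diff by simp
        with qt have \<beta>: "b $$ (Suc i, Suc i) + t * b $$ (i, Suc i) \<noteq> 0" (is "?\<beta> \<noteq> 0")
          and gen: "b $$ (Suc i, Suc i) + t * b $$ (i, Suc i) - t * (c * b $$ (i, i)) \<noteq> 0"
          unfolding pt[symmetric] by auto
        define t' where "t' = t * b $$ (i, i) / (b $$ (Suc i, Suc i) + t * b $$ (i, Suc i))"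
        obtain b2 b2' where b2: "upper_pair N b2 b2'" and Lb: "L t * b = b2 * L t'"
          and bL: "b' * L (- t) = L (- t') * b2'"
          using lower_root_times_upper[OF b i \<beta>] unfolding t'_def L_def by blast
        have "1 - t' * c = (?\<beta> - t * (c * b $$ (i, i))) / ?\<beta>"
          using \<beta> by (simp add: t'_def diff_divide_distrib mult_ac)
        then have "1 - t' * c \<noteq> 0" using gen \<beta> by simp
        then obtain d d' where d: "upper_pair N d d'" and com: "(d' * L t') * y = y * (d' * L t')"
          using c by blast
        note Lc = L(1)[of t] L(1)[of "- t"] L(1)[of t'] L(1)[of "- t'"]
        note b2d = upper_pairD[OF b2] and dd = upper_pairD[OF d]
        \<comment> \<open>As d' U_i(t') commutes with \<open>y\<close>, conjugating \<open>y\<close>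
          by U_i(t') is the same as conjugating it by \<open>d\<close>.\<close>
        have "L t' * y * L (- t') = (d * d') * (L t' * y * L (- t'))"
          unfolding dd(3) using Lc y by simp
        also have "\<dots> = d * (((d' * L t') * y) * L (- t'))"
          using Lc y dd(1,2) by (simp add: mat_assoc[where N = N])
        also have "\<dots> = d * (y * (d' * (L t' * L (- t'))))"
          unfolding com using Lc y dd(1,2) by (simp add: mat_assoc[where N = N])
        also have "\<dots> = d * y * d'"
          unfolding L(2) using y dd(1,2) by (simp add: mat_assoc[where N = N])
        finally have Ly: "L t' * y * L (- t') = d * y * d'" .
        have "\<gamma> t = (L t * b) * y * (b' * L (- t))"
          unfolding \<gamma>_def M_def using Lc bd(1,2) y by (intro conj_mult)
        also have "\<dots> = b2 * (L t' * y * L (- t')) * b2'"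
          unfolding Lb bL using Lc b2d(1,2) y by (intro conj_mult[symmetric])
        also have "\<dots> = (b2 * d) * y * (d' * b2')"
          unfolding Ly using b2d(1,2) dd(1,2) y by (intro conj_mult)
        finally show "f (\<gamma> t) = 0"
          using f upper_pair_mult[OF b2 d] unfolding I_def by auto
      qed simp
      then show "f (L t * (b * y * b') * L (- t)) = 0" by (simp add: \<gamma>_def M_def)
    qed
    then show ?thesis unfolding S_def L_def[symmetric] using L by blast
  qed
  have multS: "g * h \<in> S" if gS: "g \<in> S" and hS: "h \<in> S" for g h
  proof -
    obtain g' where g: "g \<in> carrier_mat N N" "g' \<in> carrier_mat N N" "g * g' = 1\<^sub>m N"
      "\<And>f. f \<in> I \<Longrightarrow> (\<lambda>A. f (g * A * g')) \<in> I" using gS unfolding S_def by blast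
    obtain h' where h: "h \<in> carrier_mat N N" "h' \<in> carrier_mat N N" "h * h' = 1\<^sub>m N"
      "\<And>f. f \<in> I \<Longrightarrow> (\<lambda>A. f (h * A * h')) \<in> I" using hS unfolding S_def by blast
    have "(\<lambda>A. f ((g * h) * A * (h' * g'))) \<in> I" if f: "f \<in> I" for f
    proof -
      have 1: "(\<lambda>A. f (g * (h * A * h') * g')) \<in> I" using h(4)[OF g(4)[OF f]] .
      have "f (g * (h * A * h') * g') = f ((g * h) * A * (h' * g'))" if "A \<in> carrier_mat N N" for A
        using conj_mult[OF g(1) h(1) that h(2) g(2)] by simp
      moreover have "regular_fun N (\<lambda>A. f ((g * h) * A * (h' * g')))"
        using f g(1,2) h(1,2) unfolding I_def by (intro regconj) auto
      moreover have "b * y * b' \<in> carrier_mat N N" if "upper_pair N b b'" for b b' :: "'a mat"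
        using upper_pairD(1,2)[OF that] y by simp
      ultimately show ?thesis using 1 unfolding I_def by auto
    qed
    then show ?thesis unfolding S_def using g(1-3) h(1-3) inverse_pair_mult[OF g(1) h(1) g(2) h(2) g(3) h(3)]
      by (intro CollectI conjI bexI[of _ "h' * g'"]) auto
  qed
  have upper_addrow: "upper_pair N (addrow_mat N a i (Suc i)) (addrow_mat N (- a) i (Suc i))"
    if "Suc i < N" for a :: 'a and i
    using that addrow_mat_inv[of i N "Suc i" a] by (auto simp: upper_pair_def upper_triangular_def)
  obtain s U where s: "s \<in> S" and U: "U \<in> carrier_mat N N" "upper_triangular U" and gsU: "g = s * U"
    using gauss_elimination[of S N g]
  proof -
    have "S \<subseteq> carrier_mat N N" unfolding S_def by blast
    moreover have "1\<^sub>m N \<in> S" by (rule upS[of _ "1\<^sub>m N"]) (simp add: upper_pair_def)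
    ultimately show thesis
      using gauss_elimination[of S N g] multS lowS upS[OF upper_addrow] g(1) that by blast
  qed
  obtain s' where s': "s \<in> carrier_mat N N" "s' \<in> carrier_mat N N" "s * s' = 1\<^sub>m N"
    using s unfolding S_def by blast
  \<comment> \<open>\<open>U\<close> inherits invertibility from g and s, with inverse g^-1 s, so it
    belongs to an \<open>upper_pair\<close>.\<close>
  have "U * (g' * s) = 1\<^sub>m N"
  proof -
    have "s' * s = 1\<^sub>m N" by (rule mat_mult_left_right_inverse[OF s'])
    then have "U = s' * g" using gsU s' U(1) assoc_mult_mat[of s' N N s N U N] by simp
    moreover have "g * (g' * s) = s"
      using assoc_mult_mat[OF g(1,2) s'(1)] g(3) s'(1) by simp
    ultimately show ?thesis
      using assoc_mult_mat[OF s'(2) g(1), of "g' * s" N] g(2) s' \<open>s' * s = _\<close> by simp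
  qed
  then have "upper_pair N U (g' * s)" using U g s' by (simp add: upper_pair_def)
  then have "g \<in> S" unfolding gsU by (intro multS s upS)
  then obtain h where h: "h \<in> carrier_mat N N" "g * h = 1\<^sub>m N" "\<And>f. f \<in> I \<Longrightarrow> (\<lambda>A. f (g * A * h)) \<in> I"
    unfolding S_def by blast
  have "h = g'"
  proof -
    have "g' = g' * (g * h)" using g h by simp
    also have "\<dots> = (g' * g) * h" by (rule assoc_mult_mat[symmetric, OF g(2,1) h(1)])
    also have "\<dots> = h" using mat_mult_left_right_inverse[OF g] h by simp
    finally show ?thesis by simp
  qed
  moreover have "f \<in> I" using f van unfolding I_def by blast
  ultimately have "(\<lambda>A. f (g * A * g')) \<in> I" using h(3) by blast
  moreover have "upper_pair N (1\<^sub>m N) (1\<^sub>m N :: 'a mat)" by (simp add: upper_pair_def)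
  ultimately have "f (g * (1\<^sub>m N * y * 1\<^sub>m N) * g') = 0" unfolding I_def by blast
  then show ?thesis using y by simp
qed

text \<open>Rescaling replaces an invertible upper triangular matrix by one in
  \<open>upper_SL N\<close> with the same conjugation action, so \<open>upper_orbit_dense\<close>
  yields density for that Borel subgroup.\<close>

lemma spherical_class_if_upper_dense:
  fixes y :: "'a::alg_closed_field mat"
  assumes N: "N > 0" and y: "y \<in> carrier_mat N N" and sim: "similar_mat y x"
    and root: "\<And>i. Suc i < N \<Longrightarrow> \<exists>c. \<forall>t. 1 - t * c \<noteq> 0 \<longrightarrow> (\<exists>b b'. upper_pair N b b' \<and>
        (b' * addrow_mat N t (Suc i) i) * y = y * (b' * addrow_mat N t (Suc i) i))"
  shows "spherical_class N (conj_class (SL N) x)"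
proof -
  let ?C = "conj_class (SL N) x" and ?T = "upper_SL N :: 'a mat set"
  let ?O = "orbit ((SL N)\<lparr>carrier := ?T\<rparr>) (conj_act (SL N)) y"
  have x: "x \<in> carrier_mat N N" by (rule similar_mat_carrier[OF similar_mat_sym[OF sim] y])
  have C: "?C = {A. similar_mat A x}" by (rule conj_class_special_linear[OF x N])
  have Cc: "?C \<subseteq> carrier_mat N N" unfolding C using similar_mat_carrier[OF _ x] by blast
  have B: "borel_subgroup N ?T" by (rule borel_subgroup_upper_SL[OF N])
  have O: "z \<in> ?O \<longleftrightarrow> (\<exists>b\<in>?T. z = b * y * adj_mat b)" for z
  proof -
    have "conj_act (SL N) b y = b * y * adj_mat b" if "b \<in> ?T" for b :: "'a mat"
      using that by (intro conj_act_special_linear) (auto simp: upper_SL_def)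
    then show ?thesis unfolding orbit_def by (simp, metis)
  qed
  have OC: "?O \<subseteq> ?C"
  proof
    fix z assume "z \<in> ?O"
    then obtain b where b: "b \<in> ?T" and z: "z = b * y * adj_mat b" using O by blast
    have bc: "b \<in> carrier_mat N N" "det b = 1" using b by (auto simp: upper_SL_def)
    have "similar_mat z y"
      using adj_mat_special_linear[OF bc] bc y unfolding z by (intro similar_matI[of _ y b "adj_mat b" N]) auto
    then show "z \<in> ?C" unfolding C using similar_mat_trans[OF _ sim] by blast
  qed
  have "?C \<subseteq> zariski N closure_of ?O"
  proof
    fix A assume A: "A \<in> ?C"
    have "f A = 0" if f: "regular_fun N f" "\<forall>z\<in>?O. f z = 0" for f
    proof -
      have "similar_mat A y" using A similar_mat_trans[OF _ similar_mat_sym[OF sim]] unfolding C by blast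
      then obtain P Q where wit: "similar_mat_wit A y P Q" unfolding similar_mat_def by blast
      note PQ = similar_mat_witD2[OF subsetD[OF Cc A] wit]
      have "f (P * y * Q) = 0"
      proof (rule upper_orbit_dense[OF y root f(1) _ PQ(6,7,1)])
        fix b b' :: "'a mat" assume b: "upper_pair N b b'"
        note bd = upper_pairD[OF b]
        obtain \<mu> where \<mu>: "\<mu> \<noteq> 0" "det (\<mu> \<cdot>\<^sub>m b) = 1" "(\<mu> \<cdot>\<^sub>m b) * y * adj_mat (\<mu> \<cdot>\<^sub>m b) = b * y * b'"
          using rescale_to_special_linear[OF bd(1,2,3) N] y by metis
        then have "\<mu> \<cdot>\<^sub>m b \<in> ?T" using bd(1,5) by (auto simp: upper_SL_def upper_triangular_def)
        then have "b * y * b' \<in> ?O" unfolding O using \<mu>(3) by metis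
        then show "f (b * y * b') = 0" using f(2) by blast
      qed
      then show ?thesis using PQ(3) by simp
    qed
    then show "A \<in> zariski N closure_of ?O"
      using A Cc OC unfolding zariski_closure_of[OF subset_trans[OF OC Cc]] by blast
  qed
  then have "(subtopology (zariski N) ?C) closure_of ?O = ?C"
    using OC by (auto simp: closure_of_subtopology Int_absorb1)
  moreover have "y \<in> ?C" unfolding C using sim by simp
  ultimately show ?thesis unfolding spherical_class_def using B by blast
qed

section \<open>Normal form for quadratic matrices\<close>

text \<open>The matrix maps \<open>e\<^sub>i\<close> to \<open>e\<^sub>N\<^sub>-\<^sub>1\<^sub>-\<^sub>i\<close> for \<open>i < r\<close>, acts as \<open>c\<close> on the last \<open>r\<close> basis vectors
  and as \<open>d\<close> on the middle ones.\<close>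

definition quadratic_nf :: "nat \<Rightarrow> nat \<Rightarrow> 'a::field \<Rightarrow> 'a \<Rightarrow> 'a mat" where
  "quadratic_nf N r c d = mat N N (\<lambda>(a, b).
     if N - r \<le> a then (if a + b + 1 = N then 1 else 0) + (if a = b then c else 0)
     else if r \<le> a \<and> a = b then d else 0)"

lemma quadratic_nf_carrier [simp]: "quadratic_nf N r c d \<in> carrier_mat N N"
  by (simp add: quadratic_nf_def)

lemma quadratic_nf_mult_left:
  assumes r: "2 * r \<le> N" and z: "z \<in> carrier_mat N N" and ab: "a < N" "b < N"
  shows "(quadratic_nf N r c d * z) $$ (a, b) =
    (if N - r \<le> a then z $$ (N - 1 - a, b) + c * z $$ (a, b) else if r \<le> a then d * z $$ (a, b) else 0)"
proof -
  let ?e = "if N - r \<le> a then c else if r \<le> a then d else 0"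
  have "(quadratic_nf N r c d * z) $$ (a, b) = (\<Sum>k = 0..<N. quadratic_nf N r c d $$ (a, k) * z $$ (k, b))"
    using z ab by (simp add: scalar_prod_def quadratic_nf_def)
  also have "\<dots> = (\<Sum>k = 0..<N. (if k = N - 1 - a then if N - r \<le> a then z $$ (k, b) else 0 else 0) +
      (if k = a then ?e * z $$ (k, b) else 0))"
    using r ab by (intro sum.cong refl) (auto simp: quadratic_nf_def algebra_simps)
  also have "\<dots> = (if N - r \<le> a then z $$ (N - 1 - a, b) else 0) + ?e * z $$ (a, b)"
    using ab by (simp add: sum.distrib)
  finally show ?thesis by auto
qed

lemma quadratic_nf_mult_right:
  assumes r: "2 * r \<le> N" and z: "z \<in> carrier_mat N N" and ab: "a < N" "b < N"
  shows "(z * quadratic_nf N r c d) $$ (a, b) =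
    (if b < r then z $$ (a, N - 1 - b) else if b < N - r then d * z $$ (a, b) else c * z $$ (a, b))"
proof -
  let ?e = "if b < r then 0 else if b < N - r then d else c"
  have "(z * quadratic_nf N r c d) $$ (a, b) = (\<Sum>k = 0..<N. z $$ (a, k) * quadratic_nf N r c d $$ (k, b))"
    using z ab by (simp add: scalar_prod_def quadratic_nf_def)
  also have "\<dots> = (\<Sum>k = 0..<N. (if k = N - 1 - b then if b < r then z $$ (a, k) else 0 else 0) +
      (if k = b then ?e * z $$ (a, k) else 0))"
    using r ab by (intro sum.cong refl) (auto simp: quadratic_nf_def algebra_simps)
  also have "\<dots> = (if b < r then z $$ (a, N - 1 - b) else 0) + ?e * z $$ (a, b)"
    using ab by (simp add: sum.distrib)
  finally show ?thesis by auto
qed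

definition mat_unit :: "nat \<Rightarrow> nat \<Rightarrow> nat \<Rightarrow> 'a::field mat" where
  "mat_unit N k l = mat N N (\<lambda>(a, b). if a = k \<and> b = l then 1 else 0)"

lemma mat_unit_carrier [simp]: "mat_unit N k l \<in> carrier_mat N N"
  by (simp add: mat_unit_def)

lemma mat_unit_dim [simp]: "dim_row (mat_unit N k l) = N" "dim_col (mat_unit N k l) = N"
  by (simp_all add: mat_unit_def)

lemma mat_unit_mult_nf:
  assumes r: "2 * r \<le> N" and kl: "k < N" "l < N"
  shows "mat_unit N k l * quadratic_nf N r c d = (if l < r then 0\<^sub>m N N
    else if l < N - r then d \<cdot>\<^sub>m mat_unit N k l else mat_unit N k (N - 1 - l) + c \<cdot>\<^sub>m mat_unit N k l)" (is "_ = ?R")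
proof (rule eq_matI)
  have R: "?R \<in> carrier_mat N N" by (simp add: mat_unit_def)
  fix a b assume "a < dim_row ?R" "b < dim_col ?R"
  then have ab: "a < N" "b < N" using R by auto
  show "(mat_unit N k l * quadratic_nf N r c d) $$ (a, b) = ?R $$ (a, b)"
    unfolding quadratic_nf_mult_right[OF r mat_unit_carrier ab]
    using ab r kl by (auto simp: mat_unit_def)
qed (auto simp: mat_unit_def quadratic_nf_def)

lemma nf_mult_mat_unit:
  assumes r: "2 * r \<le> N" and kl: "k < N" "l < N"
  shows "quadratic_nf N r c d * mat_unit N k l = (if k < r then mat_unit N (N - 1 - k) l
    else if k < N - r then d \<cdot>\<^sub>m mat_unit N k l else c \<cdot>\<^sub>m mat_unit N k l)" (is "_ = ?R")
proof (rule eq_matI)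
  have R: "?R \<in> carrier_mat N N" by (simp add: mat_unit_def)
  fix a b assume "a < dim_row ?R" "b < dim_col ?R"
  then have ab: "a < N" "b < N" using R by auto
  show "(quadratic_nf N r c d * mat_unit N k l) $$ (a, b) = ?R $$ (a, b)"
    unfolding quadratic_nf_mult_left[OF r mat_unit_carrier ab]
    using ab r kl by (auto simp: mat_unit_def)
qed (auto simp: mat_unit_def quadratic_nf_def)

lemma one_plus_units_commute:
  fixes y :: "'a::field mat"
  assumes y: "y \<in> carrier_mat N N" and E: "E \<in> carrier_mat N N" "F \<in> carrier_mat N N"
    and z: "z = 1\<^sub>m N + (s \<cdot>\<^sub>m E + t \<cdot>\<^sub>m F)"
    and eq: "s \<cdot>\<^sub>m (E * y) + t \<cdot>\<^sub>m (F * y) = s \<cdot>\<^sub>m (y * E) + t \<cdot>\<^sub>m (y * F)"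
  shows "z * y = y * z"
proof -
  have "(s \<cdot>\<^sub>m E + t \<cdot>\<^sub>m F) * y = s \<cdot>\<^sub>m (E * y) + t \<cdot>\<^sub>m (F * y)"
    using add_mult_distrib_mat[OF smult_carrier_mat[OF E(1)] smult_carrier_mat[OF E(2)] y]
      mult_smult_assoc_mat[OF E(1) y] mult_smult_assoc_mat[OF E(2) y] by simp
  moreover have "y * (s \<cdot>\<^sub>m E + t \<cdot>\<^sub>m F) = s \<cdot>\<^sub>m (y * E) + t \<cdot>\<^sub>m (y * F)"
    using mult_add_distrib_mat[OF y smult_carrier_mat[OF E(1)] smult_carrier_mat[OF E(2)]]
      mult_smult_distrib[OF y E(1)] mult_smult_distrib[OF y E(2)] by simp
  moreover have sum: "s \<cdot>\<^sub>m E + t \<cdot>\<^sub>m F \<in> carrier_mat N N" using E by simp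
  moreover have "z * y = y + (s \<cdot>\<^sub>m E + t \<cdot>\<^sub>m F) * y"
    unfolding z using add_mult_distrib_mat[OF one_carrier_mat sum y] y by simp
  moreover have "y * z = y + y * (s \<cdot>\<^sub>m E + t \<cdot>\<^sub>m F)"
    unfolding z using mult_add_distrib_mat[OF y one_carrier_mat sum] y by simp
  ultimately show ?thesis using eq by simp
qed

text \<open>U_i(t) is corrected by an upper triangular factor until it centralizes the normal form.
  Inside the outer blocks the correction is E_(i+1,i) under index reversal; at a boundary with the
  middle block it is found by comparing coefficients and uses d (d - c) = 0; inside the middle block
  nothing is corrected. When the two outer blocks touch, a diagonal entry must be rescaled, which is
  where 1 - t c appears.\<close>

lemma quadratic_nf_root:
  fixes c d :: "'a::field"
  assumes r: "2 * r \<le> N" and d: "d = 0 \<or> d = c" and i: "Suc i < N" and t: "1 - t * c \<noteq> 0"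
  shows "\<exists>b b'. upper_pair N b b' \<and>
    (b' * addrow_mat N t (Suc i) i) * quadratic_nf N r c d = quadratic_nf N r c d * (b' * addrow_mat N t (Suc i) i)"
proof -
  let ?L = "addrow_mat N t (Suc i) i" and ?E = "mat_unit N :: nat \<Rightarrow> nat \<Rightarrow> 'a mat" and ?y = "quadratic_nf N r c d"
  have Lc: "?L \<in> carrier_mat N N" by simp
  have up: "upper_pair N (addrow_mat N (- s) k l) (addrow_mat N s k l)" if "k < l" "l < N" for s :: 'a and k l
    using addrow_mat_inv[of k N l "- s"] that by (auto simp: upper_pair_def upper_triangular_def)
  have case_addrow: ?thesis
    if kl: "k < l" "l < N" "l \<noteq> Suc i" and eq: "s \<cdot>\<^sub>m (?E k l * ?y) + t \<cdot>\<^sub>m (?E (Suc i) i * ?y) =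
      s \<cdot>\<^sub>m (?y * ?E k l) + t \<cdot>\<^sub>m (?y * ?E (Suc i) i)" for k l s
  proof -
    have "addrow_mat N s k l * ?L = addrow s k l ?L"
      by (rule addrow_mat[symmetric, OF Lc kl(2)])
    also have "\<dots> = 1\<^sub>m N + (s \<cdot>\<^sub>m ?E k l + t \<cdot>\<^sub>m ?E (Suc i) i)"
      using kl by (intro eq_matI) (auto simp: mat_unit_def)
    finally have "(addrow_mat N s k l * ?L) * ?y = ?y * (addrow_mat N s k l * ?L)"
      by (intro one_plus_units_commute[OF _ _ _ _ eq]) auto
    then show ?thesis using up[OF kl(1,2)] by blast
  qed
  have iN: "i < N" using i by simp
  note E = mat_unit_mult_nf[OF r] nf_mult_mat_unit[OF r]
  consider (mirror) "Suc i < r \<or> N - r \<le> i" | (left) "Suc i = r" "r < N - r" | (middle) "r \<le> i" "Suc i < N - r"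
    | (right) "r \<le> i" "Suc i = N - r" | (centre) "Suc i = r" "N = 2 * r"
    using r by linarith
  then show ?thesis
  proof cases
    case mirror
    define k l where "k = N - 2 - i" and "l = N - 1 - i"
    have kl: "k < l" "l < N" "l \<noteq> Suc i" "k < N" "N - 1 - Suc i = k" "N - 1 - i = l" "N - 1 - k = Suc i" "N - 1 - l = i"
      using mirror r i by (auto simp: k_def l_def)
    show ?thesis
    proof (rule case_addrow[OF kl(1-3), of t])
      show "t \<cdot>\<^sub>m (?E k l * ?y) + t \<cdot>\<^sub>m (?E (Suc i) i * ?y) = t \<cdot>\<^sub>m (?y * ?E k l) + t \<cdot>\<^sub>m (?y * ?E (Suc i) i)"
        using mirror
      proof
        assume a: "Suc i < r"
        then have "N - r \<le> k" "\<not> k < r" "\<not> k < N - r" "\<not> l < r" "\<not> l < N - r"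
          using r i by (auto simp: k_def l_def)
        then show ?thesis
          unfolding E[OF kl(4,2)] E[OF i iN] kl using a by (intro eq_matI) (auto simp: algebra_simps)
      next
        assume a: "N - r \<le> i"
        then have "k < r" "l < r" "\<not> i < r" "\<not> i < N - r" "\<not> Suc i < r" "\<not> Suc i < N - r"
          using r i by (auto simp: k_def l_def)
        then show ?thesis
          unfolding E[OF kl(4,2)] E[OF i iN] kl by (intro eq_matI) (auto simp: algebra_simps)
      qed
    qed
  next
    case left
    define l where "l = N - 1 - i"
    have l: "Suc i < l" "l < N" "l \<noteq> Suc i" "N - 1 - i = l" "N - 1 - l = i"
      and c: "i < r" "\<not> Suc i < r" "Suc i < N - r" "\<not> l < r" "\<not> l < N - r"
      using left r i by (auto simp: l_def)
    show ?thesis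
    \<comment> \<open>E_(i+1,l) y contains E_(i+1,i) with coefficient 1, and this must match y
      E_(i+1,i) = d E_(i+1,i), hence the coefficient t d.\<close>
    proof (rule case_addrow[OF l(1-3), of "t * d"])
      show "(t * d) \<cdot>\<^sub>m (?E (Suc i) l * ?y) + t \<cdot>\<^sub>m (?E (Suc i) i * ?y) =
          (t * d) \<cdot>\<^sub>m (?y * ?E (Suc i) l) + t \<cdot>\<^sub>m (?y * ?E (Suc i) i)"
        unfolding E[OF i l(2)] E[OF i iN] l using c d by (intro eq_matI) (auto simp: algebra_simps)
    qed
  next
    case middle
    have L: "?L = 1\<^sub>m N + (0 \<cdot>\<^sub>m ?E (Suc i) i + t \<cdot>\<^sub>m ?E (Suc i) i)"
      by (intro eq_matI) (auto simp: mat_unit_def)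
    have "?L * ?y = ?y * ?L"
      by (rule one_plus_units_commute[OF _ _ _ L]) (use middle in \<open>auto simp: E[OF i iN]\<close>)
    then show ?thesis
      by (intro exI[of _ "1\<^sub>m N"]) (simp add: upper_pair_def)
  next
    case right
    define k where "k = N - 2 - i"
    have k: "k < i" "i \<noteq> Suc i" "k < N" "N - 1 - Suc i = k" "N - 1 - k = Suc i"
      and c: "k < r" "\<not> i < r" "i < N - r" "\<not> Suc i < r" "\<not> Suc i < N - r"
      using right r i by (auto simp: k_def)
    show ?thesis
    \<comment> \<open>y E_(k,i) = E_(i+1,i) absorbs the mismatch t (d - c) between the two products
      of E_(i+1,i) with y.\<close>
    proof (rule case_addrow[OF k(1) iN k(2), of "- t * (c - d)"])
      show "(- t * (c - d)) \<cdot>\<^sub>m (?E k i * ?y) + t \<cdot>\<^sub>m (?E (Suc i) i * ?y) =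
          (- t * (c - d)) \<cdot>\<^sub>m (?y * ?E k i) + t \<cdot>\<^sub>m (?y * ?E (Suc i) i)"
        unfolding E[OF k(3) iN] E[OF i iN] k using c d by (intro eq_matI) (auto simp: algebra_simps)
    qed
  next
    case centre
    \<comment> \<open>Solves w - 1 = w t c, the condition on the coefficient of E_(i+1,i).\<close>
    let ?w = "inverse (1 - t * c)"
    let ?b = "multrow_mat N (Suc i) (1 - t * c)" and ?b' = "multrow_mat N (Suc i) ?w"
    have "upper_pair N ?b ?b'"
      using multrow_mat_inv[OF i t] by (auto simp: upper_pair_def upper_triangular_def)
    moreover have "?b' * ?L = multrow (Suc i) ?w ?L"
      by (rule multrow_mat[symmetric, OF Lc])
    then have z: "?b' * ?L = 1\<^sub>m N + ((?w - 1) \<cdot>\<^sub>m ?E (Suc i) (Suc i) + (?w * t) \<cdot>\<^sub>m ?E (Suc i) i)"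
      by (auto intro!: eq_matI simp: mat_unit_def)
    have c: "i < r" "\<not> Suc i < r" "\<not> Suc i < N - r" "N - 1 - Suc i = i" using centre by auto
    have w: "?w - 1 = ?w * t * c" using t by (simp add: field_simps)
    have "(?b' * ?L) * ?y = ?y * (?b' * ?L)"
    proof (rule one_plus_units_commute[OF _ _ _ z])
      show "(?w - 1) \<cdot>\<^sub>m (?E (Suc i) (Suc i) * ?y) + (?w * t) \<cdot>\<^sub>m (?E (Suc i) i * ?y) =
          (?w - 1) \<cdot>\<^sub>m (?y * ?E (Suc i) (Suc i)) + (?w * t) \<cdot>\<^sub>m (?y * ?E (Suc i) i)"
        unfolding E[OF i i] E[OF i iN] c(4) w using c by (intro eq_matI) (auto simp: algebra_simps)
    qed auto
    ultimately show ?thesis by blast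
  qed
qed

lemma spherical_class_nf:
  fixes x :: "'a::alg_closed_field mat"
  assumes N: "N > 0" and r: "2 * r \<le> N" and d: "d = 0 \<or> d = c"
    and sim: "similar_mat x (quadratic_nf N r c d + a \<cdot>\<^sub>m 1\<^sub>m N)"
  shows "spherical_class N (conj_class (SL N) x)"
proof (rule spherical_class_if_upper_dense[OF N _ similar_mat_sym[OF sim]])
  fix i assume i: "Suc i < N"
  have com: "z * (quadratic_nf N r c d + a \<cdot>\<^sub>m 1\<^sub>m N) = (quadratic_nf N r c d + a \<cdot>\<^sub>m 1\<^sub>m N) * z"
    if z: "z \<in> carrier_mat N N" and *: "z * quadratic_nf N r c d = quadratic_nf N r c d * z" for z :: "'a mat"
  proof -
    have "z * (quadratic_nf N r c d + a \<cdot>\<^sub>m 1\<^sub>m N) = z * quadratic_nf N r c d + a \<cdot>\<^sub>m z"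
      using z mult_add_distrib_mat[OF z quadratic_nf_carrier, of "a \<cdot>\<^sub>m 1\<^sub>m N"]
        mult_smult_distrib[OF z one_carrier_mat[of N], of a] by simp
    moreover have "(quadratic_nf N r c d + a \<cdot>\<^sub>m 1\<^sub>m N) * z = quadratic_nf N r c d * z + a \<cdot>\<^sub>m z"
      using z add_mult_distrib_mat[OF quadratic_nf_carrier _ z, of "a \<cdot>\<^sub>m 1\<^sub>m N"]
        mult_smult_assoc_mat[OF one_carrier_mat[of N] z, of a] by simp
    ultimately show ?thesis using * by simp
  qed
  show "\<exists>c'. \<forall>t. 1 - t * c' \<noteq> 0 \<longrightarrow> (\<exists>b b'. upper_pair N b b' \<and>
      (b' * addrow_mat N t (Suc i) i) * (quadratic_nf N r c d + a \<cdot>\<^sub>m 1\<^sub>m N) =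
      (quadratic_nf N r c d + a \<cdot>\<^sub>m 1\<^sub>m N) * (b' * addrow_mat N t (Suc i) i))"
  proof (intro exI[of _ c] allI impI)
    fix t assume "1 - t * c \<noteq> 0"
    then obtain b b' where b: "upper_pair N b b'" and
      "(b' * addrow_mat N t (Suc i) i) * quadratic_nf N r c d = quadratic_nf N r c d * (b' * addrow_mat N t (Suc i) i)"
      using quadratic_nf_root[OF r d i] by blast
    then show "\<exists>b b'. upper_pair N b b' \<and>
      (b' * addrow_mat N t (Suc i) i) * (quadratic_nf N r c d + a \<cdot>\<^sub>m 1\<^sub>m N) =
      (quadratic_nf N r c d + a \<cdot>\<^sub>m 1\<^sub>m N) * (b' * addrow_mat N t (Suc i) i)"
      using com[OF mult_carrier_mat[OF upper_pairD(2)[OF b] addrow_mat_carrier]] by blast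
  qed
qed simp

text \<open>A direct sum in disguise: the block with rows (0, 0) and (1, c) sits on the outer
  indices 0 and n + 1, and \<open>M\<close> on those between. Nesting preserves the antidiagonal
  shape, so bordering a normal form raises r by 1.\<close>

definition bordered :: "nat \<Rightarrow> 'a::field \<Rightarrow> 'a mat \<Rightarrow> 'a mat" where
  "bordered n c M = mat (n + 2) (n + 2) (\<lambda>(a, b).
     if a = n + 1 then (if b = 0 then 1 else if b = n + 1 then c else 0)
     else if 0 < a \<and> 0 < b \<and> b \<le> n then M $$ (a - 1, b - 1) else 0)"

lemma bordered_quadratic_nf:
  assumes r: "2 * r \<le> n"
  shows "bordered n c (quadratic_nf n r c d) = quadratic_nf (n + 2) (r + 1) c d"
proof (rule eq_matI)
  fix a b assume "a < dim_row (quadratic_nf (n + 2) (r + 1) c d)" "b < dim_col (quadratic_nf (n + 2) (r + 1) c d)"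
  then have ab: "a < n + 2" "b < n + 2" by (auto simp: quadratic_nf_def)
  consider "a = n + 1" | "a = 0" | a' where "a = Suc a'" "a' < n"
    using ab by (cases a) force+
  then show "bordered n c (quadratic_nf n r c d) $$ (a, b) = quadratic_nf (n + 2) (r + 1) c d $$ (a, b)"
  proof cases
    case 1
    then show ?thesis using ab by (simp add: bordered_def quadratic_nf_def)
  next
    case 2
    then show ?thesis using ab r by (simp add: bordered_def quadratic_nf_def)
  next
    case (3 a')
    have le: "Suc n - r \<le> Suc k \<longleftrightarrow> n - r \<le> k" for k using r by linarith
    consider "b = n + 1" | "b = 0" | b' where "b = Suc b'" "b' < n"
      using ab by (cases b) force+
    then show ?thesis
    proof cases
      case (3 b')
      then show ?thesis using \<open>a = _\<close> \<open>a' < n\<close> ab unfolding quadratic_nf_def bordered_def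
        by (simp add: le)
    qed (use 3 ab r in \<open>simp_all add: bordered_def quadratic_nf_def\<close>)
  qed
qed (auto simp: bordered_def quadratic_nf_def)

text \<open>The outer block of \<open>bordered\<close> with its two basis vectors in reverse order;
  for c = 0 it is the nilpotent Jordan block of size 2.\<close>

definition cyclic_block :: "'a::field \<Rightarrow> 'a mat" where
  "cyclic_block c = mat 2 2 (\<lambda>(a, b). if a = 0 then (if b = 0 then c else 1) else 0)"

lemma similar_bordered:
  fixes M :: "'a::field mat"
  assumes M: "M \<in> carrier_mat n n"
  shows "similar_mat (four_block_mat (cyclic_block c) (0\<^sub>m 2 n) (0\<^sub>m n 2) M) (bordered n c M)"
proof -
  \<comment> \<open>The new order of the indices is n + 1, 0, 1, ..., n.\<close>
  define \<pi> where "\<pi> a = (if a = 0 then n + 1 else if a = 1 then 0 else if a < n + 2 then a - 1 else a)" for a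
  define \<pi>' where "\<pi>' a = (if a = n + 1 then 0 else if a = 0 then 1 else a + 1)" for a
  have "bij_betw \<pi> {..<n + 2} {..<n + 2}"
    by (rule bij_betw_byWitness[of _ \<pi>']) (auto simp: \<pi>_def \<pi>'_def)
  then have p: "\<pi> permutes {..<n + 2}"
    by (rule bij_imp_permutes) (auto simp: \<pi>_def)
  have "four_block_mat (cyclic_block c) (0\<^sub>m 2 n) (0\<^sub>m n 2) M = mat (n + 2) (n + 2) (\<lambda>(a, b). bordered n c M $$ (\<pi> a, \<pi> b))"
  proof (rule eq_matI)
    fix a b assume "a < dim_row (mat (n + 2) (n + 2) (\<lambda>(a, b). bordered n c M $$ (\<pi> a, \<pi> b)))"
      "b < dim_col (mat (n + 2) (n + 2) (\<lambda>(a, b). bordered n c M $$ (\<pi> a, \<pi> b)))"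
    then have ab: "a < n + 2" "b < n + 2" by auto
    have "a = 0 \<or> a = 1 \<or> (\<exists>a'<n. a = a' + 2)" "b = 0 \<or> b = 1 \<or> (\<exists>b'<n. b = b' + 2)"
      using ab by presburger+
    then show "four_block_mat (cyclic_block c) (0\<^sub>m 2 n) (0\<^sub>m n 2) M $$ (a, b) =
        mat (n + 2) (n + 2) (\<lambda>(a, b). bordered n c M $$ (\<pi> a, \<pi> b)) $$ (a, b)"
      using M by (elim disjE exE conjE) (simp_all add: bordered_def cyclic_block_def \<pi>_def)
  qed (use M in \<open>auto simp: cyclic_block_def\<close>)
  then show ?thesis
    using similar_mat_permute[OF _ p, of "bordered n c M"] by (simp add: bordered_def)
qed

lemma similar_bordered_mono:
  fixes M :: "'a::field mat"
  assumes "similar_mat M M'" and M: "M \<in> carrier_mat n n"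
  shows "similar_mat (bordered n c M) (bordered n c M')"
proof -
  have M': "M' \<in> carrier_mat n n" by (rule similar_mat_carrier[OF similar_mat_sym[OF assms(1)] M])
  have K: "cyclic_block c \<in> carrier_mat 2 2" by (simp add: cyclic_block_def)
  have "similar_mat (four_block_mat (cyclic_block c) (0\<^sub>m 2 n) (0\<^sub>m n 2) M) (four_block_mat (cyclic_block c) (0\<^sub>m 2 n) (0\<^sub>m n 2) M')"
    by (rule similar_mat_four_block_0_0[OF similar_mat_refl[OF K] assms(1) K M])
  then show ?thesis
    using similar_bordered[OF M, of c] similar_bordered[OF M', of c] similar_mat_sym similar_mat_trans by meson
qed

lemma scalar_quadratic_nf: "quadratic_nf N 0 c d = d \<cdot>\<^sub>m 1\<^sub>m N"
  by (rule eq_matI) (auto simp: quadratic_nf_def)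

lemma similar_square:
  fixes X :: "'a::field mat"
  assumes X: "X \<in> carrier_mat N N" and sq: "X * X = c \<cdot>\<^sub>m X" and sim: "similar_mat Y X"
  shows "Y * Y = c \<cdot>\<^sub>m Y"
proof -
  obtain P Q where wit: "similar_mat_wit Y X P Q" using sim unfolding similar_mat_def by blast
  note PQ = similar_mat_witD2[OF similar_mat_carrier[OF sim X] wit]
  have "Y * Y = P * (X * ((Q * P) * (X * Q)))"
    unfolding PQ(3) using PQ(6,7) X by (simp add: mat_assoc[where N = N])
  also have "\<dots> = P * (X * X) * Q"
    unfolding PQ(2) using PQ(6,7) X by (simp add: mat_assoc[where N = N])
  also have "\<dots> = c \<cdot>\<^sub>m Y"
    unfolding sq PQ(3) using PQ(6,7) X by (simp add: mult_smult_distrib[of _ N N _ N] mult_smult_assoc_mat[of _ N N _ N])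
  finally show ?thesis .
qed

text \<open>If \<open>X\<close> is not scalar, some conjugate \<open>W\<close> has lower left entry 1. Then \<open>e\<^sub>0\<close> and \<open>W e\<^sub>0\<close> span an
  invariant plane, and the vectors \<open>w\<close> for which \<open>w\<close> and \<open>W w\<close> have last coordinate 0 form an invariant
  complement of dimension \<open>N - 2\<close>, to which the induction hypothesis applies.\<close>

lemma similar_quadratic_nf:
  fixes X :: "'a::field mat"
  assumes "X \<in> carrier_mat N N" and "X * X = c \<cdot>\<^sub>m X"
  shows "\<exists>r d. 2 * r \<le> N \<and> (d = 0 \<or> d = c) \<and> similar_mat X (quadratic_nf N r c d)"
  using assms
proof (induction N arbitrary: X rule: less_induct)
  case (less N)
  note X = less.prems(1) and sq = less.prems(2)
  show ?case
  proof (cases "\<exists>s. X = s \<cdot>\<^sub>m 1\<^sub>m N")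
    case True
    then obtain s where s: "X = s \<cdot>\<^sub>m 1\<^sub>m N" by blast
    show ?thesis
    proof (cases "N = 0")
      case True
      then have "X = quadratic_nf N 0 c 0" using X by (intro eq_matI) (auto simp: quadratic_nf_def)
      then show ?thesis using similar_mat_refl[OF X] by (intro exI[of _ 0] exI[of _ 0]) simp
    next
      case False
      have "(X * X) $$ (0, 0) = s * s"
      proof -
        have "X * X = s \<cdot>\<^sub>m (1\<^sub>m N * X)"
          using X mult_smult_assoc_mat[of "1\<^sub>m N" N N X N s] by (simp add: s)
        then show ?thesis using False by (simp add: s)
      qed
      moreover have "(c \<cdot>\<^sub>m X) $$ (0, 0) = c * s" using False by (simp add: s)
      ultimately have "s = 0 \<or> s = c" using sq by auto
      then show ?thesis using similar_mat_refl[OF X] s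
        by (intro exI[of _ 0] exI[of _ s]) (simp add: scalar_quadratic_nf)
    qed
  next
    case ns: False
    have N2: "N \<ge> 2"
    proof (rule ccontr)
      assume "\<not> N \<ge> 2"
      then have "i = 0" if "i < N" for i using that by auto
      then have "X = X $$ (0, 0) \<cdot>\<^sub>m 1\<^sub>m N" using X by (intro eq_matI) auto
      then show False using ns by blast
    qed
    define n where "n = N - 2"
    have N: "N = n + 2" using N2 by (simp add: n_def)
    have lt: "n + 1 < N" "0 < N" "n + 1 \<noteq> 0" by (auto simp: N)
    obtain Z where Z: "similar_mat Z X" "Z $$ (n + 1, 0) \<noteq> 0"
      using similar_nonzero_entry[OF X _ lt] ns by blast
    have Zc: "Z \<in> carrier_mat N N" by (rule similar_mat_carrier[OF Z(1) X])
    define W where "W = mult_col_div_row (1 / Z $$ (n + 1, 0)) 0 Z"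
    have W: "W \<in> carrier_mat N N" using Zc by (simp add: W_def)
    have simW: "similar_mat W X"
      unfolding W_def using Z Zc lt(2) similar_mat_trans mult_col_div_row_similar by (metis divide_eq_0_iff zero_neq_one)
    have W1: "W $$ (n + 1, 0) = 1" using Zc lt Z(2) by (simp add: W_def)
    have sqW: "W * W = c \<cdot>\<^sub>m W" by (rule similar_square[OF X sq simW])
    \<comment> \<open>The new basis has e_0 first, W e_0 last and e_j - W_(n+1,j) e_0 between them;
      each of these middle vectors has last coordinate 0, and so has its image under
      \<open>W\<close>.\<close>
    define P where "P = mat N N (\<lambda>(a, b). if b = n + 1 then W $$ (a, 0) else if a = b then 1
      else if a = 0 then - W $$ (n + 1, b) else 0)"
    have P: "P \<in> carrier_mat N N" by (simp add: P_def)
    have "upper_triangular P" by (auto simp: upper_triangular_def P_def N)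
    moreover have "P $$ (a, a) \<noteq> 0" if "a < N" for a
      using that W1 by (auto simp: P_def)
    then have "0 \<notin> set (diag_mat P)" using P by (auto simp: diag_mat_def)
    ultimately have "det P \<noteq> 0" using upper_triangular_imp_det_eq_0_iff[OF P] by blast
    define Q where "Q = (1 / det P) \<cdot>\<^sub>m adj_mat P"
    have Q: "Q \<in> carrier_mat N N" using adj_mat(1)[OF P] by (simp add: Q_def)
    have "P * Q = (1 / det P * det P) \<cdot>\<^sub>m 1\<^sub>m N"
      unfolding Q_def mult_smult_distrib[OF P adj_mat(1)[OF P]] adj_mat(2)[OF P] by (intro eq_matI) auto
    then have PQ: "P * Q = 1\<^sub>m N" using \<open>det P \<noteq> 0\<close> by (auto intro!: eq_matI)
    have QP: "Q * P = 1\<^sub>m N" by (rule mat_mult_left_right_inverse[OF P Q PQ])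
    define Y where "Y = Q * W * P"
    have Y: "Y \<in> carrier_mat N N" using P Q W by (simp add: Y_def)
    have simY: "similar_mat Y X"
      using similar_mat_trans[OF _ simW, of Y] Q W P PQ QP
      unfolding Y_def by (metis (no_types) similar_matI[of _ W Q P N] Y Y_def empty_subsetI insert_subset)
    have sqY: "Y * Y = c \<cdot>\<^sub>m Y" by (rule similar_square[OF X sq simY])
    have ent: "(A * B) $$ (i, j) = (\<Sum>k<N. A $$ (i, k) * B $$ (k, j))"
      if "A \<in> carrier_mat N N" "B \<in> carrier_mat N N" "i < N" "j < N" for A B :: "'a mat" and i j
      using that by (simp add: scalar_prod_def atLeast0LessThan)
    have WP: "W * P \<in> carrier_mat N N" using W P by simp
    have Yent: "Y $$ (i, j) = (\<Sum>k<N. Q $$ (i, k) * (W * P) $$ (k, j))" if "i < N" "j < N" for i j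
      using ent[OF Q WP that] assoc_mult_mat[OF Q W P] by (simp add: Y_def)
    have WP0: "(W * P) $$ (k, 0) = P $$ (k, n + 1)" if "k < N" for k
    proof -
      have "(W * P) $$ (k, 0) = (\<Sum>l<N. if l = 0 then W $$ (k, l) else 0)"
        unfolding ent[OF W P that lt(2)] using lt by (intro sum.cong refl) (auto simp: P_def)
      then show ?thesis using that lt by (simp add: P_def)
    qed
    \<comment> \<open>The last basis vector is W e_0, and W (W e_0) = c W e_0 by the quadratic
      relation.\<close>
    have WPn: "(W * P) $$ (k, n + 1) = c * P $$ (k, n + 1)" if "k < N" for k
    proof -
      have "(W * P) $$ (k, n + 1) = (W * W) $$ (k, 0)"
        unfolding ent[OF W P that lt(1)] ent[OF W W that lt(2)] using lt by (intro sum.cong refl) (auto simp: P_def)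
      then show ?thesis using that W lt by (simp add: sqW P_def)
    qed
    have QPe: "(\<Sum>k<N. Q $$ (i, k) * P $$ (k, n + 1)) = (if i = n + 1 then 1 else 0)" if "i < N" for i
      using ent[OF Q P that lt(1)] that lt(1) unfolding QP by simp
    have Y0: "Y $$ (i, 0) = (if i = n + 1 then 1 else 0)" if "i < N" for i
      unfolding Yent[OF that lt(2)] QPe[OF that, symmetric] by (intro sum.cong refl) (simp add: WP0)
    have Yn: "Y $$ (i, n + 1) = (if i = n + 1 then c else 0)" if "i < N" for i
    proof -
      have "Y $$ (i, n + 1) = c * (\<Sum>k<N. Q $$ (i, k) * P $$ (k, n + 1))"
        unfolding Yent[OF that lt(1)] sum_distrib_left by (intro sum.cong refl) (simp add: WPn[simplified])
      then show ?thesis using QPe[OF that] by simp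
    qed
    have "P * Y = W * P"
    proof -
      have "P * Y = (P * Q) * (W * P)"
        using P Q W by (simp add: Y_def mat_assoc[where N = N])
      then show ?thesis unfolding PQ left_mult_one_mat[OF WP] .
    qed
    then have Ylast: "Y $$ (n + 1, j) = (W * P) $$ (n + 1, j)" if "j < N" for j
    proof -
      have "(P * Y) $$ (n + 1, j) = (\<Sum>k<N. if k = n + 1 then Y $$ (k, j) else 0)"
        unfolding ent[OF P Y lt(1) that] using lt W1 by (intro sum.cong refl) (auto simp: P_def)
      then show ?thesis using lt \<open>P * Y = W * P\<close> by simp
    qed
    have Ymid: "Y $$ (n + 1, j) = 0" if j: "0 < j" "j \<le> n" for j
    proof -
      have jN: "j < N" using j by (simp add: N)
      have "(W * P) $$ (n + 1, j) =
          (\<Sum>k<N. (if k = 0 then - W $$ (n + 1, j) else 0) + (if k = j then W $$ (n + 1, k) else 0))"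
        unfolding ent[OF W P lt(1) jN] using j W1 jN by (intro sum.cong refl) (auto simp: P_def)
      also have "\<dots> = 0" using lt jN by (simp add: sum.distrib)
      finally show ?thesis using Ylast[OF jN] by simp
    qed
    have Yrow: "Y $$ (n + 1, k) = (if k = 0 then 1 else if k = n + 1 then c else 0)" if "k < N" for k
      using Y0[OF lt(1)] Yn[OF lt(1)] Ymid[of k] that by (auto simp: N)
    \<comment> \<open>The last row of Y Y = c Y, computed from the known last row of
      \<open>Y\<close>, leaves exactly row 0 of \<open>Y\<close>, which must vanish.\<close>
    have Ytop: "Y $$ (0, j) = 0" if j: "j < N" for j
    proof -
      have "c * Y $$ (n + 1, j) = (Y * Y) $$ (n + 1, j)" using Y lt j by (simp add: sqY)
      also have "\<dots> = (\<Sum>k<N. (if k = 0 then Y $$ (k, j) else 0) + (if k = n + 1 then c * Y $$ (k, j) else 0))"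
        unfolding ent[OF Y Y lt(1) j] by (intro sum.cong refl) (auto simp: Yrow[simplified])
      also have "\<dots> = Y $$ (0, j) + c * Y $$ (n + 1, j)" using lt by (simp add: sum.distrib)
      finally show ?thesis by simp
    qed
    define M where "M = mat n n (\<lambda>(a, b). Y $$ (a + 1, b + 1))"
    have M: "M \<in> carrier_mat n n" by (simp add: M_def)
    have YM: "Y = bordered n c M"
    proof (rule eq_matI)
      fix a b assume "a < dim_row (bordered n c M)" "b < dim_col (bordered n c M)"
      then have ab: "a < N" "b < N" by (auto simp: bordered_def N)
      consider "a = n + 1" | "a = 0" | "0 < a" "a \<le> n" "b = 0" | "0 < a" "a \<le> n" "b = n + 1" | "0 < a" "a \<le> n" "0 < b" "b \<le> n"
        using ab N by linarith
      then show "Y $$ (a, b) = bordered n c M $$ (a, b)"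
        using ab Yrow[OF ab(2)] Ytop[OF ab(2)] Y0[OF ab(1)] Yn[OF ab(1)]
        by cases (simp_all add: bordered_def N M_def)
    qed (use Y in \<open>auto simp: bordered_def N\<close>)
    have "M * M = c \<cdot>\<^sub>m M"
    proof (rule eq_matI)
      fix a b assume "a < dim_row (c \<cdot>\<^sub>m M)" "b < dim_col (c \<cdot>\<^sub>m M)"
      then have ab: "a < n" "b < n" by (auto simp: M_def)
      then have abN: "a + 1 < N" "b + 1 < N" by (auto simp: N)
      have "(c \<cdot>\<^sub>m M) $$ (a, b) = (Y * Y) $$ (a + 1, b + 1)" using ab abN Y by (simp add: sqY M_def)
      also have "\<dots> = (\<Sum>k<Suc (Suc n). Y $$ (a + 1, k) * Y $$ (k, b + 1))"
        unfolding ent[OF Y Y abN] by (simp add: N)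
      also have "\<dots> = (\<Sum>k<n. Y $$ (a + 1, k + 1) * Y $$ (k + 1, b + 1))"
        unfolding sum.lessThan_Suc_shift[of _ "Suc n"] sum.lessThan_Suc[of _ n]
        using Y0[OF abN(1)] Yn[OF abN(1)] ab by simp
      also have "\<dots> = (M * M) $$ (a, b)" using ab by (simp add: M_def scalar_prod_def atLeast0LessThan)
      finally show "(M * M) $$ (a, b) = (c \<cdot>\<^sub>m M) $$ (a, b)" by simp
    qed (auto simp: M_def)
    then obtain r d where r: "2 * r \<le> n" "d = 0 \<or> d = c" "similar_mat M (quadratic_nf n r c d)"
      using less.IH[of n M] M by (auto simp: N)
    have "similar_mat Y (quadratic_nf N (r + 1) c d)"
      using similar_bordered_mono[OF r(3) M, of c] bordered_quadratic_nf[OF r(1), of c d] by (simp add: YM N)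
    then have "similar_mat X (quadratic_nf N (r + 1) c d)"
      using similar_mat_trans[OF similar_mat_sym[OF simY]] by blast
    then show ?thesis using r(1,2) by (intro exI[of _ "r + 1"] exI[of _ d]) (auto simp: N)
  qed
qed

lemma similar_mat_add_scalar:
  fixes A B :: "'a::field mat"
  assumes sim: "similar_mat A B" and B: "B \<in> carrier_mat N N"
  shows "similar_mat (A + a \<cdot>\<^sub>m 1\<^sub>m N) (B + a \<cdot>\<^sub>m 1\<^sub>m N)"
proof -
  have A: "A \<in> carrier_mat N N" by (rule similar_mat_carrier[OF sim B])
  obtain P Q where wit: "similar_mat_wit A B P Q" using sim unfolding similar_mat_def by blast
  note PQ = similar_mat_witD2[OF A wit]
  have "P * (B + a \<cdot>\<^sub>m 1\<^sub>m N) * Q = (P * B + a \<cdot>\<^sub>m P) * Q"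
    using mult_add_distrib_mat[OF PQ(6) B, of "a \<cdot>\<^sub>m 1\<^sub>m N"] mult_smult_distrib[OF PQ(6) one_carrier_mat, of a] PQ(6) by simp
  also have "\<dots> = P * B * Q + a \<cdot>\<^sub>m (P * Q)"
    using add_mult_distrib_mat[of "P * B" N N "a \<cdot>\<^sub>m P" Q N] mult_smult_assoc_mat[OF PQ(6,7), of a] PQ(6,7) B by simp
  finally have "A + a \<cdot>\<^sub>m 1\<^sub>m N = P * (B + a \<cdot>\<^sub>m 1\<^sub>m N) * Q" using PQ(1,3) by simp
  then show ?thesis
    using A B PQ by (intro similar_matI[of _ _ P Q N]) auto
qed

text \<open>The factor x - b is (x - a) - (b - a); the shift brings the relation to the form
  required by \<open>similar_quadratic_nf\<close>.\<close>

lemma quadratic_mat_shift: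
  fixes x :: "'a::field mat"
  assumes q: "quadratic_mat N a b x"
  shows "(x - a \<cdot>\<^sub>m 1\<^sub>m N) * (x - a \<cdot>\<^sub>m 1\<^sub>m N) = (b - a) \<cdot>\<^sub>m (x - a \<cdot>\<^sub>m 1\<^sub>m N)"
proof -
  let ?X = "x - a \<cdot>\<^sub>m 1\<^sub>m N"
  have x: "x \<in> carrier_mat N N" and 0: "?X * (x - b \<cdot>\<^sub>m 1\<^sub>m N) = 0\<^sub>m N N"
    using q by (auto simp: quadratic_mat_def)
  have X: "?X \<in> carrier_mat N N" using x by (simp add: minus_carrier_mat)
  have b: "x - b \<cdot>\<^sub>m 1\<^sub>m N = ?X - (b - a) \<cdot>\<^sub>m 1\<^sub>m N"
    using x by (intro eq_matI) (auto simp: algebra_simps)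
  have "?X * (x - b \<cdot>\<^sub>m 1\<^sub>m N) = ?X * ?X - (b - a) \<cdot>\<^sub>m ?X"
    unfolding b using mult_minus_distrib_mat[OF X X, of "(b - a) \<cdot>\<^sub>m 1\<^sub>m N"]
      mult_smult_distrib[OF X one_carrier_mat, of "b - a"] X by simp
  then have z: "?X * ?X - (b - a) \<cdot>\<^sub>m ?X = 0\<^sub>m N N" using 0 by simp
  show ?thesis
  proof (rule eq_matI)
    fix i j assume "i < dim_row ((b - a) \<cdot>\<^sub>m ?X)" "j < dim_col ((b - a) \<cdot>\<^sub>m ?X)"
    then have ij: "i < N" "j < N" by auto
    have "(?X * ?X - (b - a) \<cdot>\<^sub>m ?X) $$ (i, j) = 0" using z ij by simp
    then show "(?X * ?X) $$ (i, j) = ((b - a) \<cdot>\<^sub>m ?X) $$ (i, j)"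
      using ij X by (simp del: index_mult_mat(1))
  qed (use X in auto)
qed

lemma quadratic_mat_nf:
  fixes x :: "'a::field mat"
  assumes q: "quadratic_mat N a b x"
  obtains r d where "2 * r \<le> N" "d = 0 \<or> d = b - a"
    "similar_mat x (quadratic_nf N r (b - a) d + a \<cdot>\<^sub>m 1\<^sub>m N)"
proof -
  have x: "x \<in> carrier_mat N N" using q by (simp add: quadratic_mat_def)
  have X: "x - a \<cdot>\<^sub>m 1\<^sub>m N \<in> carrier_mat N N" using x by (simp add: minus_carrier_mat)
  obtain r d where r: "2 * r \<le> N" "d = 0 \<or> d = b - a" "similar_mat (x - a \<cdot>\<^sub>m 1\<^sub>m N) (quadratic_nf N r (b - a) d)"
    using similar_quadratic_nf[OF X quadratic_mat_shift[OF q]] by blast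
  have "x = (x - a \<cdot>\<^sub>m 1\<^sub>m N) + a \<cdot>\<^sub>m 1\<^sub>m N" using x by (intro eq_matI) auto
  then show ?thesis
    using that[OF r(1,2)] similar_mat_add_scalar[OF r(3) quadratic_nf_carrier, of a] by simp
qed

theorem spherical_class_iff_quadratic:
  fixes x :: "'a::alg_closed_field mat"
  assumes "(2 :: 'a) \<noteq> 0" and N: "N > 0" and x: "x \<in> carrier_mat N N"
  shows "spherical_class N (conj_class (SL N) x) \<longleftrightarrow> (\<exists>a b. quadratic_mat N a b x)"
proof
  assume "\<exists>a b. quadratic_mat N a b x"
  then obtain a b where "quadratic_mat N a b x" by blast
  then show "spherical_class N (conj_class (SL N) x)"
    using quadratic_mat_nf spherical_class_nf[OF N] by metis
qed (rule spherical_class_quadratic[OF assms])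

lemma similar_mat_quadratic:
  fixes x :: "'a::field mat"
  assumes q: "quadratic_mat N a b x" and sim: "similar_mat y x"
  shows "quadratic_mat N a b y"
proof -
  have x: "x \<in> carrier_mat N N" using q by (simp add: quadratic_mat_def)
  have y: "y \<in> carrier_mat N N" by (rule similar_mat_carrier[OF sim x])
  have X: "x + (- a) \<cdot>\<^sub>m 1\<^sub>m N \<in> carrier_mat N N" using x by simp
  have minus: "z + (- a) \<cdot>\<^sub>m 1\<^sub>m N = z - a \<cdot>\<^sub>m 1\<^sub>m N" if "z \<in> carrier_mat N N" for z
    using that by (intro eq_matI) auto
  have Y: "y - a \<cdot>\<^sub>m 1\<^sub>m N \<in> carrier_mat N N" using y by (simp add: minus_carrier_mat)
  have "(y - a \<cdot>\<^sub>m 1\<^sub>m N) * (y - a \<cdot>\<^sub>m 1\<^sub>m N) = (b - a) \<cdot>\<^sub>m (y - a \<cdot>\<^sub>m 1\<^sub>m N)"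
    using similar_square[OF X _ similar_mat_add_scalar[OF sim x, of "- a"], of "b - a"]
      quadratic_mat_shift[OF q] by (simp add: minus[OF x] minus[OF y])
  moreover have b: "y - b \<cdot>\<^sub>m 1\<^sub>m N = (y - a \<cdot>\<^sub>m 1\<^sub>m N) - (b - a) \<cdot>\<^sub>m 1\<^sub>m N"
    using y by (intro eq_matI) (auto simp: algebra_simps)
  moreover have "(y - a \<cdot>\<^sub>m 1\<^sub>m N) * (y - b \<cdot>\<^sub>m 1\<^sub>m N) =
      (y - a \<cdot>\<^sub>m 1\<^sub>m N) * (y - a \<cdot>\<^sub>m 1\<^sub>m N) - (b - a) \<cdot>\<^sub>m (y - a \<cdot>\<^sub>m 1\<^sub>m N)"
    unfolding b using mult_minus_distrib_mat[OF Y Y, of "(b - a) \<cdot>\<^sub>m 1\<^sub>m N"]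
      mult_smult_distrib[OF Y one_carrier_mat, of "b - a"] Y by simp
  ultimately have "(y - a \<cdot>\<^sub>m 1\<^sub>m N) * (y - b \<cdot>\<^sub>m 1\<^sub>m N) = 0\<^sub>m N N"
    by (simp, intro eq_matI) auto
  then show ?thesis using y by (simp add: quadratic_mat_def)
qed

section \<open>Semisimple, unipotent and symmetric classes\<close>

text \<open>Cayley-Hamilton in size 2; it settles the case n = 1.\<close>

lemma quadratic_mat_2:
  fixes x :: "'a::alg_closed_field mat"
  assumes x: "x \<in> carrier_mat 2 2"
  shows "\<exists>a b. quadratic_mat 2 a b x"
proof (rule quadratic_matI[OF x])
  let ?tr = "x $$ (0, 0) + x $$ (1, 1)" and ?det = "x $$ (0, 0) * x $$ (1, 1) - x $$ (0, 1) * x $$ (1, 0)"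
  show "(- ?tr) \<cdot>\<^sub>m x + 1 \<cdot>\<^sub>m (x * x) = (- ?det) \<cdot>\<^sub>m 1\<^sub>m 2"
    using x by (intro eq_matI) (auto simp: scalar_prod_def numeral_2_eq_2 less_Suc_eq algebra_simps)
qed simp

text \<open>On an eigenvector for k the relation becomes (k - b) (k - a) = 0.\<close>

lemma spectrum_quadratic:
  fixes x :: "'a::field mat"
  assumes q: "quadratic_mat N a b x"
  shows "spectrum x \<subseteq> {a, b}"
proof
  fix k assume "k \<in> spectrum x"
  have x: "x \<in> carrier_mat N N" and 0: "(x - a \<cdot>\<^sub>m 1\<^sub>m N) * (x - b \<cdot>\<^sub>m 1\<^sub>m N) = 0\<^sub>m N N"
    using q by (auto simp: quadratic_mat_def)
  obtain v where v: "v \<in> carrier_vec N" "v \<noteq> 0\<^sub>v N" "x *\<^sub>v v = k \<cdot>\<^sub>v v"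
    using \<open>k \<in> spectrum x\<close> x unfolding spectrum_def eigenvalue_def eigenvector_def by auto
  have shift: "(x - e \<cdot>\<^sub>m 1\<^sub>m N) *\<^sub>v v = (k - e) \<cdot>\<^sub>v v" for e
  proof -
    have "(x - e \<cdot>\<^sub>m 1\<^sub>m N) *\<^sub>v v = x *\<^sub>v v - (e \<cdot>\<^sub>m 1\<^sub>m N) *\<^sub>v v"
      using x v(1) by (intro minus_mult_distrib_mat_vec) auto
    also have "(e \<cdot>\<^sub>m 1\<^sub>m N) *\<^sub>v v = e \<cdot>\<^sub>v v"
      using v(1) by (intro eq_vecI) auto
    finally show ?thesis unfolding v(3) using v(1) by (auto intro!: eq_vecI simp: algebra_simps)
  qed
  have "0\<^sub>v N = ((x - a \<cdot>\<^sub>m 1\<^sub>m N) * (x - b \<cdot>\<^sub>m 1\<^sub>m N)) *\<^sub>v v"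
    unfolding 0 using v(1) by (intro eq_vecI) auto
  also have "\<dots> = (x - a \<cdot>\<^sub>m 1\<^sub>m N) *\<^sub>v ((x - b \<cdot>\<^sub>m 1\<^sub>m N) *\<^sub>v v)"
    using x v(1) by (intro assoc_mult_mat_vec[of _ N N _ N]) (auto simp: minus_carrier_mat)
  also have "\<dots> = (k - b) \<cdot>\<^sub>v ((x - a \<cdot>\<^sub>m 1\<^sub>m N) *\<^sub>v v)"
    unfolding shift[of b] using x v(1) by (intro mult_mat_vec[of _ N N]) (auto simp: minus_carrier_mat)
  finally have "((k - b) * (k - a)) \<cdot>\<^sub>v v = 0\<^sub>v N" unfolding shift[of a] by (simp add: smult_smult_assoc)
  then have all: "(k - b) * (k - a) * v $ i = 0" if "i < N" for i
    using that v(1) by (metis carrier_vecD index_smult_vec(1) index_zero_vec(1))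
  obtain i where "i < N" "v $ i \<noteq> 0"
    using v(1,2) by (metis carrier_vecD eq_vecI index_zero_vec)
  with all[of i] show "k \<in> {a, b}" by auto
qed

lemma spectrum_similar:
  fixes A B :: "'a::field mat"
  assumes "similar_mat A B" "B \<in> carrier_mat N N"
  shows "spectrum A = spectrum B"
  using spectrum_root_char_poly[OF assms(2)] spectrum_root_char_poly[OF similar_mat_carrier[OF assms]]
    char_poly_similar[OF assms(1)] by simp

lemma diagonal_spectrum:
  fixes D :: "'a::field mat"
  assumes D: "D \<in> carrier_mat N N" "diagonal_mat D" and i: "i < N"
  shows "D $$ (i, i) \<in> spectrum D"
proof -
  have "D *\<^sub>v unit_vec N i = D $$ (i, i) \<cdot>\<^sub>v unit_vec N i"
    using D i by (intro eq_vecI) (auto simp: diagonal_mat_def)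
  moreover have "unit_vec N i \<noteq> (0\<^sub>v N :: 'a vec)"
    using i by (metis index_unit_vec(2) index_zero_vec(1) zero_neq_one)
  ultimately show ?thesis
    using D i unfolding spectrum_def eigenvalue_def eigenvector_def
    by (auto intro!: exI[of _ "unit_vec N i"])
qed

lemma semisimple_matD:
  assumes "semisimple_mat s" "s \<in> carrier_mat N N"
  obtains D where "D \<in> carrier_mat N N" "diagonal_mat D" "similar_mat s D"
    "\<And>i. i < N \<Longrightarrow> D $$ (i, i) \<in> spectrum s"
proof -
  obtain D where D: "diagonal_mat D" "similar_mat s D"
    using assms(1) unfolding semisimple_mat_def by blast
  have "D \<in> carrier_mat N N" by (rule similar_mat_carrier[OF similar_mat_sym[OF D(2)] assms(2)])
  then show ?thesis
    using that D diagonal_spectrum spectrum_similar by metis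
qed

lemma semisimple_quadratic:
  fixes s :: "'a::field mat"
  assumes ss: "semisimple_mat s" and s: "s \<in> carrier_mat N N" and sp: "spectrum s \<subseteq> {a, b}"
  shows "quadratic_mat N a b s"
proof -
  obtain D where D: "D \<in> carrier_mat N N" "diagonal_mat D" "similar_mat s D"
    "\<And>i. i < N \<Longrightarrow> D $$ (i, i) \<in> spectrum s"
    using semisimple_matD[OF ss s] by blast
  have "(D - a \<cdot>\<^sub>m 1\<^sub>m N) * (D - b \<cdot>\<^sub>m 1\<^sub>m N) = 0\<^sub>m N N"
  proof (rule eq_matI)
    fix i j assume "i < dim_row (0\<^sub>m N N :: 'a mat)" "j < dim_col (0\<^sub>m N N :: 'a mat)"
    then have ij: "i < N" "j < N" by auto
    have "((D - a \<cdot>\<^sub>m 1\<^sub>m N) * (D - b \<cdot>\<^sub>m 1\<^sub>m N)) $$ (i, j) =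
        (\<Sum>k = 0..<N. (D - a \<cdot>\<^sub>m 1\<^sub>m N) $$ (i, k) * (D - b \<cdot>\<^sub>m 1\<^sub>m N) $$ (k, j))"
      using ij D(1) by (simp add: scalar_prod_def)
    also have "\<dots> = 0"
    proof (rule sum.neutral, rule ballI)
      fix k assume "k \<in> {0..<N}"
      then have k: "k < N" by simp
      show "(D - a \<cdot>\<^sub>m 1\<^sub>m N) $$ (i, k) * (D - b \<cdot>\<^sub>m 1\<^sub>m N) $$ (k, j) = 0"
        using D(1,2) ij k D(4)[OF k] sp by (cases "i = k"; cases "k = j") (auto simp: diagonal_mat_def)
    qed
    finally show "((D - a \<cdot>\<^sub>m 1\<^sub>m N) * (D - b \<cdot>\<^sub>m 1\<^sub>m N)) $$ (i, j) = 0\<^sub>m N N $$ (i, j)" using ij by simp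
  qed (use D(1) in auto)
  then have "quadratic_mat N a b D" using D(1) by (simp add: quadratic_mat_def)
  then show ?thesis using similar_mat_quadratic D(3) by blast
qed

lemma semisimple_spherical_iff:
  fixes s :: "'a::alg_closed_field mat"
  assumes ss: "semisimple_mat s" and s: "s \<in> carrier_mat N N"
  shows "(\<exists>a b. quadratic_mat N a b s) \<longleftrightarrow> card (spectrum s) \<le> 2"
proof
  assume "\<exists>a b. quadratic_mat N a b s"
  then obtain a b where "spectrum s \<subseteq> {a, b}" using spectrum_quadratic by blast
  then have "card (spectrum s) \<le> card {a, b}" by (intro card_mono) auto
  also have "\<dots> \<le> 2" by (simp add: card_insert_if)
  finally show "card (spectrum s) \<le> 2" .
next
  assume c: "card (spectrum s) \<le> 2"
  have fin: "finite (spectrum s)" by (rule card_finite_spectrum(1)[OF s])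
  consider "card (spectrum s) = 0" | "card (spectrum s) = 1" | "card (spectrum s) = 2" using c by linarith
  then have "\<exists>a b. spectrum s \<subseteq> {a, b}"
    by cases (use fin in \<open>auto simp: card_1_singleton_iff card_2_iff\<close>)
  then show "\<exists>a b. quadratic_mat N a b s" using semisimple_quadratic[OF ss s] by blast
qed

text \<open>For j < r the vector e_j - (1/c) e_(N-1-j) lies in the kernel, and the remaining basis
  vectors are already eigenvectors. These columns form the lower unitriangular \<open>Z\<close>,
  whose inverse is its adjugate.\<close>

lemma quadratic_nf_semisimple:
  fixes c :: "'a::field"
  assumes r: "2 * r \<le> N" and c: "c \<noteq> 0"
  shows "semisimple_mat (quadratic_nf N r c d)"
proof -
  define Z where "Z = mat N N (\<lambda>(i, j). (if i = j then 1 else 0) + (if j < r \<and> i + j + 1 = N then - 1 / c else 0))"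
  define D where "D = mat N N (\<lambda>(i, j). if i = j then (if i < r then 0 else if i < N - r then d else c) else 0)"
  have Z: "Z \<in> carrier_mat N N" and D: "D \<in> carrier_mat N N" by (auto simp: Z_def D_def)
  have "quadratic_nf N r c d * Z = Z * D"
  proof (rule eq_matI)
    fix i j assume "i < dim_row (Z * D)" "j < dim_col (Z * D)"
    then have ij: "i < N" "j < N" by (auto simp: Z_def D_def)
    have "(Z * D) $$ (i, j) = (\<Sum>k = 0..<N. Z $$ (i, k) * D $$ (k, j))"
      using ij Z D by (simp add: scalar_prod_def)
    also have "\<dots> = (\<Sum>k = 0..<N. if k = j then Z $$ (i, k) * D $$ (k, j) else 0)"
      using ij by (intro sum.cong refl) (auto simp: D_def)
    finally have ZD: "(Z * D) $$ (i, j) = Z $$ (i, j) * D $$ (j, j)" using ij by simp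
    show "(quadratic_nf N r c d * Z) $$ (i, j) = (Z * D) $$ (i, j)"
    proof (cases "N - r \<le> i")
      case True
      define i' where "i' = N - 1 - i"
      have i': "i + i' + 1 = N" "i' < r" "r \<le> i" "i' < N" using True ij r by (auto simp: i'_def)
      have j: "j + i + 1 = N \<longleftrightarrow> j = i'" "j + i' + 1 = N \<longleftrightarrow> j = i" using i'(1) by auto
      have "Z $$ (i', j) = (if j = i' then 1 else 0)"
        using ij i'(2-4) j(2) by (simp add: Z_def add.commute)
      moreover have "Z $$ (i, j) = (if j = i then 1 else if j = i' then - 1 / c else 0)"
        using ij i'(2,3) j(1) by (simp add: Z_def add.commute)
      moreover have "D $$ (i, i) = c" "D $$ (i', i') = 0"
        using i'(2-4) ij True by (simp_all add: D_def)
      moreover have "i' \<noteq> i" using i' by linarith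
      ultimately show ?thesis
        unfolding quadratic_nf_mult_left[OF r Z ij] ZD i'_def[symmetric] using True c by simp
    next
      case False
      then have "Z $$ (i, j) = (if j = i then 1 else 0)" using ij r by (auto simp: Z_def)
      moreover have "D $$ (i, i) = (if r \<le> i then d else 0)" using False ij by (auto simp: D_def)
      ultimately show ?thesis
        unfolding quadratic_nf_mult_left[OF r Z ij] ZD using False by auto
    qed
  qed (auto simp: Z_def D_def quadratic_nf_def)
  moreover have "det Z = 1"
  proof -
    have "det Z = prod_list (diag_mat Z)"
      by (rule det_lower_triangular[OF _ Z]) (use r in \<open>auto simp: Z_def\<close>)
    also have "diag_mat Z = map (\<lambda>i. 1) [0..<N]"
      using r by (auto simp: diag_mat_def Z_def)
    finally show ?thesis by (simp add: map_replicate_const)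
  qed
  note Zi = adj_mat_special_linear[OF Z this]
  have "quadratic_nf N r c d * Z * adj_mat Z = quadratic_nf N r c d"
    using assoc_mult_mat[OF quadratic_nf_carrier Z Zi(1)] right_mult_one_mat[OF quadratic_nf_carrier]
    by (simp add: Zi(2))
  then have "quadratic_nf N r c d = Z * D * adj_mat Z"
    unfolding \<open>quadratic_nf N r c d * Z = Z * D\<close> by (rule sym)
  then have "similar_mat (quadratic_nf N r c d) D"
    using Z D Zi by (intro similar_matI[of _ _ Z "adj_mat Z" N]) auto
  moreover have "diagonal_mat D" by (simp add: D_def diagonal_mat_def)
  ultimately show ?thesis unfolding semisimple_mat_def by blast
qed

lemma quadratic_distinct_semisimple:
  fixes x :: "'a::field mat"
  assumes q: "quadratic_mat N a b x" and ab: "a \<noteq> b"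
  shows "semisimple_mat x"
proof -
  obtain r d where r: "2 * r \<le> N" and sim: "similar_mat x (quadratic_nf N r (b - a) d + a \<cdot>\<^sub>m 1\<^sub>m N)"
    using quadratic_mat_nf[OF q] by blast
  obtain D where D: "diagonal_mat D" "similar_mat (quadratic_nf N r (b - a) d) D"
    using quadratic_nf_semisimple[OF r] ab unfolding semisimple_mat_def by (metis right_minus_eq)
  have Dc: "D \<in> carrier_mat N N"
    by (rule similar_mat_carrier[OF similar_mat_sym[OF D(2)] quadratic_nf_carrier])
  have "similar_mat x (D + a \<cdot>\<^sub>m 1\<^sub>m N)"
    using similar_mat_trans[OF sim similar_mat_add_scalar[OF D(2) Dc]] .
  moreover have "diagonal_mat (D + a \<cdot>\<^sub>m 1\<^sub>m N)"
    using D(1) Dc by (auto simp: diagonal_mat_def)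
  ultimately show ?thesis unfolding semisimple_mat_def by blast
qed

text \<open>With a = b the normal form is lower triangular with constant diagonal. For a matrix of
  determinant 1 this gives a^N = 1, so the scalar matrix a lies in the group.\<close>

lemma quadratic_double_det:
  fixes x :: "'a::field mat"
  assumes q: "quadratic_mat N a a x"
  shows "det x = a ^ N"
proof -
  obtain r d where r: "2 * r \<le> N" and d: "d = 0 \<or> d = a - a"
    and "similar_mat x (quadratic_nf N r (a - a) d + a \<cdot>\<^sub>m 1\<^sub>m N)"
    using quadratic_mat_nf[OF q] by blast
  then have sim: "similar_mat x (quadratic_nf N r 0 0 + a \<cdot>\<^sub>m 1\<^sub>m N)" (is "similar_mat x ?A") by auto
  have A: "?A \<in> carrier_mat N N" by simp
  have "det ?A = prod_list (diag_mat ?A)"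
    by (rule det_lower_triangular[OF _ A]) (use r in \<open>auto simp: quadratic_nf_def\<close>)
  also have "diag_mat ?A = map (\<lambda>i. a) [0..<N]"
    using r by (auto simp: diag_mat_def quadratic_nf_def)
  finally show ?thesis using det_similar[OF sim] by (simp add: map_replicate_const)
qed

lemma quadratic_one_unipotent:
  fixes x :: "'a::field mat"
  assumes q: "quadratic_mat N 1 1 x"
  shows "unipotent_mat x"
proof -
  have x: "x \<in> carrier_mat N N" and "(x - 1 \<cdot>\<^sub>m 1\<^sub>m N) * (x - 1 \<cdot>\<^sub>m 1\<^sub>m N) = 0\<^sub>m N N"
    using q by (auto simp: quadratic_mat_def)
  moreover have "1 \<cdot>\<^sub>m 1\<^sub>m N = (1\<^sub>m N :: 'a mat)" by (intro eq_matI) auto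
  ultimately show ?thesis unfolding unipotent_mat_def
    by (intro exI[of _ 2]) (simp add: numeral_2_eq_2)
qed

text \<open>(u - 1)^m acts on an eigenvector for k as (k - 1)^m, and it is zero for some m.\<close>

lemma unipotent_spectrum:
  fixes u :: "'a::field mat"
  assumes un: "unipotent_mat u" and u: "u \<in> carrier_mat N N" and k: "k \<in> spectrum u"
  shows "k = 1"
proof -
  obtain m where m: "(u - 1\<^sub>m N) ^\<^sub>m m = 0\<^sub>m N N" using un u unfolding unipotent_mat_def by auto
  obtain v where v: "v \<in> carrier_vec N" "v \<noteq> 0\<^sub>v N" "u *\<^sub>v v = k \<cdot>\<^sub>v v"
    using k u unfolding spectrum_def eigenvalue_def eigenvector_def by auto
  have U: "u - 1\<^sub>m N \<in> carrier_mat N N" using u by (simp add: minus_carrier_mat)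
  have "(u - 1\<^sub>m N) *\<^sub>v v = u *\<^sub>v v - 1\<^sub>m N *\<^sub>v v"
    using u v(1) by (intro minus_mult_distrib_mat_vec) auto
  also have "\<dots> = (k - 1) \<cdot>\<^sub>v v" unfolding v(3) using v(1) by (auto intro!: eq_vecI simp: algebra_simps)
  finally have "eigenvector (u - 1\<^sub>m N) v (k - 1)"
    using v U u by (simp add: eigenvector_def)
  then have "(k - 1) ^ m \<cdot>\<^sub>v v = 0\<^sub>v N"
  proof -
    have "0\<^sub>m N N *\<^sub>v v = 0\<^sub>v N" using v(1) by (intro eq_vecI) auto
    then show ?thesis using eigenvector_pow[OF U \<open>eigenvector _ v _\<close>, of m] unfolding m by simp
  qed
  then have all: "(k - 1) ^ m * v $ i = 0" if "i < N" for i
    using that v(1) by (metis carrier_vecD index_smult_vec(1) index_zero_vec(1))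
  obtain i where "i < N" "v $ i \<noteq> 0"
    using v(1,2) by (metis carrier_vecD eq_vecI index_zero_vec)
  with all[of i] show ?thesis by auto
qed

text \<open>Distinct a and b would make \<open>u\<close> diagonalizable with 1 as its only
  eigenvalue, hence the identity. With a = b the matrix u - a has square zero, so a is an eigenvalue
  and equals 1.\<close>

lemma unipotent_quadratic:
  fixes u :: "'a::field mat"
  assumes un: "unipotent_mat u" and q: "quadratic_mat N a b u" and ne: "u \<noteq> 1\<^sub>m N" and N: "N > 0"
  shows "quadratic_mat N 1 1 u"
proof -
  have u: "u \<in> carrier_mat N N" using q by (simp add: quadratic_mat_def)
  have "a = b"
  proof (rule ccontr)
    assume "a \<noteq> b"
    then obtain D where D: "D \<in> carrier_mat N N" "diagonal_mat D" "similar_mat u D"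
      "\<And>i. i < N \<Longrightarrow> D $$ (i, i) \<in> spectrum u"
      using semisimple_matD[OF quadratic_distinct_semisimple[OF q] u] by blast
    have "D = 1\<^sub>m N"
      using D(1,2) unipotent_spectrum[OF un u D(4)] by (intro eq_matI) (auto simp: diagonal_mat_def)
    obtain P Q where wit: "similar_mat_wit u D P Q" using D(3) unfolding similar_mat_def by blast
    note PQ = similar_mat_witD2[OF u wit]
    have "u = 1\<^sub>m N" using PQ(1,3,6) \<open>D = 1\<^sub>m N\<close> by simp
    with ne show False by simp
  qed
  have "a = 1"
  proof (rule unipotent_spectrum[OF un u])
    let ?X = "u - a \<cdot>\<^sub>m 1\<^sub>m N"
    have X: "?X \<in> carrier_mat N N" using u by (simp add: minus_carrier_mat)
    have "?X * ?X = 0\<^sub>m N N" using q \<open>a = b\<close> by (simp add: quadratic_mat_def)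
    then have "det ?X * det ?X = 0" using det_mult[OF X X] N by (simp add: det_zero)
    moreover have "char_matrix u a = ?X" using u unfolding char_matrix_def by (intro eq_matI) auto
    ultimately show "a \<in> spectrum u" unfolding spectrum_def by (simp add: eigenvalue_det[OF u])
  qed
  then show ?thesis using q \<open>a = b\<close> by simp
qed

section \<open>Jordan types\<close>

lemma jordan_matrix_Cons:
  "jordan_matrix ((n, e) # n_as) = four_block_mat (jordan_block n e) (0\<^sub>m n (sum_list (map fst n_as)))
    (0\<^sub>m (sum_list (map fst n_as)) n) (jordan_matrix n_as)"
  using jordan_matrix_carrier[of n_as] by (simp add: jordan_matrix_def Let_def)

text \<open>Induction on r peels off the outer pair of indices as in \<open>bordered\<close>;
  shifted by a, \<open>cyclic_block 0\<close> is \<open>jordan_block 2 a\<close>.\<close>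

lemma quadratic_nf_jordan:
  fixes a :: "'a::field"
  assumes "2 * r \<le> N"
  shows "similar_mat (quadratic_nf N r 0 0 + a \<cdot>\<^sub>m 1\<^sub>m N)
    (jordan_matrix (replicate r (2, a) @ replicate (N - 2 * r) (1, a)))"
  using assms
proof (induction r arbitrary: N)
  case 0
  have "jordan_matrix (replicate N (1, a)) = a \<cdot>\<^sub>m 1\<^sub>m N"
  proof (induction N)
    case 0
    show ?case by (intro eq_matI) (auto simp: jordan_matrix_def)
  next
    case (Suc N)
    show ?case
      by (simp only: replicate_Suc jordan_matrix_Cons Suc) (intro eq_matI, auto simp: sum_list_replicate)
  qed
  then have "quadratic_nf N 0 0 0 + a \<cdot>\<^sub>m 1\<^sub>m N = jordan_matrix (replicate N (1, a))"
    by (auto intro!: eq_matI simp: scalar_quadratic_nf)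
  then show ?case using similar_mat_refl[of "a \<cdot>\<^sub>m 1\<^sub>m N" N] \<open>jordan_matrix _ = _\<close> by simp
next
  case (Suc r)
  define n where "n = N - 2"
  have N: "N = n + 2" and r: "2 * r \<le> n" using Suc.prems by (auto simp: n_def)
  let ?M = "quadratic_nf n r 0 0 :: 'a mat" and ?J = "replicate r (2, a) @ replicate (n - 2 * r) (1, a)"
  have K: "cyclic_block (0 :: 'a) \<in> carrier_mat 2 2" by (simp add: cyclic_block_def)
  have len: "sum_list (map fst ?J) = n"
    using r by (simp add: sum_list_replicate)
  have sim: "similar_mat (four_block_mat (cyclic_block 0) (0\<^sub>m 2 n) (0\<^sub>m n 2) ?M) (quadratic_nf N (Suc r) 0 0)"
    using similar_bordered[of ?M n 0] bordered_quadratic_nf[OF r, of "0 :: 'a" 0] by (simp add: N)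
  have 1: "similar_mat (four_block_mat (cyclic_block 0) (0\<^sub>m 2 n) (0\<^sub>m n 2) ?M + a \<cdot>\<^sub>m 1\<^sub>m N) (quadratic_nf N (Suc r) 0 0 + a \<cdot>\<^sub>m 1\<^sub>m N)"
    by (rule similar_mat_add_scalar[OF sim]) simp
  have 2: "four_block_mat (cyclic_block 0) (0\<^sub>m 2 n) (0\<^sub>m n 2) ?M + a \<cdot>\<^sub>m 1\<^sub>m N =
      four_block_mat (jordan_block 2 a) (0\<^sub>m 2 n) (0\<^sub>m n 2) (?M + a \<cdot>\<^sub>m 1\<^sub>m n)"
  proof (rule eq_matI)
    fix i j assume "i < dim_row (four_block_mat (jordan_block 2 a) (0\<^sub>m 2 n) (0\<^sub>m n 2) (?M + a \<cdot>\<^sub>m 1\<^sub>m n))"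
      "j < dim_col (four_block_mat (jordan_block 2 a) (0\<^sub>m 2 n) (0\<^sub>m n 2) (?M + a \<cdot>\<^sub>m 1\<^sub>m n))"
    then have ij: "i < n + 2" "j < n + 2" by auto
    have "i = 0 \<or> i = 1 \<or> (\<exists>i'<n. i = i' + 2)" "j = 0 \<or> j = 1 \<or> (\<exists>j'<n. j = j' + 2)"
      using ij by presburger+
    then show "(four_block_mat (cyclic_block 0) (0\<^sub>m 2 n) (0\<^sub>m n 2) ?M + a \<cdot>\<^sub>m 1\<^sub>m N) $$ (i, j) =
        four_block_mat (jordan_block 2 a) (0\<^sub>m 2 n) (0\<^sub>m n 2) (?M + a \<cdot>\<^sub>m 1\<^sub>m n) $$ (i, j)"
      by (elim disjE exE conjE)
        (simp_all add: cyclic_block_def jordan_block_def N carrier_matD[OF quadratic_nf_carrier])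
  qed (auto simp: cyclic_block_def N)
  have 3: "similar_mat (four_block_mat (jordan_block 2 a) (0\<^sub>m 2 n) (0\<^sub>m n 2) (?M + a \<cdot>\<^sub>m 1\<^sub>m n))
      (four_block_mat (jordan_block 2 a) (0\<^sub>m 2 n) (0\<^sub>m n 2) (jordan_matrix ?J))"
    by (rule similar_mat_four_block_0_0[OF similar_mat_refl[of _ 2] Suc.IH[OF r]]) auto
  have 4: "four_block_mat (jordan_block 2 a) (0\<^sub>m 2 n) (0\<^sub>m n 2) (jordan_matrix ?J) =
      jordan_matrix (replicate (Suc r) (2, a) @ replicate (N - 2 * Suc r) (1, a))"
    using len by (simp add: jordan_matrix_Cons N)
  show ?case
    using similar_mat_trans[OF similar_mat_sym[OF 1[unfolded 2]] 3] unfolding 4 .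
qed

text \<open>A Jordan block of size at most 2 with its eigenvalue subtracted squares to zero, and a
  block sum is squared blockwise.\<close>

lemma jordan_matrix_quadratic:
  assumes "\<And>n e. (n, e) \<in> set n_as \<Longrightarrow> n \<le> 2 \<and> e = (1 :: 'a::field)"
  shows "quadratic_mat (sum_list (map fst n_as)) 1 1 (jordan_matrix n_as)"
proof -
  let ?n = "\<lambda>n_as. sum_list (map fst n_as)"
  have "(jordan_matrix n_as - 1\<^sub>m (?n n_as)) * (jordan_matrix n_as - 1\<^sub>m (?n n_as)) = (0\<^sub>m (?n n_as) (?n n_as) :: 'a mat)"
    using assms
  proof (induction n_as)
    case Nil
    show ?case by (intro eq_matI) auto
  next
    case (Cons ne n_as)
    obtain n where ne: "ne = (n, 1)" and n: "n \<le> 2" using Cons.prems by (cases ne) auto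
    let ?m = "?n n_as"
    let ?B = "jordan_block n 1 - 1\<^sub>m n :: 'a mat" and ?J = "jordan_matrix n_as - 1\<^sub>m ?m :: 'a mat"
    have J: "jordan_matrix n_as \<in> (carrier_mat ?m ?m :: 'a mat set)" by simp
    have Jc: "?J \<in> carrier_mat ?m ?m" by (simp add: minus_carrier_mat)
    have Bc: "?B \<in> carrier_mat n n" by (simp add: minus_carrier_mat)
    have split: "jordan_matrix (ne # n_as) - 1\<^sub>m (?n (ne # n_as)) =
        four_block_mat ?B (0\<^sub>m n ?m) (0\<^sub>m ?m n) ?J"
      unfolding ne jordan_matrix_Cons using J by (intro eq_matI) auto
    have BB: "?B * ?B = 0\<^sub>m n n"
    proof (rule eq_matI)
      fix i j assume "i < dim_row (0\<^sub>m n n :: 'a mat)" "j < dim_col (0\<^sub>m n n :: 'a mat)"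
      then have ij: "i < n" "j < n" by auto
      have "?B $$ (i, k) * ?B $$ (k, j) = 0" if "k < n" for k
        using ij that n by (auto simp: jordan_block_def)
      then show "(?B * ?B) $$ (i, j) = 0\<^sub>m n n $$ (i, j)"
        using ij Bc by (simp add: scalar_prod_def del: index_minus_mat mult_eq_0_iff)
    qed auto
    have "?J * ?J = 0\<^sub>m ?m ?m" using Cons by auto
    then show ?case unfolding split
      using mult_four_block_mat[OF Bc zero_carrier_mat[of n ?m] zero_carrier_mat[of ?m n] Jc Bc zero_carrier_mat[of n ?m] zero_carrier_mat[of ?m n] Jc] BB Bc Jc
      by (simp add: ne)
  qed
  moreover have "1 \<cdot>\<^sub>m 1\<^sub>m k = (1\<^sub>m k :: 'a mat)" for k by (intro eq_matI) auto
  ultimately show ?thesis by (simp add: quadratic_mat_def)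
qed

lemma unipotent_jordan_type_iff:
  fixes u :: "'a::field mat"
  assumes un: "unipotent_mat u" and u: "u \<in> carrier_mat N N" and ne: "u \<noteq> 1\<^sub>m N" and N: "N > 0"
  shows "(\<exists>a b. quadratic_mat N a b u) \<longleftrightarrow>
    (\<exists>m\<in>{1..N div 2}. has_jordan_type u (replicate_mset m 2 + replicate_mset (N - 2 * m) 1))"
proof
  assume "\<exists>a b. quadratic_mat N a b u"
  then have q: "quadratic_mat N 1 1 u" using unipotent_quadratic[OF un _ ne N] by blast
  obtain r d where r: "2 * r \<le> N" and d: "d = 0 \<or> d = (1 :: 'a) - 1"
    and "similar_mat u (quadratic_nf N r (1 - 1) d + 1 \<cdot>\<^sub>m 1\<^sub>m N)"
    using quadratic_mat_nf[OF q] by blast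
  then have sim: "similar_mat u (quadratic_nf N r 0 0 + 1 \<cdot>\<^sub>m 1\<^sub>m N)" by auto
  let ?n_as = "replicate r (2 :: nat, 1 :: 'a) @ replicate (N - 2 * r) (1, 1)"
  \<comment> \<open>This is the bound m \<ge> 1: with r = 0 the normal form is the identity.\<close>
  have "r \<noteq> 0"
  proof
    assume "r = 0"
    then have "similar_mat u (1\<^sub>m N)"
    proof -
      have "quadratic_nf N 0 0 0 + 1 \<cdot>\<^sub>m 1\<^sub>m N = (1\<^sub>m N :: 'a mat)"
        by (auto intro!: eq_matI simp: scalar_quadratic_nf)
      then show ?thesis using sim \<open>r = 0\<close> by simp
    qed
    then obtain P Q where wit: "similar_mat_wit u (1\<^sub>m N) P Q" unfolding similar_mat_def by blast
    note PQ = similar_mat_witD2[OF u wit]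
    have "u = 1\<^sub>m N" using PQ(1,3,6) by simp
    with ne show False by simp
  qed
  then have "r \<in> {1..N div 2}" using r by auto
  moreover have "jordan_nf u ?n_as"
    using similar_mat_trans[OF sim quadratic_nf_jordan[OF r]] by (auto simp: jordan_nf_def)
  moreover have "mset (map fst ?n_as) = replicate_mset r 2 + replicate_mset (N - 2 * r) 1" by simp
  ultimately show "\<exists>m\<in>{1..N div 2}. has_jordan_type u (replicate_mset m 2 + replicate_mset (N - 2 * m) 1)"
    unfolding has_jordan_type_def by metis
next
  assume "\<exists>m\<in>{1..N div 2}. has_jordan_type u (replicate_mset m 2 + replicate_mset (N - 2 * m) 1)"
  then obtain m n_as where nf: "jordan_nf u n_as"
    and ms: "mset (map fst n_as) = replicate_mset m 2 + replicate_mset (N - 2 * m) 1"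
    unfolding has_jordan_type_def by metis
  have sim: "similar_mat u (jordan_matrix n_as)" using nf unfolding jordan_nf_def by blast
  have dim: "sum_list (map fst n_as) = N"
    using similar_mat_carrier[OF similar_mat_sym[OF sim] u] by auto
  \<comment> \<open>\<open>has_jordan_type\<close> records block sizes only. Blocks of a Jordan form
    are nonempty, so each \<open>e\<close> is a root of the characteristic polynomial and hence an
    eigenvalue of \<open>u\<close>.\<close>
  have "n \<le> 2 \<and> e = 1" if ne: "(n, e) \<in> set n_as" for n e
  proof
    have "n \<in># mset (map fst n_as)" using ne by force
    then show "n \<le> 2" unfolding ms by (auto split: if_splits)
    have root: "poly (prod_list ps) e = 0" if "p \<in> set ps" "poly p e = 0" for p and ps :: "'a poly list"
      using that by (induction ps) auto
    have "n \<noteq> 0" using nf ne unfolding jordan_nf_def by force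
    have "[:- e, 1:] ^ n \<in> set (map (\<lambda>(n, a). [:- a, 1:] ^ n) n_as)" using ne by force
    moreover have "poly ([:- e, 1:] ^ n) e = 0" using \<open>n \<noteq> 0\<close> by (simp add: poly_power)
    ultimately have "poly (char_poly (jordan_matrix n_as)) e = 0"
      unfolding jordan_matrix_char_poly by (intro root)
    then have "e \<in> spectrum u"
      using spectrum_root_char_poly[OF u] char_poly_similar[OF sim] by simp
    then show "e = 1" by (rule unipotent_spectrum[OF un u])
  qed
  then have "quadratic_mat N 1 1 (jordan_matrix n_as)"
    using jordan_matrix_quadratic[of n_as] dim by simp
  then show "\<exists>a b. quadratic_mat N a b u" using similar_mat_quadratic[OF _ sim] by blast
qed

text \<open>Conjugation by \<open>J\<close> is an involution whose fixed points form the centralizer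
  of \<open>J\<close>, which by \<open>com\<close> is that of \<open>s\<close>. The centralizer of
  \<open>s\<close> is thus the full fixed group.\<close>

lemma symmetric_space_involution:
  fixes J s :: "'a::field mat"
  assumes J: "J \<in> carrier_mat N N" and JJ: "J * J = 1\<^sub>m N" and s: "s \<in> carrier_mat N N"
    and com: "\<And>g. g \<in> carrier_mat N N \<Longrightarrow> g * s = s * g \<longleftrightarrow> g * J = J * g"
  shows "symmetric_space N (group_centralizer (SL N) s)"
proof -
  let ?H = "group_centralizer (SL N) s"
  interpret SL: group "SL N :: 'a mat monoid" by (rule group_special_linear)
  have H: "g \<in> ?H \<longleftrightarrow> g \<in> carrier_mat N N \<and> det g = 1 \<and> g * s = s * g" for g
    by (auto simp: group_centralizer_def)
  have sub: "subgroup ?H (SL N)"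
  proof (rule SL.subgroupI)
    show "?H \<subseteq> carrier (SL N)" by (auto simp: group_centralizer_def)
    have "1\<^sub>m N \<in> ?H" using s by (simp add: H)
    then show "?H \<noteq> {}" by blast
  next
    fix g assume g: "g \<in> ?H"
    then have gc: "g \<in> carrier_mat N N" "det g = 1" "g * s = s * g" by (auto simp: H)
    note adj = adj_mat_special_linear[OF gc(1,2)]
    have "adj_mat g * s = adj_mat g * (s * (g * adj_mat g))" using adj s by simp
    also have "\<dots> = adj_mat g * ((s * g) * adj_mat g)" using adj(1) s gc by (simp add: mat_assoc[where N = N])
    also have "\<dots> = adj_mat g * ((g * s) * adj_mat g)" by (simp add: gc(3))
    also have "\<dots> = (adj_mat g * g) * (s * adj_mat g)" using adj(1) s gc(1) by (simp add: mat_assoc[where N = N])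
    also have "\<dots> = s * adj_mat g" unfolding adj(3) using adj(1) s by (intro left_mult_one_mat mult_carrier_mat)
    finally show "inv\<^bsub>SL N\<^esub> g \<in> ?H"
      using adj by (simp add: H inv_special_linear[OF gc(1,2)])
  next
    fix g h assume "g \<in> ?H" "h \<in> ?H"
    then have gc: "g \<in> carrier_mat N N" "det g = 1" "g * s = s * g" and hc: "h \<in> carrier_mat N N" "det h = 1" "h * s = s * h"
      by (auto simp: H)
    have "(g * h) * s = g * (s * h)" using gc(1) hc s by (simp add: mat_assoc[where N = N])
    also have "\<dots> = (g * s) * h" using gc(1) hc(1) s by (simp add: mat_assoc[where N = N])
    also have "\<dots> = s * (g * h)" unfolding gc(3) using gc(1) hc(1) s by (simp add: mat_assoc[where N = N])
    finally show "g \<otimes>\<^bsub>SL N\<^esub> h \<in> ?H" using gc hc by (simp add: H det_mult[OF gc(1) hc(1)])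
  qed
  have closed: "closedin (zariski N) ?H"
  proof -
    let ?F = "insert (\<lambda>A. det A - 1) ((\<lambda>(i, j) A. (A * s) $$ (i, j) - (s * A) $$ (i, j)) ` ({..<N} \<times> {..<N}))"
    have "closedin (zariski N) {A \<in> carrier_mat N N. \<forall>f\<in>?F. f A = 0}"
      by (rule closedin_zariski_regular)
        (auto intro!: regular_fun_diff regular_fun_det regular_map_id regular_map_entry[OF regular_map_mult]
          regular_map_const s regular_fun_const simp del: index_mult_mat)
    also have "{A \<in> carrier_mat N N. \<forall>f\<in>?F. f A = 0} = ?H"
    proof (intro Set.set_eqI)
      fix A :: "'a mat"
      have "A * s = s * A \<longleftrightarrow> (\<forall>i<N. \<forall>j<N. (A * s) $$ (i, j) = (s * A) $$ (i, j))" if "A \<in> carrier_mat N N"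
        using that s by (auto intro!: eq_matI simp del: index_mult_mat(1))
      then show "A \<in> {A \<in> carrier_mat N N. \<forall>f\<in>?F. f A = 0} \<longleftrightarrow> A \<in> ?H"
        unfolding H by (auto simp del: index_mult_mat)
    qed
    finally show ?thesis .
  qed
  define \<theta> where "\<theta> A = J * A * J" for A
  have \<theta>c: "\<theta> A \<in> carrier_mat N N" if "A \<in> carrier_mat N N" for A
    using that J unfolding \<theta>_def by (intro mult_carrier_mat)
  have \<theta>2: "\<theta> (\<theta> A) = A" if A: "A \<in> carrier_mat N N" for A
  proof -
    have "\<theta> (\<theta> A) = (J * J) * (A * (J * J))"
      unfolding \<theta>_def using A J by (simp add: mat_assoc[where N = N])
    then show ?thesis using A JJ by simp
  qed
  \<comment> \<open>\<open>J\<close> may have determinant -1 and lie outside \<open>SL N\<close>;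
    conjugation by it still preserves determinants.\<close>
  have dJ: "det J * det J = 1" using det_mult[OF J J] JJ by simp
  have \<theta>det: "det (\<theta> A) = det A" if A: "A \<in> carrier_mat N N" for A
    using det_mult[OF mult_carrier_mat[OF J A] J] det_mult[OF J A] dJ
    by (simp add: \<theta>_def mult.commute mult.left_commute)
  have \<theta>mult: "\<theta> (A * B) = \<theta> A * \<theta> B" if A: "A \<in> carrier_mat N N" and B: "B \<in> carrier_mat N N" for A B
  proof -
    have "\<theta> A * \<theta> B = J * (A * ((J * J) * (B * J)))"
      unfolding \<theta>_def using A B J by (simp add: mat_assoc[where N = N])
    also have "(J * J) * (B * J) = B * J" unfolding JJ using B J by (intro left_mult_one_mat mult_carrier_mat)
    also have "J * (A * (B * J)) = \<theta> (A * B)"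
      unfolding \<theta>_def using A B J by (simp add: mat_assoc[where N = N])
    finally show ?thesis by simp
  qed
  have reg: "regular_map N N \<theta>"
    unfolding \<theta>_def by (intro regular_map_mult regular_map_const regular_map_id J)
  have fix_iff: "\<theta> A = A \<longleftrightarrow> A * J = J * A" if A: "A \<in> carrier_mat N N" for A
  proof
    assume "\<theta> A = A"
    then have "A * J = J * A * (J * J)"
      unfolding \<theta>_def using A J assoc_mult_mat[OF mult_carrier_mat[OF J A] J J] by simp
    then show "A * J = J * A" using JJ A J right_mult_one_mat[OF mult_carrier_mat[OF J A]] by simp
  next
    assume "A * J = J * A"
    then have "\<theta> A = A * (J * J)" unfolding \<theta>_def using A J assoc_mult_mat[OF A J J] by simp
    then show "\<theta> A = A" using JJ A by simp
  qed
  have "algebraic_involution N \<theta>"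
    unfolding algebraic_involution_def
  proof (intro conjI allI impI ballI)
    have "\<theta> \<in> hom (SL N) (SL N)"
      by (rule homI) (auto simp: \<theta>c \<theta>det \<theta>mult)
    moreover have "bij_betw \<theta> (carrier (SL N)) (carrier (SL N))"
      by (rule bij_betw_byWitness[of _ \<theta>]) (auto simp: \<theta>c \<theta>det \<theta>2)
    ultimately show "\<theta> \<in> iso (SL N) (SL N)" by (simp add: iso_def)
    fix i j assume "i < N" "j < N"
    then obtain p where "p \<in> polynomial_funs N" "\<And>A. A \<in> carrier_mat N N \<Longrightarrow> \<theta> A $$ (i, j) = p A"
      using regular_map_entry[OF reg, of i j] unfolding regular_fun_def by blast
    then show "\<exists>f\<in>polynomial_funs N. \<forall>A\<in>carrier (SL N). \<theta> A $$ (i, j) = f A"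
      by (intro bexI[of _ p]) auto
  qed (simp add: \<theta>2)
  moreover have fp: "fixed_points N \<theta> = ?H"
    unfolding fixed_points_def using com fix_iff by (auto simp: H)
  moreover have "identity_component N (fixed_points N \<theta>) \<subseteq> ?H"
    using connected_component_of_subset_topspace[of "subtopology (zariski N) ?H" "1\<^sub>m N"]
    unfolding identity_component_def fp by auto
  ultimately show ?thesis
    unfolding symmetric_space_def using sub closed by blast
qed

text \<open>For a \<noteq> b, \<open>J\<close> is 1 on the a-eigenspace and -1 on the b-eigenspace.
  \<open>J\<close> and \<open>s\<close> are affine functions of each other, so they have the same
  centralizer. For a = b, \<open>s\<close> is scalar and the involution is the identity.\<close>

lemma quadratic_semisimple_symmetric:
  fixes s :: "'a::field mat"
  assumes two: "(2 :: 'a) \<noteq> 0" and ss: "semisimple_mat s" and q: "quadratic_mat N a b s"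
  shows "symmetric_space N (group_centralizer (SL N) s)"
proof -
  have s: "s \<in> carrier_mat N N" using q by (simp add: quadratic_mat_def)
  show ?thesis
  proof (cases "a = b")
    case True
    obtain D where D: "D \<in> carrier_mat N N" "diagonal_mat D" "similar_mat s D"
      "\<And>i. i < N \<Longrightarrow> D $$ (i, i) \<in> spectrum s"
      using semisimple_matD[OF ss s] by blast
    have "D $$ (i, i) = a" if "i < N" for i using D(4)[OF that] spectrum_quadratic[OF q] True by blast
    then have Da: "D = a \<cdot>\<^sub>m 1\<^sub>m N" using D(1,2) by (intro eq_matI) (auto simp: diagonal_mat_def)
    obtain P Q where wit: "similar_mat_wit s D P Q" using D(3) unfolding similar_mat_def by blast
    note PQ = similar_mat_witD2[OF s wit]
    have "s = a \<cdot>\<^sub>m 1\<^sub>m N"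
      using PQ(1,3,6,7) mult_smult_distrib[OF PQ(6) one_carrier_mat, of a] mult_smult_assoc_mat[OF PQ(6,7), of a]
      by (simp add: Da)
    then have "g * s = s * g" if "g \<in> carrier_mat N N" for g
      using that mult_smult_distrib[OF that one_carrier_mat, of a] mult_smult_assoc_mat[OF one_carrier_mat that, of a] by simp
    then show ?thesis by (intro symmetric_space_involution[of "1\<^sub>m N"] s) auto
  next
    case False
    define X where "X = s - a \<cdot>\<^sub>m 1\<^sub>m N"
    \<comment> \<open>Chosen so that 1 - k (b - a) = -1; being nonzero it allows \<open>s\<close> to
      be recovered from \<open>J\<close>.\<close>
    define k where "k = 2 / (b - a)"
    define J where "J = 1\<^sub>m N - k \<cdot>\<^sub>m X"
    have k: "k \<noteq> 0" "k * (k * (b - a)) = k + k" using False two by (simp_all add: k_def field_simps)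
    have X: "X \<in> carrier_mat N N" using s by (simp add: X_def minus_carrier_mat)
    have J: "J \<in> carrier_mat N N" using X by (simp add: J_def minus_carrier_mat)
    have gJ: "g * J = g - k \<cdot>\<^sub>m (g * X)" "J * g = g - k \<cdot>\<^sub>m (X * g)" if g: "g \<in> carrier_mat N N" for g
      unfolding J_def
      using g mult_minus_distrib_mat[OF g one_carrier_mat smult_carrier_mat[OF X]] mult_smult_distrib[OF g X]
        minus_mult_distrib_mat[OF one_carrier_mat smult_carrier_mat[OF X] g] mult_smult_assoc_mat[OF X g]
      by simp_all
    have gX: "g * X = g * s - a \<cdot>\<^sub>m g" "X * g = s * g - a \<cdot>\<^sub>m g" if g: "g \<in> carrier_mat N N" for g
      unfolding X_def
      using g mult_minus_distrib_mat[OF g s smult_carrier_mat[OF one_carrier_mat]] mult_smult_distrib[OF g one_carrier_mat]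
        minus_mult_distrib_mat[OF s smult_carrier_mat[OF one_carrier_mat] g] mult_smult_assoc_mat[OF one_carrier_mat g]
      by simp_all
    show ?thesis
    proof (rule symmetric_space_involution[OF J _ s])
      have "X * X = (b - a) \<cdot>\<^sub>m X" unfolding X_def by (rule quadratic_mat_shift[OF q])
      then have "J * J = J - k \<cdot>\<^sub>m (X - k \<cdot>\<^sub>m ((b - a) \<cdot>\<^sub>m X))"
        using gJ(1)[OF J] gJ(2)[OF X] by simp
      also have "\<dots> = 1\<^sub>m N"
      proof (rule eq_matI)
        fix i j assume "i < dim_row (1\<^sub>m N :: 'a mat)" "j < dim_col (1\<^sub>m N :: 'a mat)"
        then have ij: "i < N" "j < N" by auto
        have "(J - k \<cdot>\<^sub>m (X - k \<cdot>\<^sub>m ((b - a) \<cdot>\<^sub>m X))) $$ (i, j) =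
            1\<^sub>m N $$ (i, j) + (k * (k * (b - a)) - (k + k)) * X $$ (i, j)"
          using ij X by (simp add: J_def algebra_simps del: index_one_mat(1))
        then show "(J - k \<cdot>\<^sub>m (X - k \<cdot>\<^sub>m ((b - a) \<cdot>\<^sub>m X))) $$ (i, j) = 1\<^sub>m N $$ (i, j)"
          by (simp add: k(2))
      qed (use X in auto)
      finally show "J * J = 1\<^sub>m N" .
      fix g :: "'a mat" assume g: "g \<in> carrier_mat N N"
      have "(g * J) $$ (i, j) = (J * g) $$ (i, j) \<longleftrightarrow> (g * s) $$ (i, j) = (s * g) $$ (i, j)"
        if "i < N" "j < N" for i j
        unfolding gJ[OF g] gX[OF g] using that g s k(1) by (simp del: index_mult_mat(1))
      moreover have eq: "A = B \<longleftrightarrow> (\<forall>i<N. \<forall>j<N. A $$ (i, j) = B $$ (i, j))"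
        if "A \<in> carrier_mat N N" "B \<in> carrier_mat N N" for A B :: "'a mat"
        using that by (auto intro: eq_matI)
      ultimately show "g * s = s * g \<longleftrightarrow> g * J = J * g"
        unfolding eq[OF mult_carrier_mat[OF g s] mult_carrier_mat[OF s g]]
          eq[OF mult_carrier_mat[OF g J] mult_carrier_mat[OF J g]] by blast
    qed
  qed
qed

text \<open>For a \<noteq> b the class is diagonalizable and z = 1 works. For a = b the determinant
  puts the scalar 1/a into the group, where it is central, and multiplying by it moves the single
  eigenvalue to 1.\<close>

lemma quadratic_central_translate:
  fixes x :: "'a::alg_closed_field mat"
  assumes q: "quadratic_mat N a b x" and d: "det x = 1" and N: "N > 0"
  shows "\<exists>z\<in>group_center (SL N).
    (\<forall>y\<in>z <#\<^bsub>SL N\<^esub> conj_class (SL N) x. semisimple_mat y) \<or>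
    (\<forall>y\<in>z <#\<^bsub>SL N\<^esub> conj_class (SL N) x. unipotent_mat y)"
proof -
  have x: "x \<in> carrier_mat N N" using q by (simp add: quadratic_mat_def)
  have C: "conj_class (SL N) x = {A. similar_mat A x}" by (rule conj_class_special_linear[OF x N])
  have qC: "quadratic_mat N a b A" if "similar_mat A x" for A by (rule similar_mat_quadratic[OF q that])
  have scal: "(c \<cdot>\<^sub>m 1\<^sub>m N) * g = c \<cdot>\<^sub>m g" "g * (c \<cdot>\<^sub>m 1\<^sub>m N) = c \<cdot>\<^sub>m g" if "g \<in> carrier_mat N N" for g :: "'a mat" and c
    using that mult_smult_distrib[OF that one_carrier_mat, of c] mult_smult_assoc_mat[OF one_carrier_mat that, of c] by auto
  show ?thesis
  proof (cases "a = b")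
    case False
    have "1\<^sub>m N \<in> group_center (SL N)" by (auto simp: group_center_def)
    moreover have "semisimple_mat y" if "y \<in> 1\<^sub>m N <#\<^bsub>SL N\<^esub> conj_class (SL N) x" for y
    proof -
      obtain A where A: "similar_mat A x" "y = 1\<^sub>m N * A"
        using \<open>y \<in> _\<close> unfolding C l_coset_def special_linear_simps(2) by blast
      then have "y = A" using similar_mat_carrier[OF A(1) x] by simp
      then show ?thesis using quadratic_distinct_semisimple[OF qC[OF A(1)] False] by simp
    qed
    ultimately show ?thesis by blast
  next
    case True
    have aN: "a ^ N = 1" using quadratic_double_det[of N a x] q True d by simp
    then have a0: "a \<noteq> 0" using N by (auto simp: zero_power)
    let ?z = "(1 / a) \<cdot>\<^sub>m 1\<^sub>m N :: 'a mat"
    have "det ?z = 1" using aN by (simp add: det_smult power_one_over)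
    then have "?z \<in> group_center (SL N)" by (auto simp: group_center_def scal)
    moreover have "unipotent_mat y" if y: "y \<in> ?z <#\<^bsub>SL N\<^esub> conj_class (SL N) x" for y
    proof (rule quadratic_one_unipotent)
      obtain A where A: "similar_mat A x" "y = ?z * A"
        using y unfolding C l_coset_def special_linear_simps(2) by blast
      have Ac: "A \<in> carrier_mat N N" by (rule similar_mat_carrier[OF A(1) x])
      then have y: "y = (1 / a) \<cdot>\<^sub>m A" using A(2) scal by simp
      let ?X = "A - a \<cdot>\<^sub>m 1\<^sub>m N"
      have X: "?X \<in> carrier_mat N N" using Ac by (simp add: minus_carrier_mat)
      have e: "y - 1 \<cdot>\<^sub>m 1\<^sub>m N = (1 / a) \<cdot>\<^sub>m ?X"
        unfolding y using Ac a0 by (intro eq_matI) (auto simp: field_simps)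
      have "?X * ?X = 0\<^sub>m N N" using qC[OF A(1)] True by (simp add: quadratic_mat_def)
      then have "((1 / a) \<cdot>\<^sub>m ?X) * ((1 / a) \<cdot>\<^sub>m ?X) = 0\<^sub>m N N"
        using mult_smult_assoc_mat[OF X smult_carrier_mat[OF X]] mult_smult_distrib[OF X X] by simp
      then show "quadratic_mat N 1 1 y" using Ac unfolding quadratic_mat_def e by (simp add: y)
    qed
    ultimately show ?thesis by blast
  qed
qed

lemma two_neq_zero:
  assumes "odd CHAR('a::field)"
  shows "(2 :: 'a) \<noteq> 0"
proof
  assume "(2 :: 'a) = 0"
  then have "of_nat 2 = (0 :: 'a)" by simp
  then have "CHAR('a) dvd 2" by (simp only: of_nat_eq_0_iff_char_dvd)
  then have "CHAR('a) = 1 \<or> CHAR('a) = 2" using prime_nat_iff two_is_prime_nat by blast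
  then show False using assms CHAR_not_1[where 'a = 'a] by auto
qed

theorem theorem3p2:
  fixes n :: nat and G :: "'k::alg_closed_field mat monoid"
  assumes "odd CHAR('k)" and "n \<ge> 1" and "G = special_linear (n + 1)"
  shows "(n = 1 \<longrightarrow> (\<forall>C\<in>conj_classes G. spherical_class (n + 1) C)) \<and>
    (n \<ge> 2 \<longrightarrow>
      (\<forall>C\<in>conj_classes G. spherical_class (n + 1) C \<longrightarrow>
         (\<exists>z\<in>group_center G.
            (\<forall>x\<in>z <#\<^bsub>G\<^esub> C. semisimple_mat x) \<or> (\<forall>x\<in>z <#\<^bsub>G\<^esub> C. unipotent_mat x))) \<and>
      (\<forall>s\<in>carrier G. semisimple_mat s \<longrightarrow>
         (spherical_class (n + 1) (conj_class G s) \<longleftrightarrow> card (spectrum s) \<le> 2) \<and>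
         (spherical_class (n + 1) (conj_class G s) \<longrightarrow>
            symmetric_space (n + 1) (group_centralizer G s))) \<and>
      (\<forall>u\<in>carrier G. unipotent_mat u \<and> u \<noteq> \<one>\<^bsub>G\<^esub> \<longrightarrow>
         (spherical_class (n + 1) (conj_class G u) \<longleftrightarrow>
            (\<exists>m\<in>{1..(n + 1) div 2}.
               has_jordan_type u (replicate_mset m 2 + replicate_mset (n + 1 - 2 * m) 1)))))"
proof -
  let ?N = "n + 1"
  have N: "?N > 0" by simp
  have two: "(2 :: 'k) \<noteq> 0" by (rule two_neq_zero[OF assms(1)])
  have G: "G = special_linear ?N" by (rule assms(3))
  have sph: "spherical_class ?N (conj_class G x) \<longleftrightarrow> (\<exists>a b. quadratic_mat ?N a b x)"
    if "x \<in> carrier G" for x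
    unfolding G by (rule spherical_class_iff_quadratic[OF two N]) (use that in \<open>simp add: G\<close>)
  show ?thesis
  proof (intro conjI impI ballI)
    fix C assume n: "n = 1" and "C \<in> conj_classes G"
    then obtain x where x: "x \<in> carrier G" "C = conj_class G x" unfolding conj_classes_def by blast
    then have "x \<in> carrier_mat 2 2" by (simp add: G n numeral_2_eq_2)
    then show "spherical_class ?N C"
      using sph[OF x(1)] quadratic_mat_2[of x] by (simp add: x(2) n numeral_2_eq_2)
  next
    fix C assume "C \<in> conj_classes G" and s: "spherical_class ?N C"
    then obtain x where x: "x \<in> carrier G" "C = conj_class G x" unfolding conj_classes_def by blast
    then obtain a b where "quadratic_mat ?N a b x" using sph s by blast
    from quadratic_central_translate[OF this _ N] x(1)
    show "\<exists>z\<in>group_center G. (\<forall>x\<in>z <#\<^bsub>G\<^esub> C. semisimple_mat x) \<or> (\<forall>x\<in>z <#\<^bsub>G\<^esub> C. unipotent_mat x)"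
      unfolding x(2) G by simp
  next
    fix s assume s: "s \<in> carrier G" and ss: "semisimple_mat s"
    have sc: "s \<in> carrier_mat ?N ?N" using s by (simp add: G)
    show "spherical_class ?N (conj_class G s) \<longleftrightarrow> card (spectrum s) \<le> 2"
      using sph[OF s] semisimple_spherical_iff[OF ss sc] by simp
    show "symmetric_space ?N (group_centralizer G s)" if "spherical_class ?N (conj_class G s)"
      using that sph[OF s] quadratic_semisimple_symmetric[OF two ss] unfolding G by blast
  next
    fix u assume u: "u \<in> carrier G" and un: "unipotent_mat u \<and> u \<noteq> \<one>\<^bsub>G\<^esub>"
    have uc: "u \<in> carrier_mat ?N ?N" and u1: "u \<noteq> 1\<^sub>m ?N" using u un by (simp_all add: G)
    show "spherical_class ?N (conj_class G u) \<longleftrightarrow>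
      (\<exists>m\<in>{1..(n + 1) div 2}. has_jordan_type u (replicate_mset m 2 + replicate_mset (n + 1 - 2 * m) 1))"
      using sph[OF u] unipotent_jordan_type_iff[OF conjunct1[OF un] uc u1 N] by simp
  qed
qed

end
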